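(* Let $d=2^n$. Suppose an unknown $n$-qubit channel $\mathcal{C}$ is, each with probability $1/3$, one of: $\rho\mapsto U\rho U^\dagger$ for a fixed Haar-random $U\in U(d)$; $\rho\mapsto O\rho O^t$ for a fixed Haar-random $O\in O(d)$; or $\rho\mapsto S\rho S^\dagger$ for a fixed Haar-random $S\in\mathrm{Sp}(d/2)$. Any learning algorithm without quantum memory (for channels) that identifies which of the three classes $\mathcal{C}$ comes from with success probability at least $2/3$ must use $T\ge\Omega(2^{2n/7})$ applications of $\mathcal{C}$.
   Context: $U(d)$ is the unitary group, $O(d)=\{O\in U(d):O^t=O^{-1}\}$, and $\mathrm{Sp}(d/2)=\{S\in U(d): JS^tJ^{-1}=S^{-1}\}$ with $J=\begin{pmatrix}0&I_{d/2}\\-I_{d/2}&0\end{pmatrix}$, each with its Haar probability measure. A learning algorithm without quantum memory for an unknown $n$-qubit channel $\mathcal{C}$, using $T$ applications, proceeds in $T$ rounds, with an auxiliary register of an arbitrary number $n'\ge0$ of qubits: in each round it chooses (depending arbitrarily on all previously observed classical outcomes) a pure state $|\phi\rangle$ on $n+n'$ qubits and a POVM $\{F_s\}_s$ on $n+n'$ qubits, applies $\mathcal{C}$ to the first $n$ qubits, and observes outcome $s$ with probability $\mathrm{Tr}\big(F_s(\mathcal{C}\otimes\mathrm{id})(|\phi\rangle\langle\phi|)\big)$; no quantum state is retained between rounds. Its final output is an arbitrary function of the classical outcomes. *)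

theory Defs
  imports "HOL-Probability.Probability" "Jordan_Normal_Form.Matrix"
begin

definition adj :: "complex mat \<Rightarrow> complex mat" where
  "adj A = mat (dim_col A) (dim_row A) (\<lambda>(i,j). cnj (A $$ (j,i)))"

definition mtrace :: "complex mat \<Rightarrow> complex" where
  "mtrace A = (\<Sum>i<dim_row A. A $$ (i,i))"

text \<open>Kronecker product; the first factor acts on the first (most significant) qubits.\<close>
definition kron :: "complex mat \<Rightarrow> complex mat \<Rightarrow> complex mat" where
  "kron A B = mat (dim_row A * dim_row B) (dim_col A * dim_col B)
     (\<lambda>(i,j). A $$ (i div dim_row B, j div dim_col B) * B $$ (i mod dim_row B, j mod dim_col B))"

definition outer :: "complex vec \<Rightarrow> complex mat" where
  "outer v = mat (dim_vec v) (dim_vec v) (\<lambda>(i,j). v $ i * cnj (v $ j))"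

definition qform :: "complex mat \<Rightarrow> complex vec \<Rightarrow> complex" where
  "qform F v = (\<Sum>i<dim_vec v. \<Sum>j<dim_vec v. cnj (v $ i) * F $$ (i,j) * v $ j)"

definition sqnorm :: "complex vec \<Rightarrow> real" where
  "sqnorm v = (\<Sum>i<dim_vec v. (cmod (v $ i))\<^sup>2)"

definition psd :: "nat \<Rightarrow> complex mat \<Rightarrow> bool" where
  "psd D F \<longleftrightarrow> F \<in> carrier_mat D D \<and> adj F = F \<and>
     (\<forall>v \<in> carrier_vec D. Re (qform F v) \<ge> 0)"

text \<open>POVM on a D-dimensional space with (countably many) outcomes indexed by nat:
  positive semidefinite effects summing to the identity (weak-operator sum).\<close>
definition is_povm :: "nat \<Rightarrow> (nat \<Rightarrow> complex mat) \<Rightarrow> bool" where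
  "is_povm D F \<longleftrightarrow> (\<forall>s. psd D (F s)) \<and>
     (\<forall>v \<in> carrier_vec D. (\<lambda>s. Re (qform (F s) v)) sums sqnorm v)"

definition unitary_group :: "nat \<Rightarrow> complex mat set" where
  "unitary_group d = {U \<in> carrier_mat d d. adj U * U = 1\<^sub>m d \<and> U * adj U = 1\<^sub>m d}"

text \<open>O(d) = {O in U(d). O^t = O^-1}; since O is unitary, O^-1 = O^dagger.\<close>
definition orthogonal_group :: "nat \<Rightarrow> complex mat set" where
  "orthogonal_group d = {Q \<in> unitary_group d. transpose_mat Q = adj Q}"

definition sympJ :: "nat \<Rightarrow> complex mat" where
  "sympJ d = mat d d (\<lambda>(i,j). if i < d div 2 \<and> j = i + d div 2 then 1
                              else if j < d div 2 \<and> i = j + d div 2 then -1 else 0)"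

text \<open>Sp(d/2) = {S in U(d). J S^t J^-1 = S^-1}; here J^-1 = -J and S^-1 = S^dagger.\<close>
definition symplectic_group :: "nat \<Rightarrow> complex mat set" where
  "symplectic_group d = {S \<in> unitary_group d.
      sympJ d * transpose_mat S * (- sympJ d) = adj S}"

definition mat_borel :: "nat \<Rightarrow> complex mat measure" where
  "mat_borel d = sigma (carrier_mat d d)
     {{M \<in> carrier_mat d d. M $$ (i,j) \<in> A} | i j A. i < d \<and> j < d \<and> A \<in> sets borel}"

definition haar_prob :: "nat \<Rightarrow> complex mat set \<Rightarrow> complex mat measure \<Rightarrow> bool" where
  "haar_prob d G \<mu> \<longleftrightarrow> sets \<mu> = sets (mat_borel d) \<and> prob_space \<mu> \<and>
     G \<in> sets \<mu> \<and> emeasure \<mu> G = 1 \<and>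
     (\<forall>g \<in> G. \<forall>A \<in> sets \<mu>. emeasure \<mu> {M \<in> space \<mu>. g * M \<in> A} = emeasure \<mu> A)"

text \<open>Adaptive strategy: auxiliary register of aux qubits; from the history of
  previous outcomes it chooses an input pure state and a POVM; finally it outputs
  a label (0 = unitary class, 1 = orthogonal class, 2 = symplectic class).\<close>
record learner =
  aux   :: nat
  state :: "nat list \<Rightarrow> complex vec"
  meas  :: "nat list \<Rightarrow> nat \<Rightarrow> complex mat"
  guess :: "nat list \<Rightarrow> nat"

definition valid_learner :: "nat \<Rightarrow> learner \<Rightarrow> bool" where
  "valid_learner n L \<longleftrightarrow> (\<forall>h. state L h \<in> carrier_vec (2 ^ (n + aux L)) \<and>
      sqnorm (state L h) = 1 \<and> is_povm (2 ^ (n + aux L)) (meas L h))"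

text \<open>Probability of outcome s after history h when the channel is rho |-> A rho B
  (applied to the first n qubits, identity on the auxiliary register).\<close>
definition out_prob :: "learner \<Rightarrow> complex mat \<Rightarrow> complex mat \<Rightarrow> nat list \<Rightarrow> nat \<Rightarrow> real" where
  "out_prob L A B h s = Re (mtrace (meas L h s *
      (kron A (1\<^sub>m (2 ^ aux L)) * outer (state L h) * kron B (1\<^sub>m (2 ^ aux L)))))"

primrec run :: "learner \<Rightarrow> complex mat \<Rightarrow> complex mat \<Rightarrow> nat \<Rightarrow> nat \<Rightarrow> nat list \<Rightarrow> real" where
  "run L A B c 0 h = (if guess L h = c then 1 else 0)"
| "run L A B c (Suc k) h = (\<Sum>s. out_prob L A B h s * run L A B c k (h @ [s]))"

definition success_prob :: "learner \<Rightarrow> nat \<Rightarrow> complex mat measure \<Rightarrow> complex mat measure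
      \<Rightarrow> complex mat measure \<Rightarrow> real" where
  "success_prob L T \<mu>U \<mu>O \<mu>S = (1/3) *
     ((\<integral>U. run L U (adj U) 0 T [] \<partial>\<mu>U) +
      (\<integral>Q. run L Q (transpose_mat Q) 1 T [] \<partial>\<mu>O) +
      (\<integral>S. run L S (adj S) 2 T [] \<partial>\<mu>S))"

end

(* The three average success events are compared with the completely depolarizing channel. The
   probability of a path of outcomes is a product of T factors |l_t(U)|^2 with linear forms l_t in the
   entries of U (after splitting each effect into rank-one pieces), and it suffices to show that its Haar
   average is at least (1 - o(1)) times the depolarizing value, the product of |l_t|^2 / d, in each group:
   then no final decision has average probability exceeding its depolarizing value by more than o(1), and the
   three depolarizing values sum to at most 1.

   For the lower bound, multiply U on both sides by sign-Hadamard matrices, which lie in all three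
   groups, so that no row or column carries a large part of any l_t. In the expansion of the product, the monomials
   whose entries lie in distinct rows and columns (up to the symplectic pairing) are orthogonal to all others,
   so the others can be dropped. The Gram matrix of the remaining ones is diagonally dominant, by a recursion
   for mixed moments that only uses real rotations of two rows. The errors are o(1) for
   T = o(d^(1/3)), which is more than the exponent 2/7 asks for. *)
theory Submission
  imports Defs "HOL-Combinatorics.Permutations" "HOL-Real_Asymp.Real_Asymp"
begin

section \<open>Sign choices\<close>

text \<open>A linear form that comes from a product input may sit on a single row of U, and T forms
  on the same row leave no monomial with distinct rows; flattening removes this obstacle at the
  price of a logarithmic factor. Rows and columns are compared up to pairing because the entry of a
  symplectic matrix at the partner position is the conjugate of the given entry up to sign. Haar
  measures are given by left invariance. Flattening from the right therefore passes to a translated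
  measure, and columns are compared through the moment recursion. The decay parameter \<theta>
  satisfies \<theta>^2 d = 2 T: a step of the recursion gains a factor d, has about 2 T terms, and
  may repair two mismatched columns at once. An off-diagonal row sum of the Gram matrix then has
  relative size T \<theta> = T sqrt (2 T / d), which is where d^(1/3) comes from; the logarithms
  enter only through a term T^2 log^2 / d, of smaller order in that range. Lower bounds suffice
  because the path laws have total mass one: a lower bound for the complement of a decision is an
  upper bound for the decision.\<close>

lemma cosh_le_exp_half_square: "cosh (x::real) \<le> exp (x\<^sup>2 / 2)"
proof -
  \<comment> \<open>This comparison of coefficients makes the series of cosh x, whose odd terms
    vanish, termwise at most the series of exp (x^2 / 2).\<close>
  have f: "2 ^ n * fact n \<le> (fact (2 * n) :: real)" for n
  proof (induction n)
    case (Suc n)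
    have "2 ^ Suc n * fact (Suc n) = (2 * (real n + 1)) * (2 ^ n * fact n)"
      by (simp add: algebra_simps)
    also have "\<dots> \<le> (2 * (real n + 1)) * fact (2 * n)"
      using Suc by (intro mult_left_mono) auto
    also have "\<dots> \<le> (2 * (real n + 1)) * ((2 * real n + 1) * fact (2 * n))"
      by (intro mult_left_mono) (auto simp: algebra_simps)
    also have "\<dots> = fact (2 * Suc n)"
      by (simp add: algebra_simps)
    finally show ?case .
  qed simp
  have c: "(\<lambda>n. if even n then x ^ n /\<^sub>R fact n else 0) sums cosh x"
    by (rule cosh_converges)
  have "(\<lambda>n. x ^ (2 * n) /\<^sub>R fact (2 * n)) sums cosh x"
  proof -
    have "(\<lambda>n. (\<lambda>n. if even n then x ^ n /\<^sub>R fact n else 0) (2 * n)) sums cosh x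
        \<longleftrightarrow> (\<lambda>n. if even n then x ^ n /\<^sub>R fact n else 0) sums cosh x"
      by (rule sums_mono_reindex) (auto simp: strict_mono_def elim: oddE)
    then show ?thesis using c by simp
  qed
  moreover have "(\<lambda>n. (x\<^sup>2 / 2) ^ n /\<^sub>R fact n) sums exp (x\<^sup>2 / 2)"
    by (rule exp_converges)
  moreover have "x ^ (2 * n) /\<^sub>R fact (2 * n) \<le> (x\<^sup>2 / 2) ^ n /\<^sub>R fact n" for n
  proof -
    have "x ^ (2 * n) /\<^sub>R fact (2 * n) = x ^ (2 * n) / fact (2 * n)"
      by (simp add: field_simps)
    also have "\<dots> \<le> x ^ (2 * n) / (2 ^ n * fact n)"
      using f[of n] by (intro divide_left_mono) auto
    also have "\<dots> = (x\<^sup>2 / 2) ^ n /\<^sub>R fact n"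
      by (simp add: power_divide field_simps flip: power_mult)
    finally show ?thesis .
  qed
  ultimately show ?thesis by (rule sums_le[rotated])
qed

text \<open>Signs are chosen by conditional expectation: the two choices of the last sign have
  average \<open>cosh (S e) * cosh (a e n)\<close>, so one of them does not exceed the average. The
  weights \<open>w\<close> carry the factor \<open>cosh (a e n)\<close> while the earlier signs are
  chosen.\<close>

lemma exists_signs_cosh:
  fixes a :: "'e \<Rightarrow> nat \<Rightarrow> real"
  assumes "\<And>e. e \<in> E \<Longrightarrow> 0 \<le> w e"
  shows "\<exists>\<epsilon>. (\<forall>i. \<epsilon> i = 1 \<or> \<epsilon> i = -1) \<and>
     (\<Sum>e\<in>E. w e * cosh (\<Sum>i<n. \<epsilon> i * a e i)) \<le> (\<Sum>e\<in>E. w e * (\<Prod>i<n. cosh (a e i)))"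
  using assms
proof (induction n arbitrary: w)
  case 0
  show ?case by (intro exI[of _ "\<lambda>_. 1"]) simp
next
  case (Suc n)
  obtain \<epsilon> where e1: "\<And>i. \<epsilon> i = 1 \<or> \<epsilon> i = -1" and
    e2: "(\<Sum>e\<in>E. (w e * cosh (a e n)) * cosh (\<Sum>i<n. \<epsilon> i * a e i))
       \<le> (\<Sum>e\<in>E. (w e * cosh (a e n)) * (\<Prod>i<n. cosh (a e i)))"
    using Suc.IH[of "\<lambda>e. w e * cosh (a e n)"] Suc.prems by force
  define S where "S e = (\<Sum>i<n. \<epsilon> i * a e i)" for e
  have "(\<Sum>e\<in>E. w e * cosh (S e + a e n)) + (\<Sum>e\<in>E. w e * cosh (S e - a e n))
      = 2 * (\<Sum>e\<in>E. (w e * cosh (a e n)) * cosh (S e))"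
    by (simp add: cosh_add cosh_diff algebra_simps sum_distrib_left flip: sum.distrib)
  then have "(\<Sum>e\<in>E. w e * cosh (S e + a e n)) + (\<Sum>e\<in>E. w e * cosh (S e - a e n))
      \<le> 2 * (\<Sum>e\<in>E. w e * (\<Prod>i<Suc n. cosh (a e i)))"
    using e2 by (simp add: S_def algebra_simps)
  then consider "(\<Sum>e\<in>E. w e * cosh (S e + a e n)) \<le> (\<Sum>e\<in>E. w e * (\<Prod>i<Suc n. cosh (a e i)))"
    | "(\<Sum>e\<in>E. w e * cosh (S e - a e n)) \<le> (\<Sum>e\<in>E. w e * (\<Prod>i<Suc n. cosh (a e i)))"
    by linarith
  then obtain s :: real where s: "s = 1 \<or> s = -1"
    "(\<Sum>e\<in>E. w e * cosh (S e + s * a e n)) \<le> (\<Sum>e\<in>E. w e * (\<Prod>i<Suc n. cosh (a e i)))"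
  proof cases
    case 1 then show ?thesis using that[of 1] by simp
  next
    case 2 then show ?thesis using that[of "-1"] by simp
  qed
  show ?case
    using e1 s by (intro exI[of _ "\<epsilon>(n := s)"]) (auto simp: S_def)
qed

text \<open>With each family divided by its Euclidean norm, the potential of the previous lemma is
  at most \<open>card E * exp (1/2)\<close>, and so is each of its summands. Since exp |s| is at
  most 2 cosh s, all signed sums are at most \<open>ln (2 * card E) + 1/2\<close> times their norms
  simultaneously.\<close>

lemma exists_signs:
  fixes a :: "'e \<Rightarrow> nat \<Rightarrow> real"
  assumes "finite E" "E \<noteq> {}"
  shows "\<exists>\<epsilon>. (\<forall>i. \<epsilon> i = 1 \<or> \<epsilon> i = -1) \<and>
     (\<forall>e\<in>E. (\<Sum>i<n. \<epsilon> i * a e i)\<^sup>2 \<le> (ln (2 * card E) + 1/2)\<^sup>2 * (\<Sum>i<n. (a e i)\<^sup>2))"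
proof -
  define \<sigma> where "\<sigma> e = sqrt (\<Sum>i<n. (a e i)\<^sup>2)" for e
  obtain \<epsilon> where e1: "\<And>i. \<epsilon> i = 1 \<or> \<epsilon> i = -1" and
    e2: "(\<Sum>e\<in>E. 1 * cosh (\<Sum>i<n. \<epsilon> i * (a e i / \<sigma> e)))
       \<le> (\<Sum>e\<in>E. 1 * (\<Prod>i<n. cosh (a e i / \<sigma> e)))"
    using exists_signs_cosh[where w = "\<lambda>_. 1" and a = "\<lambda>e i. a e i / \<sigma> e" and n = n and E = E]
    by force
  have pr: "(\<Prod>i<n. cosh (a e i / \<sigma> e)) \<le> exp (1/2)" for e
  proof -
    have "(\<Prod>i<n. cosh (a e i / \<sigma> e)) \<le> (\<Prod>i<n. exp ((a e i / \<sigma> e)\<^sup>2 / 2))"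
      by (intro prod_mono) (auto intro: cosh_le_exp_half_square)
    also have "\<dots> = exp ((\<Sum>i<n. (a e i)\<^sup>2) / (\<sigma> e)\<^sup>2 / 2)"
      by (simp add: exp_sum power_divide sum_divide_distrib)
    \<comment> \<open>If \<open>\<sigma> e = 0\<close>, the quotient is 0 by convention and the
      bound still holds.\<close>
    also have "\<dots> \<le> exp (1/2)"
      by (auto simp: \<sigma>_def sum_nonneg)
    finally show ?thesis .
  qed
  have "(\<Sum>i<n. \<epsilon> i * a e i)\<^sup>2 \<le> (ln (2 * card E) + 1/2)\<^sup>2 * (\<Sum>i<n. (a e i)\<^sup>2)" if e: "e \<in> E" for e
  proof (cases "\<sigma> e = 0")
    case True
    then have "(\<Sum>i<n. (a e i)\<^sup>2) = 0" by (simp add: \<sigma>_def)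
    then have "\<forall>i<n. a e i = 0" by (subst (asm) sum_nonneg_eq_0_iff) auto
    then show ?thesis by simp
  next
    case False
    then have sp: "\<sigma> e > 0" by (simp add: \<sigma>_def less_le sum_nonneg)
    define s where "s = (\<Sum>i<n. \<epsilon> i * (a e i / \<sigma> e))"
    have "cosh s \<le> (\<Sum>e\<in>E. cosh (\<Sum>i<n. \<epsilon> i * (a e i / \<sigma> e)))"
      unfolding s_def by (rule member_le_sum[OF e]) (auto simp: assms)
    also have "\<dots> \<le> (\<Sum>e\<in>E. exp (1/2))"
      using e2 sum_mono[of E "\<lambda>e. \<Prod>i<n. cosh (a e i / \<sigma> e)" "\<lambda>_. exp (1/2)", OF pr] by simp
    finally have c: "cosh s \<le> card E * exp (1/2)" by simp
    have "exp \<bar>s\<bar> \<le> 2 * cosh s"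
      by (auto simp: cosh_def abs_if)
    also have "\<dots> \<le> (2 * card E) * exp (1/2)" using c by simp
    finally have "exp \<bar>s\<bar> \<le> exp (ln (2 * card E) + 1/2)"
      using assms by (simp add: exp_add card_gt_0_iff)
    then have "\<bar>s\<bar> \<le> ln (2 * card E) + 1/2" by simp
    then have "s\<^sup>2 \<le> (ln (2 * card E) + 1/2)\<^sup>2"
      by (metis abs_ge_zero power2_abs power_mono)
    then have "s\<^sup>2 * (\<sigma> e)\<^sup>2 \<le> (ln (2 * card E) + 1/2)\<^sup>2 * (\<sigma> e)\<^sup>2"
      by (intro mult_right_mono) auto
    moreover have "(\<Sum>i<n. \<epsilon> i * a e i) = s * \<sigma> e"
      using sp by (simp add: s_def sum_distrib_right)
    ultimately show ?thesis
      by (simp add: \<sigma>_def sum_nonneg power_mult_distrib)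
  qed
  then show ?thesis using e1 by blast
qed

text \<open>The Sylvester-Hadamard matrix without normalization: for i, j below 2^n the entry is -1
  to the number of binary places where both i and j have digit 1. The recursion peels off the lowest
  digit.\<close>

fun had :: "nat \<Rightarrow> nat \<Rightarrow> nat \<Rightarrow> real" where
  "had 0 i j = 1"
| "had (Suc n) i j = had n (i div 2) (j div 2) * (if odd i \<and> odd j then -1 else 1)"

lemma had_sym: "had n i j = had n j i"
  by (induction n arbitrary: i j) auto

lemma had_square: "(had n i j)\<^sup>2 = 1"
  by (induction n arbitrary: i j) (auto simp: power_mult_distrib)

lemma sum_lessThan_double:
  fixes f :: "nat \<Rightarrow> 'a::comm_monoid_add"
  shows "(\<Sum>k<2 * n. f k) = (\<Sum>k<n. f (2 * k)) + (\<Sum>k<n. f (2 * k + 1))"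
  by (induction n) (auto simp: algebra_simps)

text \<open>Splitting the summation index by parity gives (1 + s) times the inner product one level
  down, where s = -1 exactly when the lowest digits of i and j differ.\<close>

lemma had_orthogonal:
  assumes "i < 2 ^ n" "j < 2 ^ n"
  shows "(\<Sum>k<2 ^ n. had n i k * had n j k) = (if i = j then 2 ^ n else 0)"
  using assms
proof (induction n arbitrary: i j)
  case (Suc n)
  have b: "i div 2 < 2 ^ n" "j div 2 < 2 ^ n" using Suc.prems by auto
  define S where "S = (\<Sum>k<2 ^ n. had n (i div 2) k * had n (j div 2) k)"
  define s where "s = (if odd i \<longleftrightarrow> odd j then 1 else -1 :: real)"
  have S: "S = (if i div 2 = j div 2 then 2 ^ n else 0)"
    unfolding S_def using Suc.IH[OF b] .
  have "(\<Sum>k<2 ^ Suc n. had (Suc n) i k * had (Suc n) j k) =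
     S + (\<Sum>k<2 ^ n. s * (had n (i div 2) k * had n (j div 2) k))"
    unfolding power_Suc sum_lessThan_double S_def s_def
    by (intro arg_cong2[of _ _ _ _ "(+)"] sum.cong) auto
  also have "\<dots> = S + s * S" by (simp add: S_def sum_distrib_left)
  also have "\<dots> = (if i = j then 2 ^ Suc n else 0)"
    unfolding S s_def using div_mult_mod_eq[of i 2] div_mult_mod_eq[of j 2]
    by (auto simp: odd_iff_mod_2_eq_one) (metis even_iff_mod_2_eq_zero mod_div_mult_eq odd_iff_mod_2_eq_one)+
  finally show ?case .
qed simp

section \<open>Permutations and matchings\<close>

text \<open>Permutations are grouped by the set of points they move. At most r! of them move exactly
  a given set of size r, and there are \<open>card A choose r\<close> such sets, so size r
  contributes at most the r-th power of \<open>card A * \<theta>\<close>. The geometric series with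
  ratio at most 1/2 gives the factor 2.\<close>

lemma sum_permutes_moved_le:
  fixes \<theta> :: real
  assumes "finite A" "0 \<le> \<theta>" "card A * \<theta> \<le> 1 / 2"
  shows "(\<Sum>\<rho>\<in>{\<rho>. \<rho> permutes A} - {id}. \<theta> ^ card {a \<in> A. \<rho> a \<noteq> a}) \<le> 2 * card A * \<theta>"
proof -
  define n where "n = card A"
  define mv where "mv \<rho> = {a \<in> A. \<rho> a \<noteq> a}" for \<rho>
  have mv: "\<rho> permutes mv \<rho>" if "\<rho> permutes A" for \<rho>
    using that by (auto simp: mv_def permutes_def)
  have img: "mv ` ({\<rho>. \<rho> permutes A} - {id}) \<subseteq> Pow A - {{}}"
  proof
    fix R assume "R \<in> mv ` ({\<rho>. \<rho> permutes A} - {id})"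
    then obtain \<rho> where "\<rho> permutes A" "\<rho> \<noteq> id" "R = mv \<rho>" by auto
    moreover have "mv \<rho> \<noteq> {}"
    proof
      assume "mv \<rho> = {}"
      then have "\<rho> permutes {}" using mv[of \<rho>] \<open>\<rho> permutes A\<close> by simp
      then show False using \<open>\<rho> \<noteq> id\<close> by simp
    qed
    ultimately show "R \<in> Pow A - {{}}" by (auto simp: mv_def)
  qed
  have "(\<Sum>\<rho>\<in>{\<rho>. \<rho> permutes A} - {id}. \<theta> ^ card (mv \<rho>)) =
     (\<Sum>R\<in>Pow A - {{}}. \<Sum>\<rho>\<in>{\<rho> \<in> {\<rho>. \<rho> permutes A} - {id}. mv \<rho> = R}. \<theta> ^ card (mv \<rho>))"
    using assms img by (intro sum.group[symmetric]) (auto simp: finite_permutations)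
  also have "\<dots> \<le> (\<Sum>R\<in>Pow A - {{}}. fact (card R) * \<theta> ^ card R)"
  proof (intro sum_mono)
    fix R assume R: "R \<in> Pow A - {{}}"
    then have fR: "finite R" using assms finite_subset by auto
    have "(\<Sum>\<rho>\<in>{\<rho> \<in> {\<rho>. \<rho> permutes A} - {id}. mv \<rho> = R}. \<theta> ^ card (mv \<rho>))
      = card {\<rho> \<in> {\<rho>. \<rho> permutes A} - {id}. mv \<rho> = R} * \<theta> ^ card R" by simp
    also have "\<dots> \<le> card {\<rho>. \<rho> permutes R} * \<theta> ^ card R"
      using mv fR assms by (intro mult_right_mono of_nat_mono card_mono) (auto simp: finite_permutations)
    also have "real (card {\<rho>. \<rho> permutes R}) = fact (card R)"
      using fR by (simp add: card_permutations)
    finally show "(\<Sum>\<rho>\<in>{\<rho> \<in> {\<rho>. \<rho> permutes A} - {id}. mv \<rho> = R}. \<theta> ^ card (mv \<rho>))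
       \<le> fact (card R) * \<theta> ^ card R" .
  qed
  also have "\<dots> = (\<Sum>r\<in>{1..n}. \<Sum>R\<in>{R \<in> Pow A - {{}}. card R = r}. fact (card R) * \<theta> ^ card R)"
    using assms by (intro sum.group[symmetric])
      (auto simp: n_def card_mono Suc_le_eq card_gt_0_iff intro: finite_subset[OF _ assms(1)])
  also have "\<dots> = (\<Sum>r\<in>{1..n}. real (n choose r) * (fact r * \<theta> ^ r))"
  proof (intro sum.cong refl)
    fix r assume r: "r \<in> {1..n}"
    have "{R \<in> Pow A - {{}}. card R = r} = {R. R \<subseteq> A \<and> card R = r}" using r by auto
    then show "(\<Sum>R\<in>{R \<in> Pow A - {{}}. card R = r}. fact (card R) * \<theta> ^ card R)
       = real (n choose r) * (fact r * \<theta> ^ r)"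
      using n_subsets[OF assms(1), of r] by (simp add: n_def)
  qed
  also have "\<dots> \<le> (\<Sum>r\<in>{1..n}. (n * \<theta>) ^ r)"
  proof (intro sum_mono)
    fix r
    have "real ((n choose r) * fact r) \<le> real (n ^ r)"
      using binomial_fact_pow[of n r] of_nat_mono by blast
    then have "real (n choose r) * fact r \<le> n ^ r" by simp
    from mult_right_mono[OF this, of "\<theta> ^ r"] assms
    show "real (n choose r) * (fact r * \<theta> ^ r) \<le> (n * \<theta>) ^ r"
      by (simp add: power_mult_distrib mult.assoc)
  qed
  also have "\<dots> = (n * \<theta>) * (\<Sum>r<n. (n * \<theta>) ^ r)"
    by (simp add: sum_distrib_left sum.atLeast1_atMost_eq)
  also have "\<dots> \<le> (n * \<theta>) * (\<Sum>r<n. (1 / 2) ^ r)"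
    using assms by (intro mult_left_mono sum_mono power_mono) (auto simp: n_def)
  also have "(\<Sum>r<n. (1 / 2) ^ r) = 2 - 2 * (1 / 2 :: real) ^ n"
    by (induction n) auto
  then have "(\<Sum>r<n. (1 / 2) ^ r) \<le> (2 :: real)" by simp
  then have "(n * \<theta>) * (\<Sum>r<n. (1 / 2) ^ r) \<le> (n * \<theta>) * 2"
    using assms by (intro mult_left_mono) auto
  finally show ?thesis by (simp add: n_def mv_def)
qed

lemma sum_UN_le:
  fixes f :: "'a \<Rightarrow> real"
  assumes "finite I" "\<And>i. i \<in> I \<Longrightarrow> finite (A i)" "\<And>x. 0 \<le> f x"
  shows "sum f (\<Union>i\<in>I. A i) \<le> (\<Sum>i\<in>I. sum f (A i))"
  using assms(1,2)
proof (induction I)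
  case (insert i I)
  have "sum f (\<Union>i\<in>insert i I. A i) \<le> sum f (A i) + sum f (\<Union>i\<in>I. A i)"
    using insert assms(3) by (subst sum.union_inter[symmetric]) (auto intro: sum_nonneg)
  also have "sum f (\<Union>i\<in>I. A i) \<le> (\<Sum>i\<in>I. sum f (A i))"
    using insert by auto
  finally show ?case using insert by simp
qed simp

text \<open>Diagonal entries of a phase matrix lying in all three groups: \<open>bar\<close> is the identity for \<open>U(d)\<close> and
  \<open>O(d)\<close>, where only signs are available, and pairs \<open>i\<close> with \<open>i + d/2\<close> for \<open>Sp(d/2)\<close>.\<close>

definition chi :: "(nat \<Rightarrow> nat) \<Rightarrow> nat \<Rightarrow> nat \<Rightarrow> complex" where
  "chi bar b i = (if bar b = b then (if i = b then -1 else 1)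
     else if i = b then \<i> else if i = bar b then -\<i> else 1)"

locale involution =
  fixes d :: nat and bar :: "nat \<Rightarrow> nat"
  assumes bar_less [simp]: "i < d \<Longrightarrow> bar i < d"
    and bar_bar [simp]: "i < d \<Longrightarrow> bar (bar i) = i"
begin

definition cls :: "nat \<Rightarrow> nat" where "cls i = min i (bar i)"

lemma cls_eq_iff: "i < d \<Longrightarrow> j < d \<Longrightarrow> cls i = cls j \<longleftrightarrow> i = j \<or> i = bar j"
  using bar_bar[of i] bar_bar[of j] by (auto simp: cls_def min_def split: if_splits) (metis bar_bar)

lemma cmod_chi [simp]: "cmod (chi bar b i) = 1"
  by (simp add: chi_def)

lemma chi_other: "i < d \<Longrightarrow> b < d \<Longrightarrow> cls i \<noteq> cls b \<Longrightarrow> chi bar b i = 1"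
  by (auto simp: chi_def cls_eq_iff)

lemma chi_bar: "i < d \<Longrightarrow> b < d \<Longrightarrow> chi bar b (bar i) = cnj (chi bar b i)"
  by (auto simp: chi_def) (metis bar_bar)+

lemma chi_self_neq_1: "chi bar b b \<noteq> 1"
  by (auto simp: chi_def complex_eq_iff)

lemma chi_eq_self: "i < d \<Longrightarrow> b < d \<Longrightarrow> chi bar b i = chi bar b b \<Longrightarrow> i = b"
  by (auto simp: chi_def complex_eq_iff split: if_splits)

text \<open>At b = f s the product over f reduces to \<open>chi bar b b\<close>, which is not 1,
  because the other values lie in other classes. So f' meets the class of every f s, and by counting
  it meets each exactly once. The value of the character then tells f s from its partner, whose
  character is the conjugate.\<close>

lemma characters_determine_image:
  assumes I: "finite I" and f: "\<And>t. t \<in> I \<Longrightarrow> f t < d" and f': "\<And>t. t \<in> I \<Longrightarrow> f' t < d"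
    and inj: "inj_on (cls \<circ> f) I"
    and eq: "\<And>b. b < d \<Longrightarrow> (\<Prod>t\<in>I. chi bar b (f' t)) = (\<Prod>t\<in>I. chi bar b (f t))"
  shows "f' ` I = f ` I"
proof -
  have pf: "(\<Prod>t\<in>I. chi bar (f s) (f t)) = chi bar (f s) (f s)" if s: "s \<in> I" for s
  proof -
    have "cls (f t) \<noteq> cls (f s)" if "t \<in> I" "t \<noteq> s" for t
      using inj_onD[OF inj, of t s] s that by auto
    then have "(\<Prod>t\<in>I. chi bar (f s) (f t)) = (\<Prod>t\<in>I. if t = s then chi bar (f s) (f s) else 1)"
      using s f by (intro prod.cong refl) (simp add: chi_other)
    then show ?thesis using s I by simp
  qed
  have ex: "\<exists>t\<in>I. cls (f' t) = cls (f s)" if s: "s \<in> I" for s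
  proof (rule ccontr)
    assume "\<not> ?thesis"
    then have "(\<Prod>t\<in>I. chi bar (f s) (f' t)) = 1"
      using s f f' by (intro prod.neutral) (auto intro!: chi_other)
    then show False using eq[OF f[OF s]] pf[OF s] chi_self_neq_1 by metis
  qed
  have sub: "(cls \<circ> f) ` I \<subseteq> (cls \<circ> f') ` I"
  proof
    fix x assume "x \<in> (cls \<circ> f) ` I"
    then obtain s where "s \<in> I" "x = cls (f s)" by auto
    with ex[of s] show "x \<in> (cls \<circ> f') ` I" by force
  qed
  have "card ((cls \<circ> f') ` I) \<ge> card I"
    using card_mono[OF _ sub] I card_image[OF inj] by simp
  then have inj': "inj_on (cls \<circ> f') I"
    using I by (intro eq_card_imp_inj_on) (auto simp: le_antisym card_image_le)
  have "f s \<in> f' ` I" if s: "s \<in> I" for s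
  proof -
    obtain t where t: "t \<in> I" "cls (f' t) = cls (f s)" using ex[OF s] by blast
    have "(\<Prod>t\<in>I. chi bar (f s) (f' t)) = (\<Prod>u\<in>I. if u = t then chi bar (f s) (f' t) else 1)"
    proof (intro prod.cong refl)
      fix u assume u: "u \<in> I"
      have "cls (f' u) \<noteq> cls (f s)" if "u \<noteq> t"
        using inj_onD[OF inj', of u t] t u that by auto
      then show "chi bar (f s) (f' u) = (if u = t then chi bar (f s) (f' t) else 1)"
        using chi_other f f' s u by auto
    qed
    then have "chi bar (f s) (f' t) = chi bar (f s) (f s)"
      using eq[OF f[OF s]] pf[OF s] t I by simp
    then have "f' t = f s" using chi_eq_self f f' s t by blast
    then show ?thesis using t by force
  qed
  then have "f ` I \<subseteq> f' ` I" by auto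
  moreover have "card (f' ` I) \<le> card (f ` I)"
  proof -
    have "inj_on f I" using inj by (rule inj_on_imageI2)
    then show ?thesis using I by (simp add: card_image card_image_le)
  qed
  ultimately show ?thesis using I by (metis card_seteq finite_imageI)
qed

section \<open>Matchings in the grid of matrix positions\<close>

definition edges :: "(nat \<times> nat) set" where "edges = {..<d} \<times> {..<d}"

text \<open>A position is an edge between a row and a column. Partner rows or columns already
  conflict, since in the symplectic group entries at partner positions are conjugate up to sign and
  cannot be treated as separate variables.\<close>

definition conflict :: "nat \<times> nat \<Rightarrow> nat \<times> nat \<Rightarrow> bool" where
  "conflict e e' \<longleftrightarrow> cls (fst e) = cls (fst e') \<or> cls (snd e) = cls (snd e')"

definition matchings :: "nat \<Rightarrow> (nat \<times> nat) set set" where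
  "matchings k = {m. m \<subseteq> edges \<and> card m = k \<and> (\<forall>e\<in>m. \<forall>e'\<in>m. e \<noteq> e' \<longrightarrow> \<not> conflict e e')}"

definition free_edges :: "(nat \<times> nat) set \<Rightarrow> (nat \<times> nat) set" where
  "free_edges m = {e \<in> edges. \<forall>e'\<in>m. \<not> conflict e e'}"

lemma finite_edges [simp]: "finite edges" by (simp add: edges_def)

lemma finite_free_edges [simp]: "finite (free_edges m)" by (simp add: free_edges_def)

lemma finite_matchings [simp]: "finite (matchings k)"
  by (rule finite_subset[of _ "Pow edges"]) (auto simp: matchings_def)

lemma finite_matching: "m \<in> matchings k \<Longrightarrow> finite m"
  by (auto simp: matchings_def intro: finite_subset)

lemma conflict_refl [simp]: "conflict e e" by (simp add: conflict_def)

lemma conflict_sym: "conflict e e' \<longleftrightarrow> conflict e' e" by (auto simp: conflict_def)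

lemma free_edges_insert: "free_edges (insert e m) = {e' \<in> free_edges m. \<not> conflict e' e}"
  by (auto simp: free_edges_def)

text \<open>Double counting: removing a chosen edge from a matching with k + 1 edges is inverse to
  adding a free edge to a matching with k edges.\<close>

lemma sum_matchings_Suc:
  fixes f :: "(nat \<times> nat) set \<Rightarrow> nat \<times> nat \<Rightarrow> 'b::comm_monoid_add"
  shows "(\<Sum>m\<in>matchings (Suc k). \<Sum>e\<in>m. f (m - {e}) e) = (\<Sum>m\<in>matchings k. \<Sum>e\<in>free_edges m. f m e)"
proof -
  have "(\<Sum>m\<in>matchings (Suc k). \<Sum>e\<in>m. f (m - {e}) e)
     = (\<Sum>(m, e)\<in>Sigma (matchings (Suc k)) (\<lambda>m. m). f (m - {e}) e)"
    by (subst sum.Sigma) (auto simp: finite_matching)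
  also have "\<dots> = (\<Sum>(m, e)\<in>Sigma (matchings k) free_edges. f m e)"
  proof (rule sum.reindex_bij_witness[of _ "\<lambda>(m, e). (insert e m, e)" "\<lambda>(m, e). (m - {e}, e)"])
    fix a assume a: "a \<in> Sigma (matchings (Suc k)) (\<lambda>m. m)"
    obtain m e where [simp]: "a = (m, e)" by (cases a)
    have m: "m \<in> matchings (Suc k)" "e \<in> m" using a by auto
    then have "card (m - {e}) = k" using finite_matching[OF m(1)] by (simp add: matchings_def)
    then show "(case a of (m, e) \<Rightarrow> (m - {e}, e)) \<in> Sigma (matchings k) free_edges"
      using m by (auto simp: matchings_def free_edges_def)
  next
    fix b assume b: "b \<in> Sigma (matchings k) free_edges"
    obtain m e where [simp]: "b = (m, e)" by (cases b)
    have m: "m \<in> matchings k" "e \<in> free_edges m" using b by auto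
    then have en: "e \<notin> m" by (auto simp: free_edges_def)
    show "(case case b of (m, e) \<Rightarrow> (insert e m, e) of (m, e) \<Rightarrow> (m - {e}, e)) = b"
      using en by auto
    have "card (insert e m) = Suc k" using m en finite_matching[OF m(1)] by (simp add: matchings_def)
    then show "(case b of (m, e) \<Rightarrow> (insert e m, e)) \<in> Sigma (matchings (Suc k)) (\<lambda>m. m)"
      using m conflict_sym by (auto simp: matchings_def free_edges_def)
  qed auto
  also have "\<dots> = (\<Sum>m\<in>matchings k. \<Sum>e\<in>free_edges m. f m e)"
    by (subst sum.Sigma) auto
  finally show ?thesis .
qed

text \<open>The arithmetic-geometric inequality is applied crosswise, pairing \<open>N e\<close>
  with \<open>q e'\<close> and \<open>N e'\<close> with \<open>q e\<close>. As conflict is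
  symmetric, both halves have the same sum, and for fixed e the conflicting positions fill one row
  class and one column class, of mass at most \<kappa> each.\<close>

lemma sum_conflict_pairs_le:
  fixes N q :: "nat \<times> nat \<Rightarrow> real"
  assumes X: "X \<subseteq> edges"
    and row: "\<And>e. e \<in> edges \<Longrightarrow> (\<Sum>e'\<in>{e' \<in> edges. cls (fst e') = cls (fst e)}. (N e')\<^sup>2) \<le> \<kappa>"
    and col: "\<And>e. e \<in> edges \<Longrightarrow> (\<Sum>e'\<in>{e' \<in> edges. cls (snd e') = cls (snd e)}. (N e')\<^sup>2) \<le> \<kappa>"
  shows "(\<Sum>e\<in>X. \<Sum>e'\<in>{e' \<in> X. conflict e' e}. (N e * q e) * (N e' * q e')) \<le> 2 * \<kappa> * (\<Sum>e\<in>X. (q e)\<^sup>2)"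
proof -
  have fX: "finite X" using finite_subset[OF X] by simp
  have nn: "(\<Sum>e'\<in>{e' \<in> X. conflict e' e}. (N e')\<^sup>2) \<le> 2 * \<kappa>" if e: "e \<in> X" for e
  proof -
    have "(\<Sum>e'\<in>{e' \<in> X. conflict e' e}. (N e')\<^sup>2) \<le>
       (\<Sum>e'\<in>{e' \<in> edges. cls (fst e') = cls (fst e)} \<union> {e' \<in> edges. cls (snd e') = cls (snd e)}. (N e')\<^sup>2)"
      using X by (intro sum_mono2) (auto simp: conflict_def)
    also have "\<dots> \<le> (\<Sum>e'\<in>{e' \<in> edges. cls (fst e') = cls (fst e)}. (N e')\<^sup>2)
         + (\<Sum>e'\<in>{e' \<in> edges. cls (snd e') = cls (snd e)}. (N e')\<^sup>2)"
      by (subst sum.union_inter[symmetric]) (auto intro: sum_nonneg)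
    also have "\<dots> \<le> \<kappa> + \<kappa>" using e X row[of e] col[of e] by (intro add_mono) (auto simp del: split_paired_All)
    finally show ?thesis by simp
  qed
  have "(\<Sum>e\<in>X. \<Sum>e'\<in>{e' \<in> X. conflict e' e}. (N e * q e) * (N e' * q e'))
     \<le> (\<Sum>e\<in>X. \<Sum>e'\<in>{e' \<in> X. conflict e' e}. ((N e * q e')\<^sup>2 + (N e' * q e)\<^sup>2) / 2)"
  proof (intro sum_mono)
    fix e e'
    have "0 \<le> (N e * q e' - N e' * q e)\<^sup>2" by simp
    then show "(N e * q e) * (N e' * q e') \<le> ((N e * q e')\<^sup>2 + (N e' * q e)\<^sup>2) / 2"
      by (simp add: power2_diff algebra_simps)
  qed
  also have "\<dots> = (\<Sum>e\<in>X. \<Sum>e'\<in>{e' \<in> X. conflict e' e}. (N e * q e')\<^sup>2) / 2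
      + (\<Sum>e\<in>X. \<Sum>e'\<in>{e' \<in> X. conflict e' e}. (N e' * q e)\<^sup>2) / 2"
    by (simp add: sum.distrib add_divide_distrib sum_divide_distrib)
  also have "(\<Sum>e\<in>X. \<Sum>e'\<in>{e' \<in> X. conflict e' e}. (N e * q e')\<^sup>2)
      = (\<Sum>e\<in>X. \<Sum>e'\<in>{e' \<in> X. conflict e' e}. (N e' * q e)\<^sup>2)"
  proof -
    have "(\<Sum>e\<in>X. \<Sum>e'\<in>{e' \<in> X. conflict e' e}. (N e * q e')\<^sup>2)
      = (\<Sum>e\<in>X. \<Sum>e'\<in>X. if conflict e' e then (N e * q e')\<^sup>2 else 0)"
      using fX by (simp add: sum.If_cases Int_def)
    also have "\<dots> = (\<Sum>e\<in>X. \<Sum>e'\<in>X. if conflict e' e then (N e' * q e)\<^sup>2 else 0)"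
      by (subst sum.swap) (simp add: conflict_sym)
    finally show ?thesis using fX by (simp add: sum.If_cases Int_def)
  qed
  also have "(\<Sum>e\<in>X. \<Sum>e'\<in>{e' \<in> X. conflict e' e}. (N e' * q e)\<^sup>2) / 2
      + (\<Sum>e\<in>X. \<Sum>e'\<in>{e' \<in> X. conflict e' e}. (N e' * q e)\<^sup>2) / 2
      = (\<Sum>e\<in>X. (\<Sum>e'\<in>{e' \<in> X. conflict e' e}. (N e')\<^sup>2) * (q e)\<^sup>2)"
    by (simp add: power_mult_distrib sum_distrib_right)
  also have "\<dots> \<le> (\<Sum>e\<in>X. 2 * \<kappa> * (q e)\<^sup>2)"
    using nn by (intro sum_mono mult_right_mono) auto
  finally show ?thesis by (simp add: sum_distrib_left)
qed

text \<open>The effect on the coefficient norm of multiplying by one more linear form and keeping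
  matchings only. The diagonal part loses 2 k \<kappa> to positions blocked by the k present edges,
  and the cross terms cost at most another 2 k \<kappa>.\<close>

lemma extend_matchings_norm:
  fixes N :: "nat \<times> nat \<Rightarrow> complex" and q :: "(nat \<times> nat) set \<Rightarrow> complex"
  assumes row: "\<And>e. e \<in> edges \<Longrightarrow> (\<Sum>e'\<in>{e' \<in> edges. cls (fst e') = cls (fst e)}. (cmod (N e'))\<^sup>2) \<le> \<kappa>"
    and col: "\<And>e. e \<in> edges \<Longrightarrow> (\<Sum>e'\<in>{e' \<in> edges. cls (snd e') = cls (snd e)}. (cmod (N e'))\<^sup>2) \<le> \<kappa>"
  shows "((\<Sum>e\<in>edges. (cmod (N e))\<^sup>2) - 4 * k * \<kappa>) * (\<Sum>m\<in>matchings k. (cmod (q m))\<^sup>2)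
    \<le> (\<Sum>m\<in>matchings (Suc k). (cmod (\<Sum>e\<in>m. N e * q (m - {e})))\<^sup>2)"
proof -
  define S where "S = (\<Sum>m\<in>matchings k. (cmod (q m))\<^sup>2)"
  define D where "D = (\<Sum>m\<in>matchings (Suc k). \<Sum>e\<in>m. (cmod (N e))\<^sup>2 * (cmod (q (m - {e})))\<^sup>2)"
  define f where "f m e = N e * q m * (\<Sum>e'\<in>m. cnj (N e' * q (insert e (m - {e'}))))" for m e
  have expand: "complex_of_real ((cmod (\<Sum>e\<in>m. N e * q (m - {e})))\<^sup>2)
      = of_real (\<Sum>e\<in>m. (cmod (N e))\<^sup>2 * (cmod (q (m - {e})))\<^sup>2) + (\<Sum>e\<in>m. f (m - {e}) e)"
    if m: "m \<in> matchings (Suc k)" for m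
  proof -
    have "complex_of_real ((cmod (\<Sum>e\<in>m. N e * q (m - {e})))\<^sup>2)
       = (\<Sum>e\<in>m. \<Sum>e'\<in>m. (N e * q (m - {e})) * cnj (N e' * q (m - {e'})))"
      by (simp only: complex_norm_square cnj_sum sum_product)
    also have "\<dots> = (\<Sum>e\<in>m. of_real ((cmod (N e))\<^sup>2 * (cmod (q (m - {e})))\<^sup>2) + f (m - {e}) e)"
    proof (intro sum.cong refl)
      fix e assume e: "e \<in> m"
      have "(\<Sum>e'\<in>m. (N e * q (m - {e})) * cnj (N e' * q (m - {e'})))
        = (N e * q (m - {e})) * cnj (N e * q (m - {e}))
          + (\<Sum>e'\<in>m - {e}. (N e * q (m - {e})) * cnj (N e' * q (m - {e'})))"
        using e m finite_matching by (intro sum.remove) auto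
      moreover have "(\<Sum>e'\<in>m - {e}. (N e * q (m - {e})) * cnj (N e' * q (m - {e'}))) = f (m - {e}) e"
        unfolding f_def sum_distrib_left
      proof (intro sum.cong refl)
        fix e' assume "e' \<in> m - {e}"
        then have "insert e (m - {e} - {e'}) = m - {e'}" using e by auto
        then show "(N e * q (m - {e})) * cnj (N e' * q (m - {e'}))
           = N e * q (m - {e}) * cnj (N e' * q (insert e (m - {e} - {e'})))" by simp
      qed
      moreover have "(N e * q (m - {e})) * cnj (N e * q (m - {e}))
          = of_real ((cmod (N e))\<^sup>2 * (cmod (q (m - {e})))\<^sup>2)"
        by (simp only: complex_norm_square[symmetric] norm_mult power_mult_distrib)
      ultimately show "(\<Sum>e'\<in>m. (N e * q (m - {e})) * cnj (N e' * q (m - {e'})))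
        = of_real ((cmod (N e))\<^sup>2 * (cmod (q (m - {e})))\<^sup>2) + f (m - {e}) e" by simp
    qed
    finally show ?thesis by (simp add: sum.distrib)
  qed
  have "complex_of_real (\<Sum>m\<in>matchings (Suc k). (cmod (\<Sum>e\<in>m. N e * q (m - {e})))\<^sup>2)
     = of_real D + (\<Sum>m\<in>matchings (Suc k). \<Sum>e\<in>m. f (m - {e}) e)"
    using expand by (simp add: D_def sum.distrib)
  from arg_cong[OF this, of Re]
  have tot: "(\<Sum>m\<in>matchings (Suc k). (cmod (\<Sum>e\<in>m. N e * q (m - {e})))\<^sup>2)
     = D + Re (\<Sum>m\<in>matchings (Suc k). \<Sum>e\<in>m. f (m - {e}) e)"
    by (simp only: Re_complex_of_real plus_complex.simps)
  \<comment> \<open>Each of the k edges of m blocks one row class and one column class, of mass at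
    most \<kappa> each.\<close>
  have D: "D \<ge> ((\<Sum>e\<in>edges. (cmod (N e))\<^sup>2) - 2 * k * \<kappa>) * S"
  proof -
    have "D = (\<Sum>m\<in>matchings k. \<Sum>e\<in>free_edges m. (cmod (N e))\<^sup>2 * (cmod (q m))\<^sup>2)"
      unfolding D_def by (rule sum_matchings_Suc[where f = "\<lambda>m e. (cmod (N e))\<^sup>2 * (cmod (q m))\<^sup>2"])
    moreover have "((\<Sum>e\<in>edges. (cmod (N e))\<^sup>2) - 2 * k * \<kappa>) * (cmod (q m))\<^sup>2
       \<le> (\<Sum>e\<in>free_edges m. (cmod (N e))\<^sup>2 * (cmod (q m))\<^sup>2)" if m: "m \<in> matchings k" for m
    proof -
      let ?R = "\<lambda>f. {e' \<in> edges. cls (fst e') = cls (fst f)}"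
      let ?C = "\<lambda>f. {e' \<in> edges. cls (snd e') = cls (snd f)}"
      have "(\<Sum>e\<in>edges. (cmod (N e))\<^sup>2) \<le> (\<Sum>e\<in>free_edges m \<union> (\<Union>f\<in>m. ?R f \<union> ?C f). (cmod (N e))\<^sup>2)"
        using finite_matching[OF m]
        by (intro sum_mono2) (auto simp: free_edges_def conflict_def)
      also have "\<dots> \<le> (\<Sum>e\<in>free_edges m. (cmod (N e))\<^sup>2) + (\<Sum>e\<in>(\<Union>f\<in>m. ?R f \<union> ?C f). (cmod (N e))\<^sup>2)"
        using finite_matching[OF m] by (subst sum.union_inter[symmetric]) (auto intro: sum_nonneg)
      also have "(\<Sum>e\<in>(\<Union>f\<in>m. ?R f \<union> ?C f). (cmod (N e))\<^sup>2) \<le> (\<Sum>f\<in>m. \<Sum>e\<in>?R f \<union> ?C f. (cmod (N e))\<^sup>2)"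
        using finite_matching[OF m] by (intro sum_UN_le) auto
      also have "\<dots> \<le> (\<Sum>f\<in>m. 2 * \<kappa>)"
      proof (intro sum_mono)
        fix f assume "f \<in> m"
        then have f: "f \<in> edges" using m by (auto simp: matchings_def)
        have "(\<Sum>e\<in>?R f \<union> ?C f. (cmod (N e))\<^sup>2) \<le> (\<Sum>e\<in>?R f. (cmod (N e))\<^sup>2) + (\<Sum>e\<in>?C f. (cmod (N e))\<^sup>2)"
          by (subst sum.union_inter[symmetric]) (auto intro: sum_nonneg)
        also have "\<dots> \<le> 2 * \<kappa>" using row[OF f] col[OF f] by simp
        finally show "(\<Sum>e\<in>?R f \<union> ?C f. (cmod (N e))\<^sup>2) \<le> 2 * \<kappa>" .
      qed
      also have "(\<Sum>f\<in>m. 2 * \<kappa>) = 2 * k * \<kappa>" using m by (simp add: matchings_def)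
      finally have "(\<Sum>e\<in>edges. (cmod (N e))\<^sup>2) - 2 * k * \<kappa> \<le> (\<Sum>e\<in>free_edges m. (cmod (N e))\<^sup>2)" by simp
      then have "((\<Sum>e\<in>edges. (cmod (N e))\<^sup>2) - 2 * k * \<kappa>) * (cmod (q m))\<^sup>2
         \<le> (\<Sum>e\<in>free_edges m. (cmod (N e))\<^sup>2) * (cmod (q m))\<^sup>2"
        by (rule mult_right_mono) simp
      then show ?thesis by (simp add: sum_distrib_right)
    qed
    ultimately show ?thesis unfolding S_def sum_distrib_left by (simp add: sum_mono)
  qed
  have O: "Re (\<Sum>m\<in>matchings (Suc k). \<Sum>e\<in>m. f (m - {e}) e) \<ge> - (2 * k * \<kappa> * S)"
  proof (cases k)
    case 0
    have "(\<Sum>m\<in>matchings (Suc k). \<Sum>e\<in>m. f (m - {e}) e) = (\<Sum>m\<in>matchings k. \<Sum>e\<in>free_edges m. f m e)"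
      by (rule sum_matchings_Suc[where f = f])
    also have "\<dots> = 0"
      using 0 finite_matching by (intro sum.neutral ballI) (auto simp: f_def matchings_def card_eq_0_iff)
    finally show ?thesis using 0 by simp
  next
    case (Suc j)
    define z where "z r e = N e * cnj (q (insert e r))" for r e
    have "(\<Sum>m\<in>matchings (Suc k). \<Sum>e\<in>m. f (m - {e}) e) = (\<Sum>m\<in>matchings k. \<Sum>e\<in>free_edges m. f m e)"
      by (rule sum_matchings_Suc[where f = f])
    also have "\<dots> = (\<Sum>m\<in>matchings (Suc j). \<Sum>e'\<in>m. \<Sum>e\<in>free_edges (insert e' (m - {e'})).
         N e * q (insert e' (m - {e'})) * cnj (N e' * q (insert e (m - {e'}))))"
      unfolding f_def sum_distrib_left Suc
    proof (rule sum.cong[OF refl])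
      fix m
      show "(\<Sum>e\<in>free_edges m. \<Sum>e'\<in>m. N e * q m * cnj (N e' * q (insert e (m - {e'}))))
        = (\<Sum>e'\<in>m. \<Sum>e\<in>free_edges (insert e' (m - {e'})).
         N e * q (insert e' (m - {e'})) * cnj (N e' * q (insert e (m - {e'}))))"
        by (subst sum.swap) (simp add: insert_absorb)
    qed
    also have "\<dots> = (\<Sum>r\<in>matchings j. \<Sum>e'\<in>free_edges r. \<Sum>e\<in>free_edges (insert e' r).
         N e * q (insert e' r) * cnj (N e' * q (insert e r)))"
      by (rule sum_matchings_Suc[where f = "\<lambda>r e'. \<Sum>e\<in>free_edges (insert e' r).
         N e * q (insert e' r) * cnj (N e' * q (insert e r))"])
    also have "\<dots> = (\<Sum>r\<in>matchings j. \<Sum>e'\<in>free_edges r. \<Sum>e\<in>free_edges (insert e' r). z r e * cnj (z r e'))"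
      by (intro sum.cong refl) (simp add: z_def)
    finally have 1: "(\<Sum>m\<in>matchings (Suc k). \<Sum>e\<in>m. f (m - {e}) e)
      = (\<Sum>r\<in>matchings j. \<Sum>e'\<in>free_edges r. \<Sum>e\<in>free_edges (insert e' r). z r e * cnj (z r e'))" .
    \<comment> \<open>If all pairs of free edges of r were allowed, the sum would be a perfect
      square. The missing pairs are the conflicting ones, so only they can make the sum
      negative.\<close>
    have 2: "Re (\<Sum>e'\<in>free_edges r. \<Sum>e\<in>free_edges (insert e' r). z r e * cnj (z r e'))
       \<ge> - (2 * \<kappa> * (\<Sum>e\<in>free_edges r. (cmod (q (insert e r)))\<^sup>2))" for r
    proof -
      let ?X = "free_edges r"
      let ?c = "\<Sum>e'\<in>?X. \<Sum>e\<in>{e \<in> ?X. conflict e e'}. z r e * cnj (z r e')"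
      have "(\<Sum>e'\<in>?X. \<Sum>e\<in>?X. z r e * cnj (z r e'))
         = (\<Sum>e'\<in>?X. (\<Sum>e\<in>free_edges (insert e' r). z r e * cnj (z r e'))
              + (\<Sum>e\<in>{e \<in> ?X. conflict e e'}. z r e * cnj (z r e')))"
      proof (intro sum.cong refl)
        fix e'
        have "?X = free_edges (insert e' r) \<union> {e \<in> ?X. conflict e e'}"
          by (auto simp: free_edges_insert)
        then show "(\<Sum>e\<in>?X. z r e * cnj (z r e')) = (\<Sum>e\<in>free_edges (insert e' r). z r e * cnj (z r e'))
              + (\<Sum>e\<in>{e \<in> ?X. conflict e e'}. z r e * cnj (z r e'))"
          by (subst sum.union_disjoint[symmetric]) (auto simp: free_edges_insert)
      qed
      moreover have "(\<Sum>e'\<in>?X. \<Sum>e\<in>?X. z r e * cnj (z r e')) = of_real ((cmod (\<Sum>e\<in>?X. z r e))\<^sup>2)"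
        by (subst sum.swap) (simp only: complex_norm_square cnj_sum sum_product)
      ultimately have "(\<Sum>e'\<in>?X. \<Sum>e\<in>free_edges (insert e' r). z r e * cnj (z r e'))
         = of_real ((cmod (\<Sum>e\<in>?X. z r e))\<^sup>2) - ?c"
        by (simp add: sum.distrib algebra_simps)
      then have "Re (\<Sum>e'\<in>?X. \<Sum>e\<in>free_edges (insert e' r). z r e * cnj (z r e')) \<ge> - Re ?c"
        by simp
      moreover have "Re ?c \<le> cmod ?c" by (rule complex_Re_le_cmod)
      moreover have "cmod ?c \<le> (\<Sum>e'\<in>?X. \<Sum>e\<in>{e \<in> ?X. conflict e e'}.
          (cmod (N e') * cmod (q (insert e' r))) * (cmod (N e) * cmod (q (insert e r))))"
        by (intro order.trans[OF norm_sum] sum_mono) (simp add: z_def norm_mult mult_ac)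
      moreover have "\<dots> \<le> 2 * \<kappa> * (\<Sum>e\<in>?X. (cmod (q (insert e r)))\<^sup>2)"
        using row col by (intro sum_conflict_pairs_le) (auto simp: free_edges_def)
      ultimately show ?thesis by linarith
    qed
    \<comment> \<open>Every matching with k edges arises once for each of its edges.\<close>
    have 3: "(\<Sum>r\<in>matchings j. \<Sum>e\<in>free_edges r. (cmod (q (insert e r)))\<^sup>2) = k * S"
    proof -
      have "(\<Sum>r\<in>matchings j. \<Sum>e\<in>free_edges r. (cmod (q (insert e r)))\<^sup>2)
         = (\<Sum>m\<in>matchings (Suc j). \<Sum>e\<in>m. (cmod (q (insert e (m - {e}))))\<^sup>2)"
        by (rule sum_matchings_Suc[where f = "\<lambda>r e. (cmod (q (insert e r)))\<^sup>2", symmetric])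
      also have "\<dots> = (\<Sum>m\<in>matchings k. \<Sum>e\<in>m. (cmod (q m))\<^sup>2)"
        using Suc by (intro sum.cong) (auto simp: insert_absorb)
      also have "\<dots> = (\<Sum>m\<in>matchings k. k * (cmod (q m))\<^sup>2)"
        by (intro sum.cong) (auto simp: matchings_def)
      finally show ?thesis by (simp add: S_def sum_distrib_left)
    qed
    have "Re (\<Sum>m\<in>matchings (Suc k). \<Sum>e\<in>m. f (m - {e}) e)
       \<ge> (\<Sum>r\<in>matchings j. - (2 * \<kappa> * (\<Sum>e\<in>free_edges r. (cmod (q (insert e r)))\<^sup>2)))"
      unfolding 1 Re_sum[of _ "matchings j"] by (intro sum_mono 2)
    also have "(\<Sum>r\<in>matchings j. - (2 * \<kappa> * (\<Sum>e\<in>free_edges r. (cmod (q (insert e r)))\<^sup>2)))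
       = - (2 * \<kappa> * (k * S))"
      by (simp add: sum_negf flip: sum_distrib_left 3)
    finally show ?thesis by (simp add: algebra_simps)
  qed
  show ?thesis using tot D O by (simp add: S_def[symmetric] algebra_simps)
qed

end

section \<open>Positive semidefinite forms and flattening\<close>

text \<open>Cholesky elimination of one index x. If the diagonal entry at x is positive, completing
  the square leaves the Schur complement, which is again positive semidefinite; if it is 0, the
  whole row of x vanishes. Applied to a measurement effect, this yields its rank-one pieces.\<close>

lemma psd_form_sum_squares:
  fixes F :: "'i \<Rightarrow> 'i \<Rightarrow> complex"
  assumes "finite S" "\<And>i j. i \<in> S \<Longrightarrow> j \<in> S \<Longrightarrow> F j i = cnj (F i j)"
    and "\<And>v. Re (\<Sum>i\<in>S. \<Sum>j\<in>S. cnj (v i) * F i j * v j) \<ge> 0"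
  shows "\<exists>w. \<forall>v. (\<Sum>i\<in>S. \<Sum>j\<in>S. cnj (v i) * F i j * v j)
     = of_real (\<Sum>r\<in>S. (cmod (\<Sum>i\<in>S. cnj (w r i) * v i))\<^sup>2)"
  using assms
proof (induction S arbitrary: F)
  case (insert x S)
  have fin: "finite S" "x \<notin> S" using insert.hyps by auto
  have herm: "F j i = cnj (F i j)" if "i \<in> insert x S" "j \<in> insert x S" for i j
    using insert.prems(1) that by blast
  have psd: "Re (\<Sum>i\<in>insert x S. \<Sum>j\<in>insert x S. cnj (v i) * F i j * v j) \<ge> 0" for v
    using insert.prems(2) by blast
  have split: "(\<Sum>i\<in>insert x S. \<Sum>j\<in>insert x S. cnj (v i) * F i j * v j)
    = cnj (v x) * F x x * v x + cnj (v x) * (\<Sum>j\<in>S. F x j * v j) + cnj (\<Sum>j\<in>S. F x j * v j) * v x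
      + (\<Sum>i\<in>S. \<Sum>j\<in>S. cnj (v i) * F i j * v j)" for v
  proof -
    have "(\<Sum>i\<in>S. cnj (v i) * F i x * v x) = cnj (\<Sum>j\<in>S. F x j * v j) * v x"
      unfolding cnj_sum sum_distrib_right using herm[of x] by (intro sum.cong) (auto simp: mult_ac)
    then show ?thesis
      using fin by (simp add: sum.distrib sum_distrib_left algebra_simps)
  qed
  define a where "a = Re (F x x)"
  have Fxx: "F x x = of_real a"
    using herm[of x x] by (auto simp: a_def complex_eq_iff)
  have a0: "a \<ge> 0"
    using psd[of "\<lambda>i. if i = x then 1 else 0"] fin
    by (simp add: split a_def cong: sum.cong) (simp add: sum.neutral cong: sum.cong if_cong)
  show ?case
  proof (cases "a = 0")
    case True
    have z: "F x j = 0" if j: "j \<in> S" for j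
    proof (rule ccontr)
      assume nz: "F x j \<noteq> 0"
      \<comment> \<open>M is tuned so that the form takes the value -1 at v, contradicting
        positivity.\<close>
      define M where "M = (Re (F j j) + 1) / (2 * (cmod (F x j))\<^sup>2)"
      define v where "v = (\<lambda>i. if i = x then - (of_real M * F x j) else if i = j then 1 else 0)"
      have s1: "(\<Sum>i\<in>S. F x i * v i) = F x j"
      proof -
        have "(\<Sum>i\<in>S. F x i * v i) = (\<Sum>i\<in>S. if i = j then F x j else 0)"
          using fin by (intro sum.cong) (auto simp: v_def)
        then show ?thesis using fin j by simp
      qed
      have s2: "(\<Sum>i\<in>S. \<Sum>k\<in>S. cnj (v i) * F i k * v k) = F j j"
      proof -
        have "(\<Sum>i\<in>S. \<Sum>k\<in>S. cnj (v i) * F i k * v k) = (\<Sum>i\<in>S. \<Sum>k\<in>S. if k = j then (if i = j then F j j else 0) else 0)"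
          using fin by (intro sum.cong) (auto simp: v_def)
        then show ?thesis using fin j by simp
      qed
      have "0 \<le> Re (cnj (v x) * F x j + cnj (F x j) * v x + F j j)"
        using psd[of v] unfolding split s1 s2 Fxx True by simp
      also have "\<dots> = Re (F j j) - 2 * M * (cmod (F x j))\<^sup>2"
        by (simp add: v_def cmod_power2) (simp add: power2_eq_square algebra_simps)
      also have "\<dots> = -1" using nz by (simp add: M_def field_simps)
      finally show False by simp
    qed
    have "Re (\<Sum>i\<in>S. \<Sum>j\<in>S. cnj (v i) * F i j * v j) \<ge> 0" for v
      using psd[of v] unfolding split Fxx True by (simp add: z)
    then obtain w where w: "\<And>v. (\<Sum>i\<in>S. \<Sum>j\<in>S. cnj (v i) * F i j * v j)
        = of_real (\<Sum>r\<in>S. (cmod (\<Sum>i\<in>S. cnj (w r i) * v i))\<^sup>2)"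
      using insert.IH[of F] herm by blast
    define w' where "w' r i = (if r = x \<or> i = x then 0 else w r i)" for r i
    have "(\<Sum>i\<in>insert x S. \<Sum>j\<in>insert x S. cnj (v i) * F i j * v j)
        = of_real (\<Sum>r\<in>insert x S. (cmod (\<Sum>i\<in>insert x S. cnj (w' r i) * v i))\<^sup>2)" for v
    proof -
      have "(\<Sum>r\<in>S. (cmod (\<Sum>i\<in>S. cnj (w r i) * v i))\<^sup>2) = (\<Sum>r\<in>S. (cmod (\<Sum>i\<in>S. cnj (w' r i) * v i))\<^sup>2)"
        using fin by (intro sum.cong refl arg_cong[of _ _ "\<lambda>z. (cmod z)\<^sup>2"]) (auto simp: w'_def)
      then show ?thesis
        unfolding split Fxx True using fin by (simp add: z w) (simp add: w'_def)
    qed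
    then show ?thesis by blast
  next
    case False
    then have ap: "a > 0" using a0 by simp
    define G where "G i j = F i j - F i x * F x j / of_real a" for i j
    have split': "(\<Sum>i\<in>insert x S. \<Sum>j\<in>insert x S. cnj (v i) * F i j * v j)
      = of_real ((cmod (of_real (sqrt a) * v x + (\<Sum>j\<in>S. F x j * v j) / of_real (sqrt a)))\<^sup>2)
        + (\<Sum>i\<in>S. \<Sum>j\<in>S. cnj (v i) * G i j * v j)" for v
    proof -
      define s where "s = (\<Sum>j\<in>S. F x j * v j)"
      have cs: "cnj s = (\<Sum>i\<in>S. cnj (v i) * F i x)"
        unfolding s_def cnj_sum using herm[of x] by (intro sum.cong) (auto simp: mult.commute)
      have "(\<Sum>i\<in>S. \<Sum>j\<in>S. cnj (v i) * G i j * v j)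
         = (\<Sum>i\<in>S. \<Sum>j\<in>S. cnj (v i) * F i j * v j) - (\<Sum>i\<in>S. \<Sum>j\<in>S. (cnj (v i) * F i x) * (F x j * v j)) / of_real a"
        by (simp add: G_def algebra_simps sum_subtractf sum_divide_distrib)
      also have "(\<Sum>i\<in>S. \<Sum>j\<in>S. (cnj (v i) * F i x) * (F x j * v j)) = cnj s * s"
        unfolding cs by (simp only: s_def sum_product)
      finally have g: "(\<Sum>i\<in>S. \<Sum>j\<in>S. cnj (v i) * G i j * v j)
         = (\<Sum>i\<in>S. \<Sum>j\<in>S. cnj (v i) * F i j * v j) - cnj s * s / of_real a" .
      have r: "complex_of_real (sqrt a) * complex_of_real (sqrt a) = of_real a" "complex_of_real (sqrt a) \<noteq> 0"
        using ap by (simp_all flip: of_real_mult)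
      have "of_real ((cmod (of_real (sqrt a) * v x + s / of_real (sqrt a)))\<^sup>2)
        = (of_real (sqrt a) * v x + s / of_real (sqrt a)) * (of_real (sqrt a) * cnj (v x) + cnj s / of_real (sqrt a))"
        by (simp only: complex_norm_square) simp
      also have "\<dots> = of_real a * v x * cnj (v x) + v x * cnj s + s * cnj (v x) + s * cnj s / of_real a"
        using r(2) unfolding r(1)[symmetric] by (simp add: field_simps)
      finally show ?thesis
        unfolding split g Fxx s_def[symmetric] by (simp add: algebra_simps)
    qed
    have "Re (\<Sum>i\<in>S. \<Sum>j\<in>S. cnj (v i) * G i j * v j) \<ge> 0" for v
    proof -
      \<comment> \<open>The coordinate at x is chosen to make the completed square vanish, so that
        the form at u equals the Schur complement at v.\<close>
      define u where "u = v(x := - (\<Sum>j\<in>S. F x j * v j) / of_real a)"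
      have e: "(\<Sum>j\<in>S. F x j * u j) = (\<Sum>j\<in>S. F x j * v j)"
        using fin by (intro sum.cong) (auto simp: u_def)
      have e': "(\<Sum>i\<in>S. \<Sum>j\<in>S. cnj (u i) * G i j * u j) = (\<Sum>i\<in>S. \<Sum>j\<in>S. cnj (v i) * G i j * v j)"
        using fin by (intro sum.cong refl) (auto simp: u_def)
      have "of_real (sqrt a) * u x + (\<Sum>j\<in>S. F x j * u j) / of_real (sqrt a) = 0"
      proof -
        have "complex_of_real a = of_real (sqrt a) * of_real (sqrt a)" "complex_of_real (sqrt a) \<noteq> 0"
          using ap by (simp_all flip: of_real_mult)
        then show ?thesis unfolding e by (simp add: u_def field_simps)
      qed
      then show ?thesis using psd[of u] unfolding split' e' by simp
    qed
    moreover have "G j i = cnj (G i j)" if "i \<in> S" "j \<in> S" for i j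
      using herm[of i j] herm[of x i] herm[of x j] that by (simp add: G_def mult.commute)
    ultimately obtain w where w: "\<And>v. (\<Sum>i\<in>S. \<Sum>j\<in>S. cnj (v i) * G i j * v j)
        = of_real (\<Sum>r\<in>S. (cmod (\<Sum>i\<in>S. cnj (w r i) * v i))\<^sup>2)"
      using insert.IH[of G] by blast
    define w' where "w' r i = (if r = x then (if i = x then of_real (sqrt a) else cnj (F x i) / of_real (sqrt a))
         else if i = x then 0 else w r i)" for r i
    have "(\<Sum>i\<in>insert x S. \<Sum>j\<in>insert x S. cnj (v i) * F i j * v j)
        = of_real (\<Sum>r\<in>insert x S. (cmod (\<Sum>i\<in>insert x S. cnj (w' r i) * v i))\<^sup>2)" for v
    proof -
      have 1: "(\<Sum>i\<in>insert x S. cnj (w' r i) * v i) = (\<Sum>i\<in>S. cnj (w r i) * v i)" if "r \<in> S" for r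
        using fin that by (auto simp: w'_def intro!: sum.cong)
      have 2: "(\<Sum>i\<in>insert x S. cnj (w' x i) * v i)
         = of_real (sqrt a) * v x + (\<Sum>j\<in>S. F x j * v j) / of_real (sqrt a)"
        using fin by (auto simp: w'_def sum_divide_distrib intro!: sum.cong)
      show ?thesis unfolding split' w sum.insert[OF fin, of "\<lambda>r. (cmod (\<Sum>i\<in>insert x S. cnj (w' r i) * v i))\<^sup>2"] 2
        by (simp add: 1 del: sum.insert)
    qed
    then show ?thesis by blast
  qed
qed simp

section \<open>Flattening by sign-Hadamard matrices\<close>

lemma sum_cmod_square_orthonormal:
  fixes R :: "nat \<Rightarrow> nat \<Rightarrow> real" and K :: "nat \<Rightarrow> complex"
  assumes "\<And>j k. j < d \<Longrightarrow> k < d \<Longrightarrow> (\<Sum>p<d. R j p * R k p) = (if j = k then 1 else 0)"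
  shows "(\<Sum>p<d. (cmod (\<Sum>j<d. of_real (R j p) * K j))\<^sup>2) = (\<Sum>j<d. (cmod (K j))\<^sup>2)"
proof -
  have "complex_of_real (\<Sum>p<d. (cmod (\<Sum>j<d. of_real (R j p) * K j))\<^sup>2)
     = (\<Sum>p<d. \<Sum>j<d. \<Sum>k<d. of_real (R j p * R k p) * (K j * cnj (K k)))"
    unfolding of_real_sum
    by (intro sum.cong refl) (simp only: complex_norm_square cnj_sum sum_product,
       simp add: mult_ac)
  also have "\<dots> = (\<Sum>j<d. \<Sum>k<d. \<Sum>p<d. of_real (R j p * R k p) * (K j * cnj (K k)))"
    by (subst sum.swap) (intro sum.cong refl sum.swap)
  also have "\<dots> = (\<Sum>j<d. \<Sum>k<d. of_real (\<Sum>p<d. R j p * R k p) * (K j * cnj (K k)))"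
    by (simp add: sum_distrib_right)
  also have "\<dots> = (\<Sum>j<d. \<Sum>k<d. if j = k then K j * cnj (K j) else 0)"
    by (intro sum.cong refl) (simp add: assms del: of_real_sum)
  also have "\<dots> = (\<Sum>j<d. K j * cnj (K j))" by simp
  also have "\<dots> = of_real (\<Sum>j<d. (cmod (K j))\<^sup>2)"
    by (simp only: of_real_sum complex_norm_square)
  finally show ?thesis by (simp only: of_real_eq_iff)
qed

text \<open>The matrix \<open>diag(D H, D H)\<close> with a diagonal sign matrix \<open>D\<close> and the normalized Hadamard matrix \<open>H\<close>.\<close>

definition flat_rot :: "nat \<Rightarrow> (nat \<Rightarrow> real) \<Rightarrow> nat \<Rightarrow> nat \<Rightarrow> real" where
  "flat_rot p \<epsilon> i b = (if i div 2 ^ p = b div 2 ^ p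
     then \<epsilon> (i mod 2 ^ p) * had p (i mod 2 ^ p) (b mod 2 ^ p) / sqrt (2 ^ p) else 0)"

lemma sum_block:
  fixes f :: "nat \<Rightarrow> 'a::comm_monoid_add"
  assumes "h < 2" "m > 0"
  shows "(\<Sum>i<2 * m. if i div m = h then f i else 0) = (\<Sum>i<m. f (h * m + i))"
proof -
  have "(\<Sum>i<2 * m. if i div m = h then f i else 0) = (\<Sum>i\<in>{h * m..<h * m + m}. f i)"
  proof (rule sum.mono_neutral_cong_right)
    show "\<forall>i\<in>{..<2 * m} - {h * m..<h * m + m}. (if i div m = h then f i else 0) = 0"
    proof
      fix i assume "i \<in> {..<2 * m} - {h * m..<h * m + m}"
      then show "(if i div m = h then f i else 0) = 0"
        using assms dividend_less_div_times[OF assms(2), of i] by auto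
    qed
    have "h * m + m \<le> 2 * m" using assms by (cases h) auto
    then show "{h * m..<h * m + m} \<subseteq> {..<2 * m}" by (meson atLeastLessThan_iff lessThan_iff less_le_trans subsetI)
    show "(if i div m = h then f i else 0) = f i" if "i \<in> {h * m..<h * m + m}" for i
      using that assms by (auto intro!: div_nat_eqI simp: mult.commute add.commute)
  qed simp
  also have "\<dots> = (\<Sum>i<m. f (h * m + i))"
    by (rule sum.reindex_bij_witness[of _ "\<lambda>i. h * m + i" "\<lambda>i. i - h * m"]) auto
  finally show ?thesis .
qed

lemma flat_rot_orthonormal_cols:
  assumes e: "\<And>i. \<epsilon> i = 1 \<or> \<epsilon> i = -1" and "j < 2 * 2 ^ p" "k < 2 * 2 ^ p"
  shows "(\<Sum>b<2 * 2 ^ p. flat_rot p \<epsilon> j b * flat_rot p \<epsilon> k b) = (if j = k then 1 else 0)"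
proof -
  let ?m = "2 ^ p :: nat"
  have h: "j div ?m < 2" using assms by (simp add: less_mult_imp_div_less)
  have iff: "j = k \<longleftrightarrow> j div ?m = k div ?m \<and> j mod ?m = k mod ?m" by (metis div_mult_mod_eq)
  have ee: "\<epsilon> i * \<epsilon> i = 1" for i using e[of i] by auto
  have "(\<Sum>b<2 * ?m. flat_rot p \<epsilon> j b * flat_rot p \<epsilon> k b)
    = (\<Sum>b<2 * ?m. if b div ?m = j div ?m then flat_rot p \<epsilon> j b * flat_rot p \<epsilon> k b else 0)"
    by (intro sum.cong) (auto simp: flat_rot_def)
  also have "\<dots> = (\<Sum>b<?m. flat_rot p \<epsilon> j (j div ?m * ?m + b) * flat_rot p \<epsilon> k (j div ?m * ?m + b))"
    using h by (rule sum_block) simp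
  also have "\<dots> = (\<Sum>b<?m. (if j div ?m = k div ?m then \<epsilon> (j mod ?m) * \<epsilon> (k mod ?m) / ?m else 0)
       * (had p (j mod ?m) b * had p (k mod ?m) b))"
    by (intro sum.cong) (auto simp: flat_rot_def)
  also have "\<dots> = (if j div ?m = k div ?m then \<epsilon> (j mod ?m) * \<epsilon> (k mod ?m) / ?m else 0)
       * (if j mod ?m = k mod ?m then ?m else 0)"
    by (subst sum_distrib_left[symmetric], subst had_orthogonal) auto
  also have "\<dots> = (if j = k then 1 else 0)"
    using ee iff by auto
  finally show ?thesis .
qed

lemma flat_rot_orthonormal_rows:
  assumes e: "\<And>i. \<epsilon> i = 1 \<or> \<epsilon> i = -1" and "b < 2 * 2 ^ p" "c < 2 * 2 ^ p"
  shows "(\<Sum>i<2 * 2 ^ p. flat_rot p \<epsilon> i b * flat_rot p \<epsilon> i c) = (if b = c then 1 else 0)"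
proof -
  let ?m = "2 ^ p :: nat"
  have h: "b div ?m < 2" using assms by (simp add: less_mult_imp_div_less)
  have iff: "b = c \<longleftrightarrow> b div ?m = c div ?m \<and> b mod ?m = c mod ?m" by (metis div_mult_mod_eq)
  have ee: "\<epsilon> i * \<epsilon> i = 1" for i using e[of i] by auto
  have "(\<Sum>i<2 * ?m. flat_rot p \<epsilon> i b * flat_rot p \<epsilon> i c)
    = (\<Sum>i<2 * ?m. if i div ?m = b div ?m then flat_rot p \<epsilon> i b * flat_rot p \<epsilon> i c else 0)"
    by (intro sum.cong) (auto simp: flat_rot_def)
  also have "\<dots> = (\<Sum>i<?m. flat_rot p \<epsilon> (b div ?m * ?m + i) b * flat_rot p \<epsilon> (b div ?m * ?m + i) c)"
    using h by (rule sum_block) simp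
  also have "\<dots> = (\<Sum>i<?m. (if b div ?m = c div ?m then 1 / ?m else 0)
       * (had p (b mod ?m) i * had p (c mod ?m) i))"
    using ee by (intro sum.cong) (auto simp: flat_rot_def had_sym[of p "_::nat" "b mod _"] had_sym[of p "_::nat" "c mod _"] field_simps)
  also have "\<dots> = (if b div ?m = c div ?m then 1 / ?m else 0) * (if b mod ?m = c mod ?m then ?m else 0)"
    by (subst sum_distrib_left[symmetric], subst had_orthogonal) auto
  also have "\<dots> = (if b = c then 1 else 0)"
    using iff by auto
  finally show ?thesis .
qed

text \<open>After the rotation, the entry at (b, j) is a signed sum over half of column j divided by
  sqrt (2^p), so \<open>exists_signs\<close> bounds all of these entries by their column norms at
  once. With real and imaginary parts apart there are 2 T d^2 sums, which explains 4 T d^2 inside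
  the logarithm of \<open>u\<close>.\<close>

lemma exists_flattening_signs:
  fixes N :: "nat \<Rightarrow> nat \<Rightarrow> nat \<Rightarrow> complex" and p T :: nat
  defines "d \<equiv> 2 * 2 ^ p"
  defines "u \<equiv> ln (4 * real T * (real d)\<^sup>2) + 1/2"
  assumes "T > 0"
  shows "\<exists>\<epsilon>. (\<forall>i. \<epsilon> i = 1 \<or> \<epsilon> i = -1) \<and>
    (\<forall>t<T. \<forall>b<d. \<forall>j<d. (cmod (\<Sum>i<d. of_real (flat_rot p \<epsilon> i b) * N t i j))\<^sup>2
        \<le> u\<^sup>2 / 2 ^ p * (\<Sum>i<d. (cmod (N t i j))\<^sup>2))"
proof -
  let ?m = "2 ^ p :: nat"
  define part where "part r z = (if r then Re z else Im z)" for r z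
  define E where "E = {..<T} \<times> {..<d} \<times> {..<d} \<times> (UNIV :: bool set)"
  define a where "a = (\<lambda>(t, b, j, r) i. had p i (b mod ?m) * part r (N t (b div ?m * ?m + i) j))"
  have E: "finite E" "E \<noteq> {}" "card E = 2 * T * d\<^sup>2"
    using assms by (auto simp: E_def card_cartesian_product power2_eq_square lessThan_empty_iff)
  obtain \<epsilon> where e: "\<And>i. \<epsilon> i = 1 \<or> \<epsilon> i = -1" and
    S: "\<And>x. x \<in> E \<Longrightarrow> (\<Sum>i<?m. \<epsilon> i * a x i)\<^sup>2 \<le> (ln (2 * card E) + 1/2)\<^sup>2 * (\<Sum>i<?m. (a x i)\<^sup>2)"
    using exists_signs[OF E(1,2), where n = ?m and a = a] by blast
  have u: "ln (2 * card E) + 1/2 = u" by (simp add: u_def E(3) mult.assoc)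
  have "(cmod (\<Sum>i<d. of_real (flat_rot p \<epsilon> i b) * N t i j))\<^sup>2 \<le> u\<^sup>2 / ?m * (\<Sum>i<d. (cmod (N t i j))\<^sup>2)"
    if t: "t < T" "b < d" "j < d" for t b j
  proof -
    let ?h = "b div ?m"
    have h: "?h < 2" using t by (simp add: d_def less_mult_imp_div_less)
    have "(\<Sum>i<d. of_real (flat_rot p \<epsilon> i b) * N t i j)
      = (\<Sum>i<2 * ?m. if i div ?m = ?h then of_real (flat_rot p \<epsilon> i b) * N t i j else 0)"
      unfolding d_def by (intro sum.cong) (auto simp: flat_rot_def)
    also have "\<dots> = (\<Sum>i<?m. of_real (flat_rot p \<epsilon> (?h * ?m + i) b) * N t (?h * ?m + i) j)"
      using h by (rule sum_block) simp
    also have "\<dots> = (\<Sum>i<?m. of_real (\<epsilon> i * had p i (b mod ?m)) * N t (?h * ?m + i) j) / of_real (sqrt ?m)"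
      unfolding sum_divide_distrib by (intro sum.cong) (auto simp: flat_rot_def)
    finally have eq: "(\<Sum>i<d. of_real (flat_rot p \<epsilon> i b) * N t i j)
      = (\<Sum>i<?m. of_real (\<epsilon> i * had p i (b mod ?m)) * N t (?h * ?m + i) j) / of_real (sqrt ?m)" .
    have "(cmod (\<Sum>i<d. of_real (flat_rot p \<epsilon> i b) * N t i j))\<^sup>2
      = ((\<Sum>i<?m. \<epsilon> i * a (t, b, j, True) i)\<^sup>2 + (\<Sum>i<?m. \<epsilon> i * a (t, b, j, False) i)\<^sup>2) / ?m"
      unfolding eq norm_divide power_divide
      by (simp add: cmod_power2 a_def part_def mult.assoc)
    also have "\<dots> \<le> (u\<^sup>2 * (\<Sum>i<?m. (a (t, b, j, True) i)\<^sup>2) + u\<^sup>2 * (\<Sum>i<?m. (a (t, b, j, False) i)\<^sup>2)) / ?m"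
      using t unfolding u[symmetric] by (intro divide_right_mono add_mono S) (auto simp: E_def)
    also have "\<dots> = u\<^sup>2 / ?m * (\<Sum>i<?m. (cmod (N t (?h * ?m + i) j))\<^sup>2)"
      by (simp add: a_def part_def power_mult_distrib had_square cmod_power2 sum.distrib algebra_simps add_divide_distrib)
    also have "\<dots> \<le> u\<^sup>2 / ?m * (\<Sum>i<d. (cmod (N t i j))\<^sup>2)"
    proof (intro mult_left_mono)
      have "(\<Sum>i<?m. (cmod (N t (?h * ?m + i) j))\<^sup>2)
         = (\<Sum>i<2 * ?m. if i div ?m = ?h then (cmod (N t i j))\<^sup>2 else 0)"
        using h by (intro sum_block[symmetric]) auto
      also have "\<dots> \<le> (\<Sum>i<d. (cmod (N t i j))\<^sup>2)"
        unfolding d_def by (intro sum_mono) auto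
      finally show "(\<Sum>i<?m. (cmod (N t (?h * ?m + i) j))\<^sup>2) \<le> (\<Sum>i<d. (cmod (N t i j))\<^sup>2)" .
    qed auto
    finally show ?thesis .
  qed
  then show ?thesis using e by (intro exI[of _ \<epsilon>]) auto
qed

text \<open>The left rotation is chosen for N and the right one for the intermediate K. Rows are
  small because every entry of K is small relative to its column in N, and the right rotation keeps
  the norm of each row. Columns are small because every final entry is small relative to its row in
  K, and the total mass is unchanged throughout.\<close>

lemma exists_flattening:
  fixes N :: "nat \<Rightarrow> nat \<Rightarrow> nat \<Rightarrow> complex" and p T :: nat
  defines "d \<equiv> 2 * 2 ^ p"
  defines "u \<equiv> ln (4 * real T * (real d)\<^sup>2) + 1/2"
  assumes T: "T > 0"
  shows "\<exists>\<epsilon> \<delta>. (\<forall>i. \<epsilon> i = 1 \<or> \<epsilon> i = -1) \<and> (\<forall>i. \<delta> i = 1 \<or> \<delta> i = -1) \<and>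
    (\<forall>t<T. let N' = (\<lambda>b q. \<Sum>i<d. \<Sum>j<d. of_real (flat_rot p \<epsilon> i b) * N t i j * of_real (flat_rot p \<delta> j q));
         s = (\<Sum>i<d. \<Sum>j<d. (cmod (N t i j))\<^sup>2) in
       (\<Sum>b<d. \<Sum>q<d. (cmod (N' b q))\<^sup>2) = s \<and>
       (\<forall>b<d. (\<Sum>q<d. (cmod (N' b q))\<^sup>2) \<le> u\<^sup>2 / 2 ^ p * s) \<and>
       (\<forall>q<d. (\<Sum>b<d. (cmod (N' b q))\<^sup>2) \<le> u\<^sup>2 / 2 ^ p * s))"
proof -
  obtain \<epsilon> where e: "\<And>i. \<epsilon> i = 1 \<or> \<epsilon> i = -1" and
    E: "\<And>t b j. t < T \<Longrightarrow> b < d \<Longrightarrow> j < d \<Longrightarrow> (cmod (\<Sum>i<d. of_real (flat_rot p \<epsilon> i b) * N t i j))\<^sup>2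
        \<le> u\<^sup>2 / 2 ^ p * (\<Sum>i<d. (cmod (N t i j))\<^sup>2)"
    using exists_flattening_signs[OF T, of p N] unfolding d_def u_def by blast
  define K where "K t b j = (\<Sum>i<d. of_real (flat_rot p \<epsilon> i b) * N t i j)" for t b j
  obtain \<delta> where dl: "\<And>i. \<delta> i = 1 \<or> \<delta> i = -1" and
    D: "\<And>t q b. t < T \<Longrightarrow> q < d \<Longrightarrow> b < d \<Longrightarrow> (cmod (\<Sum>j<d. of_real (flat_rot p \<delta> j q) * K t b j))\<^sup>2
        \<le> u\<^sup>2 / 2 ^ p * (\<Sum>j<d. (cmod (K t b j))\<^sup>2)"
    using exists_flattening_signs[OF T, of p "\<lambda>t j b. K t b j"] unfolding d_def u_def by blast
  have N': "(\<Sum>i<d. \<Sum>j<d. of_real (flat_rot p \<epsilon> i b) * N t i j * of_real (flat_rot p \<delta> j q))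
      = (\<Sum>j<d. of_real (flat_rot p \<delta> j q) * K t b j)" for t b q
    by (subst sum.swap) (simp add: K_def sum_distrib_left mult_ac)
  have row: "(\<Sum>q<d. (cmod (\<Sum>j<d. of_real (flat_rot p \<delta> j q) * K t b j))\<^sup>2) = (\<Sum>j<d. (cmod (K t b j))\<^sup>2)" for t b
    using flat_rot_orthonormal_cols[OF dl] unfolding d_def by (rule sum_cmod_square_orthonormal)
  have colK: "(\<Sum>b<d. (cmod (K t b j))\<^sup>2) = (\<Sum>i<d. (cmod (N t i j))\<^sup>2)" for t j
    using flat_rot_orthonormal_cols[OF e] unfolding d_def K_def by (rule sum_cmod_square_orthonormal)
  have totK: "(\<Sum>b<d. \<Sum>j<d. (cmod (K t b j))\<^sup>2) = (\<Sum>i<d. \<Sum>j<d. (cmod (N t i j))\<^sup>2)" for t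
    by (subst (1 2) sum.swap) (simp add: colK)
  have r: "(\<Sum>j<d. (cmod (K t b j))\<^sup>2) \<le> u\<^sup>2 / 2 ^ p * (\<Sum>i<d. \<Sum>j<d. (cmod (N t i j))\<^sup>2)"
    if "t < T" "b < d" for t b
  proof -
    have "(\<Sum>j<d. (cmod (K t b j))\<^sup>2) \<le> (\<Sum>j<d. u\<^sup>2 / 2 ^ p * (\<Sum>i<d. (cmod (N t i j))\<^sup>2))"
      unfolding K_def using that by (intro sum_mono E) auto
    then show ?thesis by (subst sum.swap) (simp only: sum_distrib_left)
  qed
  have c: "(\<Sum>b<d. (cmod (\<Sum>j<d. of_real (flat_rot p \<delta> j q) * K t b j))\<^sup>2)
      \<le> u\<^sup>2 / 2 ^ p * (\<Sum>i<d. \<Sum>j<d. (cmod (N t i j))\<^sup>2)" if "t < T" "q < d" for t q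
  proof -
    have "(\<Sum>b<d. (cmod (\<Sum>j<d. of_real (flat_rot p \<delta> j q) * K t b j))\<^sup>2)
        \<le> (\<Sum>b<d. u\<^sup>2 / 2 ^ p * (\<Sum>j<d. (cmod (K t b j))\<^sup>2))"
      using that by (intro sum_mono D) auto
    then show ?thesis unfolding totK[symmetric] by (simp only: sum_distrib_left)
  qed
  show ?thesis
    unfolding Let_def
    by (rule exI[of _ \<epsilon>], rule exI[of _ \<delta>], intro conjI allI impI)
       (simp_all only: e dl N' row totK r c)
qed

section \<open>Haar measure on matrix groups\<close>

definition plane_rot :: "nat \<Rightarrow> nat \<Rightarrow> nat \<Rightarrow> real \<Rightarrow> real \<Rightarrow> complex mat" where
  "plane_rot d i k c s = mat d d (\<lambda>(x, y). if x = y then (if x = i \<or> x = k then of_real c else 1)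
     else if x = i \<and> y = k then of_real s else if x = k \<and> y = i then - of_real s else 0)"

lemma plane_rot_carrier [simp]: "plane_rot d i k c s \<in> carrier_mat d d"
  by (simp add: plane_rot_def)

lemma mat_mult_index_sum:
  assumes "A \<in> carrier_mat n m" "B \<in> carrier_mat m l" "i < n" "j < l"
  shows "(A * B) $$ (i, j) = (\<Sum>k<m. A $$ (i, k) * B $$ (k, j))"
  using assms by (simp add: scalar_prod_def lessThan_atLeast0)

lemma diag_mult_index:
  assumes "U \<in> carrier_mat d d" "x < d" "p < d"
  shows "(mat d d (\<lambda>(i, j). if i = j then f i else 0) * U) $$ (x, p) = f x * U $$ (x, p)"
proof -
  have "(mat d d (\<lambda>(i, j). if i = j then f i else 0) * U) $$ (x, p)
    = (\<Sum>y<d. mat d d (\<lambda>(i, j). if i = j then f i else 0) $$ (x, y) * U $$ (y, p))"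
    using assms by (intro mat_mult_index_sum) auto
  also have "\<dots> = (\<Sum>y<d. if y = x then f x * U $$ (x, p) else 0)"
    using assms by (intro sum.cong) auto
  finally show ?thesis using assms by simp
qed

lemma plane_rot_mult:
  assumes "U \<in> carrier_mat d l" "i < d" "k < d" "i \<noteq> k" "x < d" "p < l"
  shows "(plane_rot d i k c s * U) $$ (x, p) =
    (if x = i then of_real c * U $$ (i, p) + of_real s * U $$ (k, p)
     else if x = k then of_real c * U $$ (k, p) - of_real s * U $$ (i, p) else U $$ (x, p))"
proof -
  have "(plane_rot d i k c s * U) $$ (x, p) = (\<Sum>y<d. plane_rot d i k c s $$ (x, y) * U $$ (y, p))"
    using assms by (intro mat_mult_index_sum) auto
  also have "\<dots> = (\<Sum>y<d. (if y = x then (if x = i \<or> x = k then of_real c else 1) * U $$ (x, p) else 0)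
      + (if y = k then (if x = i then of_real s * U $$ (k, p) else 0) else 0)
      + (if y = i then (if x = k then - of_real s * U $$ (i, p) else 0) else 0))"
    using assms by (intro sum.cong refl) (auto simp: plane_rot_def)
  also have "\<dots> = (if x = i \<or> x = k then of_real c else 1) * U $$ (x, p)
      + (if x = i then of_real s * U $$ (k, p) else 0) + (if x = k then - of_real s * U $$ (i, p) else 0)"
    using assms by (simp add: sum.distrib)
  finally show ?thesis using assms by auto
qed

lemma adj_carrier [simp]: "A \<in> carrier_mat n m \<Longrightarrow> adj A \<in> carrier_mat m n"
  by (simp add: adj_def)

lemma adj_index [simp]: "A \<in> carrier_mat n m \<Longrightarrow> i < m \<Longrightarrow> j < n \<Longrightarrow> adj A $$ (i, j) = cnj (A $$ (j, i))"
  by (auto simp: adj_def)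

lemma adj_plane_rot: "i \<noteq> k \<Longrightarrow> adj (plane_rot d i k c s) = plane_rot d i k c (- s)"
  by (intro eq_matI) (auto simp: plane_rot_def adj_def)

lemma plane_rot_inverse:
  assumes "i < d" "k < d" "i \<noteq> k" "c\<^sup>2 + s\<^sup>2 = 1"
  shows "plane_rot d i k c (- s) * plane_rot d i k c s = 1\<^sub>m d"
proof (intro eq_matI)
  fix x y assume "x < dim_row (1\<^sub>m d :: complex mat)" "y < dim_col (1\<^sub>m d :: complex mat)"
  then have xy: "x < d" "y < d" by auto
  have cs: "complex_of_real c * of_real c + of_real s * of_real s = 1"
    using assms(4) by (simp add: power2_eq_square flip: of_real_mult of_real_add)
  show "(plane_rot d i k c (- s) * plane_rot d i k c s) $$ (x, y) = 1\<^sub>m d $$ (x, y)"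
    unfolding plane_rot_mult[OF plane_rot_carrier assms(1-3) xy]
    using assms(1-3) xy cs by (auto simp: plane_rot_def algebra_simps)
qed (auto simp: plane_rot_def)

lemma plane_rot_unitary:
  assumes "i < d" "k < d" "i \<noteq> k" "c\<^sup>2 + s\<^sup>2 = 1"
  shows "plane_rot d i k c s \<in> unitary_group d"
  using plane_rot_inverse[OF assms] plane_rot_inverse[OF assms(1-3), of c "- s"] assms
  by (simp add: unitary_group_def adj_plane_rot)

lemma plane_rot_orthogonal:
  assumes "i < d" "k < d" "i \<noteq> k" "c\<^sup>2 + s\<^sup>2 = 1"
  shows "plane_rot d i k c s \<in> orthogonal_group d"
  unfolding orthogonal_group_def using plane_rot_unitary[OF assms] assms
  by (auto simp: adj_plane_rot intro!: eq_matI) (auto simp: plane_rot_def)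

lemma unitary_group_carrier: "U \<in> unitary_group d \<Longrightarrow> U \<in> carrier_mat d d"
  by (simp add: unitary_group_def)

lemma unitary_cols:
  assumes "U \<in> unitary_group d" "m < d" "n < d"
  shows "(\<Sum>i<d. U $$ (i, m) * cnj (U $$ (i, n))) = (if m = n then 1 else 0)"
proof -
  have U: "U \<in> carrier_mat d d" "adj U * U = 1\<^sub>m d" using assms by (auto simp: unitary_group_def)
  have "(\<Sum>i<d. U $$ (i, m) * cnj (U $$ (i, n))) = (adj U * U) $$ (n, m)"
    using U assms by (subst mat_mult_index_sum[where n = d and m = d and l = d]) (auto simp: mult.commute)
  then show ?thesis using U assms by auto
qed

lemma unitary_entry_le_1:
  assumes "U \<in> unitary_group d" "i < d" "j < d"
  shows "cmod (U $$ (i, j)) \<le> 1"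
proof -
  have "complex_of_real (\<Sum>k<d. (cmod (U $$ (k, j)))\<^sup>2) = 1"
    using unitary_cols[OF assms(1,3,3)] by (simp only: of_real_sum complex_norm_square) simp
  then have "(\<Sum>k<d. (cmod (U $$ (k, j)))\<^sup>2) = 1" by (simp only: of_real_eq_1_iff)
  moreover have "(cmod (U $$ (i, j)))\<^sup>2 \<le> (\<Sum>k<d. (cmod (U $$ (k, j)))\<^sup>2)"
    using assms by (intro member_le_sum) auto
  ultimately show ?thesis by (simp add: power_le_one_iff)
qed

lemma unitary_group_mult:
  assumes "U \<in> unitary_group d" "V \<in> unitary_group d"
  shows "U * V \<in> unitary_group d"
proof -
  have c: "U \<in> carrier_mat d d" "V \<in> carrier_mat d d" and u: "adj U * U = 1\<^sub>m d" "U * adj U = 1\<^sub>m d"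
    and v: "adj V * V = 1\<^sub>m d" "V * adj V = 1\<^sub>m d"
    using assms by (auto simp: unitary_group_def)
  have cc: "U * V \<in> carrier_mat d d" "adj U \<in> carrier_mat d d" "adj V \<in> carrier_mat d d" "adj V * adj U \<in> carrier_mat d d"
    using c mult_carrier_mat[of "adj V" d d "adj U" d] by auto
  have a: "adj (U * V) = adj V * adj U"
  proof (intro eq_matI)
    fix i j assume "i < dim_row (adj V * adj U)" "j < dim_col (adj V * adj U)"
    then have ij: "i < d" "j < d" using c by (auto simp: adj_def)
    show "adj (U * V) $$ (i, j) = (adj V * adj U) $$ (i, j)"
      using c ij mat_mult_index_sum[OF c, of j i] mat_mult_index_sum[of "adj V" d d "adj U" d i j]
      by (simp add: adj_index[of "U * V" d d] cnj_sum mult.commute del: index_mult_mat)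
  qed (use c in \<open>auto simp: adj_def\<close>)
  have "adj V * adj U * (U * V) = adj V * (adj U * (U * V))"
    using c cc by (intro assoc_mult_mat[of _ d d _ d _ d])
  moreover have "adj U * (U * V) = adj U * U * V"
    using c cc by (intro assoc_mult_mat[symmetric, of _ d d _ d _ d])
  ultimately have 1: "adj V * adj U * (U * V) = 1\<^sub>m d" using c u v by simp
  have "U * V * (adj V * adj U) = U * (V * (adj V * adj U))"
    using c cc by (intro assoc_mult_mat[of _ d d _ d _ d])
  moreover have "V * (adj V * adj U) = V * adj V * adj U"
    using c cc by (intro assoc_mult_mat[symmetric, of _ d d _ d _ d])
  moreover have "1\<^sub>m d * adj U = adj U"
    using cc by (intro left_mult_one_mat)
  ultimately have 2: "U * V * (adj V * adj U) = 1\<^sub>m d" using c u v by simp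
  show ?thesis using 1 2 c by (simp add: unitary_group_def a)
qed

lemma space_mat_borel [simp]: "space (mat_borel d) = carrier_mat d d"
  unfolding mat_borel_def by (rule space_measure_of) auto

lemma entry_measurable:
  assumes "i < d" "j < d"
  shows "(\<lambda>M. M $$ (i, j)) \<in> borel_measurable (mat_borel d)"
proof (rule measurableI)
  fix A :: "complex set" assume "A \<in> sets borel"
  then have "{M \<in> carrier_mat d d. M $$ (i, j) \<in> A} \<in> sets (mat_borel d)"
    unfolding mat_borel_def using assms by (subst sets_measure_of) auto
  moreover have "(\<lambda>M. M $$ (i, j)) -` A \<inter> space (mat_borel d) = {M \<in> carrier_mat d d. M $$ (i, j) \<in> A}"
    by auto
  ultimately show "(\<lambda>M. M $$ (i, j)) -` A \<inter> space (mat_borel d) \<in> sets (mat_borel d)" by simp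
qed simp

lemma measurable_mat_borelI:
  fixes f :: "'a \<Rightarrow> complex mat"
  assumes "\<And>x. x \<in> space M \<Longrightarrow> f x \<in> carrier_mat d d"
    and "\<And>i j. i < d \<Longrightarrow> j < d \<Longrightarrow> (\<lambda>x. f x $$ (i, j)) \<in> borel_measurable M"
  shows "f \<in> measurable M (mat_borel d)"
  unfolding mat_borel_def
proof (rule measurable_measure_of)
  fix y :: "complex mat set"
  assume "y \<in> {{M \<in> carrier_mat d d. M $$ (i, j) \<in> A} |i j A. i < d \<and> j < d \<and> A \<in> sets borel}"
  then obtain i j A where y: "y = {M \<in> carrier_mat d d. M $$ (i, j) \<in> A}" "i < d" "j < d" "A \<in> sets borel"
    by blast
  have "f -` y \<inter> space M = (\<lambda>x. f x $$ (i, j)) -` A \<inter> space M"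
    using assms(1) y by auto
  then show "f -` y \<inter> space M \<in> sets M"
    using measurable_sets[OF assms(2)[OF y(2,3)] y(4)] by simp
qed (use assms in auto)

lemma left_mult_measurable:
  assumes "g \<in> carrier_mat d d"
  shows "(\<lambda>U. g * U) \<in> measurable (mat_borel d) (mat_borel d)"
proof (rule measurable_mat_borelI)
  fix i j assume ij: "i < d" "j < d"
  have "(\<lambda>U. \<Sum>k<d. g $$ (i, k) * U $$ (k, j)) \<in> borel_measurable (mat_borel d)"
    using ij by (intro borel_measurable_sum borel_measurable_times borel_measurable_const entry_measurable) auto
  moreover have "(\<lambda>U. (g * U) $$ (i, j)) \<in> borel_measurable (mat_borel d)
     \<longleftrightarrow> (\<lambda>U. \<Sum>k<d. g $$ (i, k) * U $$ (k, j)) \<in> borel_measurable (mat_borel d)"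
    using assms ij by (intro measurable_cong mat_mult_index_sum) auto
  ultimately show "(\<lambda>U. (g * U) $$ (i, j)) \<in> borel_measurable (mat_borel d)" by blast
qed (use assms in auto)

lemma right_mult_measurable:
  assumes "g \<in> carrier_mat d d"
  shows "(\<lambda>U. U * g) \<in> measurable (mat_borel d) (mat_borel d)"
proof (rule measurable_mat_borelI)
  fix i j assume ij: "i < d" "j < d"
  have "(\<lambda>U. \<Sum>k<d. U $$ (i, k) * g $$ (k, j)) \<in> borel_measurable (mat_borel d)"
    using ij by (intro borel_measurable_sum borel_measurable_times borel_measurable_const entry_measurable) auto
  moreover have "(\<lambda>U. (U * g) $$ (i, j)) \<in> borel_measurable (mat_borel d)
     \<longleftrightarrow> (\<lambda>U. \<Sum>k<d. U $$ (i, k) * g $$ (k, j)) \<in> borel_measurable (mat_borel d)"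
    using assms ij by (intro measurable_cong mat_mult_index_sum) auto
  ultimately show "(\<lambda>U. (U * g) $$ (i, j)) \<in> borel_measurable (mat_borel d)" by blast
qed (use assms in auto)

section \<open>Integration against a left-invariant probability measure\<close>

locale haar_measure =
  fixes d :: nat and G :: "complex mat set" and \<mu> :: "complex mat measure"
  assumes haar: "haar_prob d G \<mu>" and unitary: "G \<subseteq> unitary_group d"
begin

sublocale prob_space \<mu> using haar by (simp add: haar_prob_def)

lemma sets_haar: "sets \<mu> = sets (mat_borel d)" using haar by (simp add: haar_prob_def)

lemma space_haar [simp]: "space \<mu> = carrier_mat d d"
  using sets_eq_imp_space_eq[OF sets_haar] by simp

lemma measurable_haar: "measurable \<mu> N = measurable (mat_borel d) N"
  by (rule measurable_cong_sets[OF sets_haar refl])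

lemma AE_in_group: "AE U in \<mu>. U \<in> G"
proof -
  have "G \<in> sets \<mu>" "emeasure \<mu> G = 1" using haar by (auto simp: haar_prob_def)
  then show ?thesis by (intro AE_prob_1) (simp add: measure_def)
qed

lemma group_carrier: "U \<in> G \<Longrightarrow> U \<in> carrier_mat d d"
  using unitary unitary_group_carrier by blast

lemma distr_left_mult:
  assumes g: "g \<in> G"
  shows "distr \<mu> \<mu> (\<lambda>U. g * U) = \<mu>"
proof (rule measure_eqI)
  have m: "(\<lambda>U. g * U) \<in> measurable \<mu> \<mu>"
    using left_mult_measurable[OF group_carrier[OF g]] by (simp add: measurable_haar measurable_cong_sets[OF refl sets_haar])
  fix A assume A: "A \<in> sets (distr \<mu> \<mu> (\<lambda>U. g * U))"
  then have "emeasure (distr \<mu> \<mu> (\<lambda>U. g * U)) A = emeasure \<mu> ((\<lambda>U. g * U) -` A \<inter> space \<mu>)"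
    using m by (intro emeasure_distr) auto
  also have "(\<lambda>U. g * U) -` A \<inter> space \<mu> = {M \<in> space \<mu>. g * M \<in> A}" by auto
  also have "emeasure \<mu> \<dots> = emeasure \<mu> A" using haar g A by (simp add: haar_prob_def)
  finally show "emeasure (distr \<mu> \<mu> (\<lambda>U. g * U)) A = emeasure \<mu> A" .
qed simp

lemma integral_left_mult:
  fixes f :: "complex mat \<Rightarrow> 'b::{banach, second_countable_topology}"
  assumes g: "g \<in> G" and f: "f \<in> borel_measurable \<mu>"
  shows "(\<integral>U. f (g * U) \<partial>\<mu>) = (\<integral>U. f U \<partial>\<mu>)"
proof -
  have m: "(\<lambda>U. g * U) \<in> measurable \<mu> \<mu>"
    using left_mult_measurable[OF group_carrier[OF g]] by (simp add: measurable_haar measurable_cong_sets[OF refl sets_haar])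
  show ?thesis using integral_distr[OF m f] distr_left_mult[OF g] by simp
qed

text \<open>Boundedness is required on \<open>G\<close> only, where the measure is concentrated; on
  all matrices the entries are unbounded.\<close>

definition bm :: "(complex mat \<Rightarrow> 'b::real_normed_field) \<Rightarrow> bool" where
  "bm f \<longleftrightarrow> f \<in> borel_measurable \<mu> \<and> (\<exists>B. \<forall>U\<in>G. norm (f U) \<le> B)"

lemma bm_measurable: "bm f \<Longrightarrow> f \<in> borel_measurable \<mu>" by (simp add: bm_def)

lemma bm_integrable:
  fixes f :: "complex mat \<Rightarrow> 'b::{real_normed_field, banach, second_countable_topology}"
  assumes "bm f" shows "integrable \<mu> f"
proof -
  obtain B where "\<forall>U\<in>G. norm (f U) \<le> B" using assms by (auto simp: bm_def)
  then have "AE U in \<mu>. norm (f U) \<le> B" using AE_in_group by (auto elim: eventually_mono)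
  then show ?thesis using assms by (intro integrable_const_bound) (auto simp: bm_def)
qed

lemma bm_const: "bm (\<lambda>_. c)" by (auto simp: bm_def)

lemma bm_entry: "i < d \<Longrightarrow> j < d \<Longrightarrow> bm (\<lambda>U. U $$ (i, j))"
  unfolding bm_def measurable_haar using entry_measurable unitary unitary_entry_le_1 by blast

lemma bm_cnj: "bm f \<Longrightarrow> bm (\<lambda>U. cnj (f U))"
  using measurable_compose[OF _ borel_measurable_continuous_onI[OF continuous_on_cnj[OF continuous_on_id]], of f]
  by (auto simp: bm_def)

lemma bm_add:
  fixes f :: "complex mat \<Rightarrow> 'b::{real_normed_field, second_countable_topology}"
  assumes "bm f" "bm g" shows "bm (\<lambda>U. f U + g U)"
proof -
  obtain B C where "\<And>U. U \<in> G \<Longrightarrow> norm (f U) \<le> B" "\<And>U. U \<in> G \<Longrightarrow> norm (g U) \<le> C"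
    using assms by (auto simp: bm_def)
  then have "\<forall>U\<in>G. norm (f U + g U) \<le> B + C" by (auto intro: norm_triangle_mono)
  then show ?thesis using assms by (auto simp: bm_def)
qed

lemma bm_mult:
  fixes f :: "complex mat \<Rightarrow> 'b::{real_normed_field, second_countable_topology}"
  assumes "bm f" "bm g" shows "bm (\<lambda>U. f U * g U)"
proof -
  obtain B C where BC: "\<And>U. U \<in> G \<Longrightarrow> norm (f U) \<le> B" "\<And>U. U \<in> G \<Longrightarrow> norm (g U) \<le> C"
    using assms by (auto simp: bm_def)
  have "norm (f U * g U) \<le> B * C" if "U \<in> G" for U
    unfolding norm_mult using BC[OF that] by (intro mult_mono) (auto intro: order_trans[OF norm_ge_zero])
  then show ?thesis using assms by (auto simp: bm_def)
qed

lemma bm_minus: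
  fixes f :: "complex mat \<Rightarrow> 'b::{real_normed_field, second_countable_topology}"
  assumes "bm f" shows "bm (\<lambda>U. - f U)"
  using bm_mult[OF bm_const[of "-1"] assms] by simp

lemma bm_diff:
  fixes f :: "complex mat \<Rightarrow> 'b::{real_normed_field, second_countable_topology}"
  assumes "bm f" "bm g" shows "bm (\<lambda>U. f U - g U)"
  using bm_add[OF assms(1) bm_minus[OF assms(2)]] by simp

lemma bm_sum:
  fixes f :: "'i \<Rightarrow> complex mat \<Rightarrow> 'b::{real_normed_field, second_countable_topology}"
  assumes "\<And>i. i \<in> I \<Longrightarrow> bm (f i)" shows "bm (\<lambda>U. \<Sum>i\<in>I. f i U)"
  using assms by (induction I rule: infinite_finite_induct) (auto intro: bm_const bm_add)

lemma bm_prod: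
  fixes f :: "'i \<Rightarrow> complex mat \<Rightarrow> 'b::{real_normed_field, second_countable_topology}"
  assumes "\<And>i. i \<in> I \<Longrightarrow> bm (f i)" shows "bm (\<lambda>U. \<Prod>i\<in>I. f i U)"
  using assms by (induction I rule: infinite_finite_induct) (auto intro: bm_const bm_mult)

lemma bm_Re: "bm f \<Longrightarrow> bm (\<lambda>U. Re (f U))"
  by (auto simp: bm_def intro: order_trans[OF abs_Re_le_cmod])

lemma bm_norm_square: "bm f \<Longrightarrow> bm (\<lambda>U. (cmod (f U))\<^sup>2)"
  using bm_Re[OF bm_mult[OF _ bm_cnj], of f f] by (simp flip: complex_norm_square of_real_power)

lemmas bm_intros = bm_const bm_entry bm_cnj bm_add bm_mult bm_minus bm_diff bm_sum bm_prod

text \<open>A rotation-invariant quartic form in the angle has vanishing derivative at angle zero;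
  the four rational angles extract that derivative without any analysis.\<close>

lemma integral_rotation_derivative4:
  fixes u1 u2 u3 u4 v1 v2 v3 v4 h :: "complex mat \<Rightarrow> complex"
  assumes bm: "bm u1" "bm u2" "bm u3" "bm u4" "bm v1" "bm v2" "bm v3" "bm v4" "bm h"
    and inv: "\<And>c s :: real. c\<^sup>2 + s\<^sup>2 = 1 \<Longrightarrow>
      (\<integral>U. (of_real c * u1 U + of_real s * v1 U) * (of_real c * u2 U + of_real s * v2 U) *
        (of_real c * u3 U + of_real s * v3 U) * (of_real c * u4 U + of_real s * v4 U) * h U \<partial>\<mu>) = I"
  shows "(\<integral>U. v1 U * u2 U * u3 U * u4 U * h U \<partial>\<mu>) + (\<integral>U. u1 U * v2 U * u3 U * u4 U * h U \<partial>\<mu>)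
    + (\<integral>U. u1 U * u2 U * v3 U * u4 U * h U \<partial>\<mu>) + (\<integral>U. u1 U * u2 U * u3 U * v4 U * h U \<partial>\<mu>) = 0"
proof -
  define F where "F c s U = (of_real c * u1 U + of_real s * v1 U) * (of_real c * u2 U + of_real s * v2 U) *
        (of_real c * u3 U + of_real s * v3 U) * (of_real c * u4 U + of_real s * v4 U) * h U" for c s :: real and U
  have F: "integrable \<mu> (F c s)" for c s
    unfolding F_def[abs_def] using bm by (intro bm_integrable bm_intros)
  have I: "(\<integral>U. F c s U \<partial>\<mu>) = I" if "c\<^sup>2 + s\<^sup>2 = 1" for c s
    unfolding F_def using inv[OF that] .
  have int: "integrable \<mu> (\<lambda>U. v1 U * u2 U * u3 U * u4 U * h U)" "integrable \<mu> (\<lambda>U. u1 U * v2 U * u3 U * u4 U * h U)"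
    "integrable \<mu> (\<lambda>U. u1 U * u2 U * v3 U * u4 U * h U)" "integrable \<mu> (\<lambda>U. u1 U * u2 U * u3 U * v4 U * h U)"
    using bm by (simp_all add: bm_integrable bm_mult)
  have "(\<integral>U. v1 U * u2 U * u3 U * u4 U * h U \<partial>\<mu>) + (\<integral>U. u1 U * v2 U * u3 U * u4 U * h U \<partial>\<mu>)
    + (\<integral>U. u1 U * u2 U * v3 U * u4 U * h U \<partial>\<mu>) + (\<integral>U. u1 U * u2 U * u3 U * v4 U * h U \<partial>\<mu>)
    = (\<integral>U. v1 U * u2 U * u3 U * u4 U * h U + u1 U * v2 U * u3 U * u4 U * h U
        + u1 U * u2 U * v3 U * u4 U * h U + u1 U * u2 U * u3 U * v4 U * h U \<partial>\<mu>)"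
    using int by simp
  \<comment> \<open>The part of F odd in s is c^3 s q1 + c s^3 q3, and q1 is the wanted derivative.
    The coefficients solve the 2 by 2 system that isolates q1 from the angles (3/5, 4/5) and (4/5,
    3/5).\<close>
  also have "\<dots> = (\<integral>U. - 75/56 * (F (3/5) (4/5) U - F (3/5) (- 4/5) U)
        + 50/21 * (F (4/5) (3/5) U - F (4/5) (- 3/5) U) \<partial>\<mu>)"
    unfolding F_def by (intro Bochner_Integration.integral_cong refl) (simp add: field_simps)
  also have "\<dots> = - 75/56 * ((\<integral>U. F (3/5) (4/5) U \<partial>\<mu>) - (\<integral>U. F (3/5) (- 4/5) U \<partial>\<mu>))
        + 50/21 * ((\<integral>U. F (4/5) (3/5) U \<partial>\<mu>) - (\<integral>U. F (4/5) (- 3/5) U \<partial>\<mu>))"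
    using F by simp
  also have "\<dots> = 0" by (simp add: I power2_eq_square)
  finally show ?thesis .
qed

lemma integral_rotation_derivative2:
  fixes u1 u2 v1 v2 h :: "complex mat \<Rightarrow> complex"
  assumes bm: "bm u1" "bm u2" "bm v1" "bm v2" "bm h"
    and inv: "\<And>c s :: real. c\<^sup>2 + s\<^sup>2 = 1 \<Longrightarrow>
      (\<integral>U. (of_real c * u1 U + of_real s * v1 U) * (of_real c * u2 U + of_real s * v2 U) * h U \<partial>\<mu>) = I"
  shows "(\<integral>U. v1 U * u2 U * h U \<partial>\<mu>) + (\<integral>U. u1 U * v2 U * h U \<partial>\<mu>) = 0"
proof -
  define F where "F c s U = (of_real c * u1 U + of_real s * v1 U) * (of_real c * u2 U + of_real s * v2 U) * h U"
    for c s :: real and U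
  have F: "integrable \<mu> (F c s)" for c s
    unfolding F_def[abs_def] using bm by (intro bm_integrable bm_intros)
  have I: "(\<integral>U. F c s U \<partial>\<mu>) = I" if "c\<^sup>2 + s\<^sup>2 = 1" for c s
    unfolding F_def using inv[OF that] .
  have int: "integrable \<mu> (\<lambda>U. v1 U * u2 U * h U)" "integrable \<mu> (\<lambda>U. u1 U * v2 U * h U)"
    using bm by (simp_all add: bm_integrable bm_mult)
  have "(\<integral>U. v1 U * u2 U * h U \<partial>\<mu>) + (\<integral>U. u1 U * v2 U * h U \<partial>\<mu>)
    = (\<integral>U. v1 U * u2 U * h U + u1 U * v2 U * h U \<partial>\<mu>)"
    using int by simp
  \<comment> \<open>With two factors the odd part is c s q1 alone, and 2 (3/5) (4/5) =
    24/25.\<close>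
  also have "\<dots> = (\<integral>U. 25/24 * (F (3/5) (4/5) U - F (3/5) (- 4/5) U) \<partial>\<mu>)"
    unfolding F_def by (intro Bochner_Integration.integral_cong refl) (simp add: field_simps)
  also have "\<dots> = 25/24 * ((\<integral>U. F (3/5) (4/5) U \<partial>\<mu>) - (\<integral>U. F (3/5) (- 4/5) U \<partial>\<mu>))"
    using F by simp
  also have "\<dots> = 0" by (simp add: I power2_eq_square)
  finally show ?thesis .
qed

lemma integral_zero_by_phase:
  fixes f :: "complex mat \<Rightarrow> complex"
  assumes "g \<in> G" "bm f" "\<And>U. U \<in> carrier_mat d d \<Longrightarrow> f (g * U) = \<zeta> * f U" "\<zeta> \<noteq> 1"
  shows "(\<integral>U. f U \<partial>\<mu>) = 0"
proof -
  have "(\<integral>U. f U \<partial>\<mu>) = (\<integral>U. f (g * U) \<partial>\<mu>)"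
    using integral_left_mult[OF assms(1) bm_measurable[OF assms(2)]] by simp
  also have "\<dots> = (\<integral>U. \<zeta> * f U \<partial>\<mu>)"
    by (intro Bochner_Integration.integral_cong) (auto simp: assms(3))
  also have "\<dots> = \<zeta> * (\<integral>U. f U \<partial>\<mu>)" by simp
  finally show ?thesis using assms(4) by auto
qed

text \<open>Left and right multiplication commute, so the right translate is again left-invariant.
  The moment estimates hold for every such measure and are later applied to a translate.\<close>

lemma haar_right_translate:
  assumes V: "V \<in> G" and cl: "\<And>U. U \<in> G \<Longrightarrow> U * V \<in> G"
  shows "haar_prob d G (distr \<mu> \<mu> (\<lambda>U. U * V))"
proof -
  have cV: "V \<in> carrier_mat d d" using group_carrier[OF V] .
  have m: "(\<lambda>U. U * V) \<in> measurable \<mu> \<mu>"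
    using right_mult_measurable[OF cV] by (simp add: measurable_haar measurable_cong_sets[OF refl sets_haar])
  let ?\<nu> = "distr \<mu> \<mu> (\<lambda>U. U * V)"
  have G: "G \<in> sets \<mu>" "emeasure \<mu> G = 1" using haar by (auto simp: haar_prob_def)
  interpret \<nu>: prob_space ?\<nu> using m by (rule prob_space_distr)
  have "AE U in \<mu>. U * V \<in> G" using AE_in_group by eventually_elim (rule cl)
  moreover have "{U \<in> space \<mu>. U \<in> G} = G" using group_carrier by auto
  then have "{U \<in> space \<mu>. U \<in> G} \<in> sets \<mu>" using G(1) by simp
  ultimately have "AE U in ?\<nu>. U \<in> G" by (subst AE_distr_iff[OF m]) auto
  then have "emeasure ?\<nu> G = 1" using G \<nu>.emeasure_eq_1_AE by simp
  moreover have "emeasure ?\<nu> {M \<in> space ?\<nu>. g * M \<in> A} = emeasure ?\<nu> A" if g: "g \<in> G" and A: "A \<in> sets ?\<nu>" for g A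
  proof -
    have cg: "g \<in> carrier_mat d d" using group_carrier[OF g] .
    have mg: "(\<lambda>U. g * U) \<in> measurable \<mu> \<mu>"
      using left_mult_measurable[OF cg] by (simp add: measurable_haar measurable_cong_sets[OF refl sets_haar])
    have A': "A \<in> sets \<mu>" using A by simp
    have B: "{M \<in> space \<mu>. g * M \<in> A} \<in> sets \<mu>"
      using measurable_sets[OF mg A'] by (simp add: vimage_def Int_def conj_commute)
    have C: "{M \<in> space \<mu>. M * V \<in> A} \<in> sets \<mu>"
      using measurable_sets[OF m A'] by (simp add: vimage_def Int_def conj_commute)
    have "emeasure ?\<nu> {M \<in> space ?\<nu>. g * M \<in> A} = emeasure \<mu> ((\<lambda>U. U * V) -` {M \<in> space \<mu>. g * M \<in> A} \<inter> space \<mu>)"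
      using m B by (subst emeasure_distr) auto
    also have "(\<lambda>U. U * V) -` {M \<in> space \<mu>. g * M \<in> A} \<inter> space \<mu> = {M \<in> space \<mu>. g * M \<in> {M \<in> space \<mu>. M * V \<in> A}}"
      using cV cg by (auto simp: assoc_mult_mat[of g d d _ d V d])
    also have "emeasure \<mu> \<dots> = emeasure \<mu> {M \<in> space \<mu>. M * V \<in> A}"
    proof -
      have "\<forall>g\<in>G. \<forall>A\<in>sets \<mu>. emeasure \<mu> {M \<in> space \<mu>. g * M \<in> A} = emeasure \<mu> A"
        using haar unfolding haar_prob_def by blast
      from this[rule_format, OF g C] show ?thesis .
    qed
    also have "\<dots> = emeasure ?\<nu> A"
      using m A' by (subst emeasure_distr) (auto simp: vimage_def Int_def conj_commute)
    finally show ?thesis .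
  qed
  ultimately show ?thesis
    using G \<nu>.prob_space_axioms by (simp add: haar_prob_def sets_haar)
qed

end

section \<open>Mixed moments\<close>

lemma prod_remove_two:
  fixes f :: "'a \<Rightarrow> 'b::comm_monoid_mult"
  assumes "finite A" "a \<in> A" "k \<in> A" "a \<noteq> k"
  shows "prod f A = f a * f k * prod f (A - {a, k})"
proof -
  have "A - {a} - {k} = A - {a, k}" by auto
  then show ?thesis
    using assms prod.remove[of A a f] prod.remove[of "A - {a}" k f] by (simp add: mult.assoc)
qed

context haar_measure begin

text \<open>One plain and one conjugated entry in each row of A. The overlap of two monomials, each
  with distinct rows, takes this form once their row sets agree; only the columns c and c' can still
  differ.\<close>

definition moment :: "nat set \<Rightarrow> (nat \<Rightarrow> nat) \<Rightarrow> (nat \<Rightarrow> nat) \<Rightarrow> complex" where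
  "moment A c c' = (\<integral>U. (\<Prod>a\<in>A. U $$ (a, c a) * cnj (U $$ (a, c' a))) \<partial>\<mu>)"

lemma moment_cong:
  "(\<And>a. a \<in> A \<Longrightarrow> c a = e a) \<Longrightarrow> (\<And>a. a \<in> A \<Longrightarrow> c' a = e' a) \<Longrightarrow> moment A c c' = moment A e e'"
  unfolding moment_def by (intro Bochner_Integration.integral_cong prod.cong) auto

lemma moment_empty [simp]: "moment {} c c' = 1"
  using prob_space by (simp add: moment_def)

end

text \<open>The recursion is what invariance under the infinitesimal rotations of row \<open>k\<close> into each other row gives;
  it is the only property of the three groups that the moment estimates need.\<close>

locale haar_symmetric = haar_measure d G \<mu> + involution d bar for d G \<mu> bar +
  assumes phase_in: "b < d \<Longrightarrow> mat d d (\<lambda>(i, j). if i = j then chi bar b i else 0) \<in> G"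
    and moment_recursion: "\<lbrakk>A \<subseteq> {..<d}; inj_on cls A; k \<in> A; \<And>a. a \<in> A \<Longrightarrow> c a < d; \<And>a. a \<in> A \<Longrightarrow> c' a < d\<rbrakk> \<Longrightarrow>
      cmod (of_nat d * moment A c c' - (if c k = c' k then moment (A - {k}) c c' else 0)) \<le>
      (\<Sum>a\<in>A - {k}. cmod (moment A (c(a := c k, k := c a)) c')
         + cmod (moment A (c(k := bar (c' a))) (c'(a := bar (c k)))))"
begin

lemma chi_mult_cnj: "chi bar b i * cnj (chi bar b i) = 1"
  by (metis cmod_chi complex_norm_square of_real_1 power_one)

text \<open>This plays the part of invariance under right multiplication by phases. Among the column
  pairs with different characters, one of maximal modulus Z is taken. All terms of the recursion
  keep the characters different: a swap leaves the product for c unchanged, and a crossed term moves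
  one factor to each other side as a conjugate. The lower moment vanishes by induction, so d Z \<le>
  (2 card A - 2) Z, and 2 card A \<le> d forces Z = 0.\<close>

lemma moment_eq_0_of_characters:
  assumes "A \<subseteq> {..<d}" "inj_on cls A" "2 * card A \<le> d" "b < d"
    and "\<And>a. a \<in> A \<Longrightarrow> c a < d" "\<And>a. a \<in> A \<Longrightarrow> c' a < d"
    and "(\<Prod>a\<in>A. chi bar b (c a)) \<noteq> (\<Prod>a\<in>A. chi bar b (c' a))"
  shows "moment A c c' = 0"
  using assms
proof (induction "card A" arbitrary: A c c' rule: less_induct)
  case less
  have fA: "finite A" using less.prems(1) finite_subset by blast
  \<comment> \<open>Functions are cut down to A so that there are finitely many candidates and a
    maximum exists.\<close>
  define D where "D = (A \<rightarrow>\<^sub>E {..<d})"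
  define S where "S = {(e, e') \<in> D \<times> D. (\<Prod>a\<in>A. chi bar b (e a)) \<noteq> (\<Prod>a\<in>A. chi bar b (e' a))}"
  have fS: "finite S" unfolding S_def D_def using fA
    by (intro finite_subset[OF _ finite_cartesian_product[of D D]]) (auto simp: D_def intro: finite_PiE)
  define m where "m = (\<lambda>(e, e'). cmod (moment A e e'))"
  have cS: "(restrict c A, restrict c' A) \<in> S"
    using less.prems by (auto simp: S_def D_def)
  define Z where "Z = Max (m ` S)"
  have Z: "cmod (moment A e e') \<le> Z" if "(e, e') \<in> S" for e e'
    unfolding Z_def using that fS by (intro Max_ge) (auto simp: m_def intro!: image_eqI[of _ _ "(e, e')"])
  have "Z \<in> m ` S" unfolding Z_def using fS cS by (intro Max_in) auto
  then obtain e e' where e: "(e, e') \<in> S" "Z = cmod (moment A e e')" by (auto simp: m_def)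
  have A0: "A \<noteq> {}" using less.prems(7) by auto
  then obtain k where k: "k \<in> A" by auto
  have le: "e a < d" "e' a < d" if "a \<in> A" for a using e(1) that by (auto simp: S_def D_def)
  have ext: "e \<in> D" "e' \<in> D" using e(1) by (auto simp: S_def)
  have ne: "(\<Prod>a\<in>A. chi bar b (e a)) \<noteq> (\<Prod>a\<in>A. chi bar b (e' a))" using e(1) by (auto simp: S_def)
  have base: "(if e k = e' k then moment (A - {k}) e e' else 0) = 0"
  proof -
    have "moment (A - {k}) e e' = 0" if eq: "e k = e' k"
    proof (rule less.hyps)
      show "card (A - {k}) < card A" using fA k by (intro psubset_card_mono) auto
      have "2 * card (A - {k}) \<le> 2 * card A" using fA by (simp add: card_mono)
      also note less.prems(3)
      finally show "2 * card (A - {k}) \<le> d" .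
      show "(\<Prod>a\<in>A - {k}. chi bar b (e a)) \<noteq> (\<Prod>a\<in>A - {k}. chi bar b (e' a))"
        using ne eq prod.remove[OF fA k, of "\<lambda>a. chi bar b (e a)"] prod.remove[OF fA k, of "\<lambda>a. chi bar b (e' a)"]
        by auto
    qed (use less.prems le in \<open>auto intro: inj_on_subset\<close>)
    then show ?thesis by simp
  qed
  have sw: "cmod (moment A (e(a := e k, k := e a)) e')
         + cmod (moment A (e(k := bar (e' a))) (e'(a := bar (e k)))) \<le> 2 * Z" if a: "a \<in> A - {k}" for a
  proof -
    have ak: "a \<in> A" "a \<noteq> k" using a by auto
    let ?P = "\<lambda>f. \<Prod>x\<in>A. chi bar b (f x)" and ?R = "\<lambda>f. \<Prod>x\<in>A - {a, k}. chi bar b (f x)"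
    have P: "?P f = chi bar b (f a) * chi bar b (f k) * ?R f" for f
      using prod_remove_two[OF fA ak(1) k ak(2), of "\<lambda>x. chi bar b (f x)"] .
    have R1: "?R (e(a := e k, k := e a)) = ?R e" by (intro prod.cong) auto
    have R2: "?R (e(k := bar (e' a))) = ?R e" by (intro prod.cong) auto
    have R3: "?R (e'(a := bar (e k))) = ?R e'" by (intro prod.cong) auto
    have "?P (e(a := e k, k := e a)) = ?P e" unfolding P R1 using ak by simp
    then have 1: "(e(a := e k, k := e a), e') \<in> S"
      using ne ext ak k le by (auto simp: S_def D_def PiE_iff extensional_def)
    have "?P (e(k := bar (e' a))) \<noteq> ?P (e'(a := bar (e k)))"
    proof
      assume "?P (e(k := bar (e' a))) = ?P (e'(a := bar (e k)))"
      then have "chi bar b (e a) * cnj (chi bar b (e' a)) * ?R e = cnj (chi bar b (e k)) * chi bar b (e' k) * ?R e'"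
        unfolding P R2 R3 using ak le k less.prems(4) by (simp add: chi_bar)
      \<comment> \<open>Characters have modulus 1, so multiplying by this product undoes the two
        conjugations.\<close>
      then have "chi bar b (e' a) * chi bar b (e k) * (chi bar b (e a) * cnj (chi bar b (e' a)) * ?R e)
        = chi bar b (e' a) * chi bar b (e k) * (cnj (chi bar b (e k)) * chi bar b (e' k) * ?R e')" by simp
      then have "chi bar b (e k) * (chi bar b (e a) * ?R e) * (chi bar b (e' a) * cnj (chi bar b (e' a)))
        = chi bar b (e' a) * (chi bar b (e' k) * ?R e') * (chi bar b (e k) * cnj (chi bar b (e k)))"
        by (simp only: mult_ac)
      then have "?P e = ?P e'" unfolding P chi_mult_cnj by (simp add: mult_ac)
      then show False using ne by simp
    qed
    then have 2: "(e(k := bar (e' a)), e'(a := bar (e k))) \<in> S"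
      using ext ak k le by (auto simp: S_def D_def PiE_iff extensional_def)
    show ?thesis using Z[OF 1] Z[OF 2] by simp
  qed
  have "real d * Z = cmod (of_nat d * moment A e e' - (if e k = e' k then moment (A - {k}) e e' else 0))"
    unfolding base e(2) by (simp add: norm_mult)
  also have "\<dots> \<le> (\<Sum>a\<in>A - {k}. cmod (moment A (e(a := e k, k := e a)) e')
         + cmod (moment A (e(k := bar (e' a))) (e'(a := bar (e k)))))"
    using less.prems k le by (intro moment_recursion) auto
  also have "\<dots> \<le> (\<Sum>a\<in>A - {k}. 2 * Z)" by (intro sum_mono sw)
  also have "\<dots> = (2 * real (card A) - 2) * Z"
    using k fA A0 by (simp add: of_nat_diff Suc_le_eq card_gt_0_iff algebra_simps)
  finally have "(real d - 2 * real (card A) + 2) * Z \<le> 0" by (simp add: algebra_simps)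
  moreover have "real (2 * card A) \<le> real d" using less.prems(3) of_nat_le_iff by blast
  then have "real d - 2 * real (card A) + 2 > 0" by simp
  ultimately have "Z \<le> 0" by (simp add: mult_le_0_iff)
  then have "cmod (moment A (restrict c A) (restrict c' A)) \<le> 0"
    using Z[OF cS] by linarith
  then show ?case using moment_cong[of A c "restrict c A" c' "restrict c' A"] by simp
qed

text \<open>Maximal moments Z of j + 1 rows and Z' of j rows are related by d Z \<le> Z' + 2 j Z;
  this is the solution of the recursion that starts with 1 at zero rows.\<close>

definition mbound :: "nat \<Rightarrow> real" where "mbound j = (\<Prod>i<j. 1 / (real d - 2 * real i))"

lemma mbound_nonneg: "2 * j \<le> d + 1 \<Longrightarrow> mbound j \<ge> 0"
  unfolding mbound_def by (intro prod_nonneg) auto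

text \<open>Maximum principle: the recursion is applied at a pair \<open>(c, c')\<close> which maximizes the moment divided by
  \<open>\<theta> ^ r\<close>, and each of its terms changes \<open>r\<close> by at most two.\<close>

lemma moment_decay:
  fixes \<theta> :: real
  assumes "A \<subseteq> {..<d}" "inj_on cls A" "card A \<le> T" "2 * T \<le> d" "0 < \<theta>" "\<theta> \<le> 1" "\<theta>\<^sup>2 * d = 2 * real T"
    and "\<And>a. a \<in> A \<Longrightarrow> c a < d" "\<And>a. a \<in> A \<Longrightarrow> c' a < d"
  shows "cmod (moment A c c') \<le> mbound (card A) * \<theta> ^ card {a \<in> A. c a \<noteq> c' a}"
  using assms
proof (induction "card A" arbitrary: A c c' rule: less_induct)
  case less
  have fA: "finite A" using less.prems(1) finite_subset by blast
  define r where "r e e' = card {a \<in> A. e a \<noteq> e' a}" for e e' :: "nat \<Rightarrow> nat"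
  define S where "S = (A \<rightarrow>\<^sub>E {..<d}) \<times> (A \<rightarrow>\<^sub>E {..<d})"
  have fS: "finite S" unfolding S_def using fA by (auto intro: finite_PiE)
  define m where "m = (\<lambda>(e, e'). cmod (moment A e e') / \<theta> ^ r e e')"
  have cS: "(restrict c A, restrict c' A) \<in> S"
    using less.prems by (auto simp: S_def)
  define Z where "Z = Max (m ` S)"
  have Z: "cmod (moment A e e') \<le> Z * \<theta> ^ r e e'" if "(e, e') \<in> S" for e e'
  proof -
    have "m (e, e') \<le> Z" unfolding Z_def using that fS by (intro Max_ge) auto
    then show ?thesis using less.prems by (simp add: m_def divide_simps)
  qed
  have "Z \<in> m ` S" unfolding Z_def using fS cS by (intro Max_in) auto
  then obtain e e' where e: "(e, e') \<in> S" "Z = cmod (moment A e e') / \<theta> ^ r e e'" by (auto simp: m_def)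
  have eZ: "cmod (moment A e e') = Z * \<theta> ^ r e e'" using e less.prems by simp
  have Z0: "Z \<ge> 0" using e less.prems by simp
  have le: "e a < d" "e' a < d" if "a \<in> A" for a using e(1) that by (auto simp: S_def)
  have card_le: "real (card A) \<le> real T" using less.prems(3) by simp
  have "real (2 * T) \<le> real d" using less.prems(4) of_nat_le_iff by blast
  then have T_le: "2 * real T \<le> real d" by simp
  \<comment> \<open>A term differs from (e, e') at a and k only, so its number of mismatches is
    smaller by at most two, which costs \<theta>^2. The second form drops the decay altogether and
    serves a maximizer without mismatch.\<close>
  have sw: "\<theta>\<^sup>2 * (cmod (moment A (e(a := e k, k := e a)) e')
         + cmod (moment A (e(k := bar (e' a))) (e'(a := bar (e k))))) \<le> 2 * (Z * \<theta> ^ r e e')"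
    "cmod (moment A (e(a := e k, k := e a)) e')
         + cmod (moment A (e(k := bar (e' a))) (e'(a := bar (e k)))) \<le> 2 * Z" if a: "a \<in> A - {k}" "k \<in> A" for a k
  proof -
    have *: "\<theta>\<^sup>2 * cmod (moment A f f') \<le> Z * \<theta> ^ r e e' \<and> cmod (moment A f f') \<le> Z"
      if f: "(f, f') \<in> S" and out: "\<And>x. x \<noteq> a \<Longrightarrow> x \<noteq> k \<Longrightarrow> f x = e x \<and> f' x = e' x" for f f'
    proof -
      have "{x \<in> A. e x \<noteq> e' x} \<subseteq> {x \<in> A. f x \<noteq> f' x} \<union> {a, k}" using out by auto
      then have "r e e' \<le> card ({x \<in> A. f x \<noteq> f' x} \<union> {a, k})"
        unfolding r_def using fA by (intro card_mono) auto
      also have "\<dots> \<le> r f f' + card {a, k}" unfolding r_def by (rule card_Un_le)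
      also have "\<dots> \<le> r f f' + 2" by (simp add: card_insert_if)
      finally have "\<theta> ^ (r f f' + 2) \<le> \<theta> ^ r e e'"
        using less.prems by (intro power_decreasing) auto
      then have "Z * (\<theta>\<^sup>2 * \<theta> ^ r f f') \<le> Z * \<theta> ^ r e e'"
        using Z0 by (intro mult_left_mono) (auto simp: power_add power2_eq_square mult_ac)
      moreover have "\<theta>\<^sup>2 * cmod (moment A f f') \<le> \<theta>\<^sup>2 * (Z * \<theta> ^ r f f')"
        using Z[OF f] by (intro mult_left_mono) auto
      moreover have "\<theta> ^ r f f' \<le> 1" using less.prems by (simp add: power_le_one)
      then have "Z * \<theta> ^ r f f' \<le> Z * 1" using Z0 by (intro mult_left_mono)
      ultimately show ?thesis using Z[OF f] by (simp add: mult_ac)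
    qed
    have 1: "(e(a := e k, k := e a), e') \<in> S" "(e(k := bar (e' a)), e'(a := bar (e k))) \<in> S"
      using e(1) a le by (auto simp: S_def PiE_iff extensional_def)
    show "\<theta>\<^sup>2 * (cmod (moment A (e(a := e k, k := e a)) e')
         + cmod (moment A (e(k := bar (e' a))) (e'(a := bar (e k))))) \<le> 2 * (Z * \<theta> ^ r e e')"
     "cmod (moment A (e(a := e k, k := e a)) e')
         + cmod (moment A (e(k := bar (e' a))) (e'(a := bar (e k)))) \<le> 2 * Z"
      using *[OF 1(1)] *[OF 1(2)] by (auto simp: algebra_simps)
  qed
  have Zle: "Z \<le> mbound (card A)"
  proof (cases "\<forall>a\<in>A. e a = e' a")
    \<comment> \<open>Without mismatch Z is the moment itself, and the recursion reduces it to the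
      set with row k removed.\<close>
    case diag: True
    then have empty: "{a \<in> A. e a \<noteq> e' a} = {}" by auto
    have r0: "r e e' = 0" unfolding r_def empty by simp
    show ?thesis
    proof (cases "A = {}")
      case True
      then show ?thesis using eZ r0 by (simp add: mbound_def)
    next
      case False
      then obtain k where k: "k \<in> A" by auto
      have cA: "card A = Suc (card (A - {k}))" using card.remove[OF fA k] .
      have "cmod (moment (A - {k}) e e') \<le> mbound (card (A - {k})) * \<theta> ^ card {a \<in> A - {k}. e a \<noteq> e' a}"
        using less.prems le cA by (intro less.hyps) (auto intro: inj_on_subset)
      also have "{a \<in> A - {k}. e a \<noteq> e' a} = {}" using diag by auto
      finally have IH: "cmod (moment (A - {k}) e e') \<le> mbound (card (A - {k}))" by simp
      have "real d * Z = cmod (of_nat d * moment A e e')" using eZ r0 by (simp add: norm_mult)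
      also have "\<dots> \<le> cmod (of_nat d * moment A e e' - (if e k = e' k then moment (A - {k}) e e' else 0))
          + cmod (if e k = e' k then moment (A - {k}) e e' else 0)"
        using norm_triangle_ineq[of "of_nat d * moment A e e' - (if e k = e' k then moment (A - {k}) e e' else 0)"
            "if e k = e' k then moment (A - {k}) e e' else 0"] by simp
      also have "\<dots> \<le> (\<Sum>a\<in>A - {k}. cmod (moment A (e(a := e k, k := e a)) e')
         + cmod (moment A (e(k := bar (e' a))) (e'(a := bar (e k))))) + mbound (card (A - {k}))"
        using less.prems k le IH diag by (intro add_mono moment_recursion) auto
      also have "\<dots> \<le> (\<Sum>a\<in>A - {k}. 2 * Z) + mbound (card (A - {k}))"
        using k by (intro add_mono sum_mono sw) auto
      finally have "(real d - 2 * real (card (A - {k}))) * Z \<le> mbound (card (A - {k}))"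
        by (simp add: algebra_simps)
      moreover have "real d - 2 * real (card (A - {k})) > 0" using cA card_le T_le by simp
      ultimately have "Z \<le> mbound (card (A - {k})) / (real d - 2 * real (card (A - {k})))"
        by (simp add: pos_le_divide_eq mult.commute)
      then show ?thesis unfolding cA by (simp add: mbound_def)
    qed
  next
    case False
    then obtain k where k: "k \<in> A" "e k \<noteq> e' k" by auto
    have "\<theta>\<^sup>2 * (real d * (Z * \<theta> ^ r e e'))
      = \<theta>\<^sup>2 * cmod (of_nat d * moment A e e' - (if e k = e' k then moment (A - {k}) e e' else 0))"
      using k eZ by (simp add: norm_mult)
    also have "\<dots> \<le> \<theta>\<^sup>2 * (\<Sum>a\<in>A - {k}. cmod (moment A (e(a := e k, k := e a)) e')
         + cmod (moment A (e(k := bar (e' a))) (e'(a := bar (e k)))))"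
      using less.prems k le by (intro mult_left_mono moment_recursion) auto
    also have "\<dots> \<le> (\<Sum>a\<in>A - {k}. 2 * (Z * \<theta> ^ r e e'))"
      unfolding sum_distrib_left using k by (intro sum_mono sw) auto
    also have "\<dots> = (2 * real (card A) - 2) * (Z * \<theta> ^ r e e')"
      using card.remove[OF fA k(1)] by (simp add: algebra_simps)
    \<comment> \<open>Here \<theta>^2 d = 2 T is what makes the coefficient positive, as 2 card A -
      2 is smaller than 2 T. A maximizer with a mismatch thus has Z \<le> 0.\<close>
    finally have "(\<theta>\<^sup>2 * real d - 2 * real (card A) + 2) * (Z * \<theta> ^ r e e') \<le> 0"
      by (simp add: algebra_simps)
    moreover have "\<theta>\<^sup>2 * real d - 2 * real (card A) + 2 > 0" using card_le less.prems by simp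
    ultimately have "Z * \<theta> ^ r e e' \<le> 0" by (simp add: mult_le_0_iff)
    then have "Z \<le> 0"
      using zero_less_power[OF less.prems(5), of "r e e'"] by (simp add: mult_le_0_iff)
    also have "0 \<le> mbound (card A)" using less.prems by (intro mbound_nonneg) auto
    finally show ?thesis .
  qed
  have "cmod (moment A c c') = cmod (moment A (restrict c A) (restrict c' A))"
    using moment_cong[of A c "restrict c A" c' "restrict c' A"] by simp
  also have "\<dots> \<le> Z * \<theta> ^ r (restrict c A) (restrict c' A)" by (rule Z[OF cS])
  also have "\<dots> \<le> mbound (card A) * \<theta> ^ r (restrict c A) (restrict c' A)"
    using Zle less.prems by (intro mult_right_mono) auto
  also have "r (restrict c A) (restrict c' A) = card {a \<in> A. c a \<noteq> c' a}"
    unfolding r_def by (intro arg_cong[of _ _ card]) auto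
  finally show ?case .
qed

text \<open>The quantity is the product of the factors 1 / (1 - 2 i / d) over i below j, of size
  about 1 + j^2 / d. Multiplied by 1 - j^2 / d it stays below 1, a form that passes from j to j + 1;
  then j^2 \<le> d / 2 gives the bound 2.\<close>

lemma mbound_le:
  assumes "2 * j\<^sup>2 \<le> d" "d > 0"
  shows "real d ^ j * mbound j \<le> 2"
proof -
  have *: "(1 - real j ^ 2 / d) * (real d ^ j * mbound j) \<le> 1" if "2 * j \<le> d" for j
    using that
  proof (induction j)
    case (Suc j)
    have pos: "real d - 2 * real j > 0" using Suc.prems by simp
    have nn: "real d ^ j * mbound j \<ge> 0" using Suc.prems by (intro mult_nonneg_nonneg mbound_nonneg) auto
    have "(1 - real (Suc j) ^ 2 / d) * (d / (d - 2 * real j)) \<le> 1 - real j ^ 2 / d"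
    proof -
      have "(1 - real (Suc j) ^ 2 / d) * d \<le> (1 - real j ^ 2 / d) * (d - 2 * real j)"
        using assms(2) by (simp add: field_simps power2_eq_square)
      then show ?thesis using pos by (simp add: pos_divide_le_eq)
    qed
    from mult_right_mono[OF this nn]
    have "(1 - real (Suc j) ^ 2 / d) * (real d ^ Suc j * mbound (Suc j)) \<le> (1 - real j ^ 2 / d) * (real d ^ j * mbound j)"
      by (simp add: mbound_def mult_ac)
    also have "\<dots> \<le> 1" using Suc by simp
    finally show ?case .
  qed (simp add: mbound_def)
  have "2 * j \<le> 2 * j\<^sup>2" by (simp add: power2_eq_square)
  then have j: "2 * j \<le> d" using assms by simp
  have "real j ^ 2 / d \<le> 1 / 2" 
  proof -
    have "real (2 * j\<^sup>2) \<le> real d" using assms(1) of_nat_le_iff by blast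
    then show ?thesis using assms(2) by (simp add: field_simps)
  qed
  then have "1 / 2 * (real d ^ j * mbound j) \<le> (1 - real j ^ 2 / d) * (real d ^ j * mbound j)"
    using j by (intro mult_right_mono mult_nonneg_nonneg mbound_nonneg) auto
  with *[OF j] show ?thesis by linarith
qed

text \<open>The 2 j error terms in the recursion for j + 1 rows are each at most
  \<open>mbound (Suc j)\<close>, hence at most 2 / d^(j + 1). After normalization a step loses at
  most 4 j / d, and 2 j^2 + 4 j \<le> 2 (j + 1)^2.\<close>

lemma moment_diagonal_ge:
  assumes "A \<subseteq> {..<d}" "inj_on cls A" "card A \<le> T" "T > 0" "2 * T\<^sup>2 \<le> d"
    and "\<And>a. a \<in> A \<Longrightarrow> c a < d"
  shows "real d ^ card A * Re (moment A c c) \<ge> 1 - 2 * real (card A) ^ 2 / d"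
  using assms
proof (induction "card A" arbitrary: A)
  case 0
  then have "A = {}" using finite_subset by fastforce
  then show ?case by simp
next
  case (Suc j)
  have fA: "finite A" using Suc.prems(1) finite_subset by blast
  obtain k where k: "k \<in> A" using Suc(2) by fastforce
  have cj: "card (A - {k}) = j" using card.remove[OF fA k] Suc(2) by simp
  have d: "d > 0" "2 * T \<le> d"
  proof -
    have "2 * T \<le> 2 * T\<^sup>2" by (simp add: power2_eq_square)
    then show "2 * T \<le> d" "d > 0" using Suc.prems by auto
  qed
  have "2 * (card A)\<^sup>2 \<le> 2 * T\<^sup>2" using Suc.prems by (intro mult_left_mono power_mono) auto
  then have K: "real d ^ card A * mbound (card A) \<le> 2"
    using Suc.prems(5) d by (intro mbound_le) linarith+
  \<comment> \<open>\<open>moment_decay\<close> is used here for its prefactor only; the power of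
    \<theta> is bounded by 1.\<close>
  define \<theta> where "\<theta> = sqrt (2 * T / d)"
  have "real (2 * T) \<le> real d" using d(2) of_nat_le_iff by blast
  then have th: "0 < \<theta>" "\<theta> \<le> 1" "\<theta>\<^sup>2 * d = 2 * real T" using Suc.prems(4) d(1)
    by (simp_all add: \<theta>_def)
  have nonneg: "mbound (card A) \<ge> 0" using Suc.prems d by (intro mbound_nonneg) auto
  have b: "cmod (moment A e e') \<le> mbound (card A)"
    if "\<And>a. a \<in> A \<Longrightarrow> e a < d" "\<And>a. a \<in> A \<Longrightarrow> e' a < d" for e e'
  proof -
    have "cmod (moment A e e') \<le> mbound (card A) * \<theta> ^ card {a \<in> A. e a \<noteq> e' a}"
      using Suc.prems d th that by (intro moment_decay) auto
    also have "\<dots> \<le> mbound (card A) * 1"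
      using th nonneg by (intro mult_left_mono power_le_one) auto
    finally show ?thesis by simp
  qed
  have IH: "real d ^ j * Re (moment (A - {k}) c c) \<ge> 1 - 2 * real j ^ 2 / d"
    using Suc.hyps(1)[of "A - {k}"] cj Suc.prems Suc(2) by (auto intro: inj_on_subset)
  have "cmod (of_nat d * moment A c c - moment (A - {k}) c c) \<le>
      (\<Sum>a\<in>A - {k}. cmod (moment A (c(a := c k, k := c a)) c)
         + cmod (moment A (c(k := bar (c a))) (c(a := bar (c k)))))"
    using moment_recursion[of A k c c] Suc.prems k by simp
  also have "\<dots> \<le> (\<Sum>a\<in>A - {k}. mbound (card A) + mbound (card A))"
    using Suc.prems k by (intro sum_mono add_mono b) auto
  finally have "cmod (of_nat d * moment A c c - moment (A - {k}) c c) \<le> 2 * j * mbound (card A)"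
    by (simp add: cj)
  moreover have "Re (moment (A - {k}) c c - of_nat d * moment A c c) \<le> cmod (moment (A - {k}) c c - of_nat d * moment A c c)"
    by (rule complex_Re_le_cmod)
  ultimately have "real d * Re (moment A c c) \<ge> Re (moment (A - {k}) c c) - 2 * j * mbound (card A)"
    by (simp add: norm_minus_commute)
  then have "real d ^ j * (real d * Re (moment A c c)) \<ge> real d ^ j * (Re (moment (A - {k}) c c) - 2 * j * mbound (card A))"
    by (intro mult_left_mono) auto
  then have "real d ^ card A * Re (moment A c c) \<ge> real d ^ j * Re (moment (A - {k}) c c) - 2 * j * (real d ^ j * mbound (card A))"
    by (simp add: Suc(2)[symmetric] algebra_simps)
  moreover have "real d ^ j * mbound (card A) \<le> 2 / d"
    using K d by (simp add: Suc(2)[symmetric] field_simps)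
  then have "2 * j * (real d ^ j * mbound (card A)) \<le> 2 * j * (2 / d)"
    by (intro mult_left_mono) auto
  ultimately have "real d ^ card A * Re (moment A c c) \<ge> 1 - 2 * real j ^ 2 / d - 4 * j / d"
    using IH by simp
  also have "1 - 2 * real j ^ 2 / d - 4 * j / d \<ge> 1 - 2 * real (card A) ^ 2 / d"
    using d by (simp add: Suc(2)[symmetric] field_simps power2_eq_square)
  finally show ?case .
qed

section \<open>Gram matrix of the monomials\<close>

definition monomial :: "(nat \<times> nat) set \<Rightarrow> complex mat \<Rightarrow> complex" where
  "monomial m U = (\<Prod>e\<in>m. U $$ e)"

text \<open>Positions in order and with possible repetitions, as they occur when a product of linear
  forms is expanded.\<close>

definition listmono :: "(nat \<times> nat) list \<Rightarrow> complex mat \<Rightarrow> complex" where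
  "listmono es U = (\<Prod>t<length es. U $$ (es ! t))"

text \<open>A set of positions in distinct rows is the graph of a function from rows to columns,
  which is the format that \<open>moment\<close> expects.\<close>

definition col_of :: "(nat \<times> nat) set \<Rightarrow> nat \<Rightarrow> nat" where
  "col_of m a = (SOME b. (a, b) \<in> m)"

lemma col_of_eq:
  assumes "inj_on fst m" "(a, b) \<in> m" shows "col_of m a = b"
  unfolding col_of_def
proof (rule some_equality)
  fix c assume "(a, c) \<in> m"
  from inj_onD[OF assms(1) _ this assms(2)] show "c = b" by simp
qed (rule assms(2))

lemma graph_col_of:
  assumes "inj_on fst m" shows "m = (\<lambda>a. (a, col_of m a)) ` fst ` m"
proof -
  have "e = (fst e, col_of m (fst e))" if "e \<in> m" for e
    using col_of_eq[OF assms, of "fst e" "snd e"] that by (cases e) auto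
  then show ?thesis unfolding image_image by force
qed

lemma monomial_graph: "inj_on fst m \<Longrightarrow> monomial m U = (\<Prod>a\<in>fst ` m. U $$ (a, col_of m a))"
  unfolding monomial_def
proof (subst prod.reindex)
  assume inj: "inj_on fst m"
  show "(\<Prod>e\<in>m. U $$ e) = prod ((\<lambda>a. U $$ (a, col_of m a)) \<circ> fst) m"
    using col_of_eq[OF inj] by (intro prod.cong) auto
qed

lemma listmono_distinct: "distinct es \<Longrightarrow> listmono es U = monomial (set es) U"
proof -
  assume d: "distinct es"
  have "bij_betw ((!) es) {..<length es} (set es)" using d by (intro bij_betw_nth) auto
  then show ?thesis unfolding listmono_def monomial_def
    by (rule prod.reindex_bij_betw[where g = "\<lambda>e. U $$ e"])
qed

lemma matching_inj:
  assumes "m \<in> matchings k"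
  shows "inj_on fst m" "inj_on snd m" "inj_on cls (fst ` m)" "inj_on cls (snd ` m)"
    "inj_on (cls \<circ> fst) m" "inj_on (cls \<circ> snd) m"
proof -
  have c: "cls (fst e) \<noteq> cls (fst e') \<and> cls (snd e) \<noteq> cls (snd e')" if "e \<in> m" "e' \<in> m" "e \<noteq> e'" for e e'
    using assms that by (auto simp: matchings_def conflict_def)
  show "inj_on (cls \<circ> fst) m" "inj_on (cls \<circ> snd) m" by (auto intro!: inj_onI dest: c)
  show "inj_on fst m" by (rule inj_onI) (metis c)
  show "inj_on snd m" by (rule inj_onI) (metis c)
  show "inj_on cls (fst ` m)" by (rule inj_onI) (auto, metis c fst_conv)
  show "inj_on cls (snd ` m)" by (rule inj_onI) (auto, metis c snd_conv)
qed

lemma bm_listmono: "set es \<subseteq> edges \<Longrightarrow> bm (listmono es)"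
  unfolding listmono_def[abs_def]
proof (rule bm_prod)
  fix t assume "set es \<subseteq> edges" "t \<in> {..<length es}"
  then have "es ! t \<in> edges" using nth_mem by blast
  then show "bm (\<lambda>U. U $$ (es ! t))" using bm_entry by (cases "es ! t") (auto simp: edges_def)
qed

lemma bm_monomial: "m \<subseteq> edges \<Longrightarrow> bm (monomial m)"
  unfolding monomial_def[abs_def]
proof (rule bm_prod)
  fix e assume "m \<subseteq> edges" "e \<in> m"
  then show "bm (\<lambda>U. U $$ e)" using bm_entry by (cases e) (auto simp: edges_def)
qed

lemma eq_of_unit_products: "x * cnj y = 1 \<Longrightarrow> y * cnj y = 1 \<Longrightarrow> y = (x :: complex)"
  by (metis mult.left_commute mult.right_neutral)

text \<open>Left multiplication by a phase matrix of the group scales the integrand by a quotient of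
  row characters. A nonzero integral forces all these quotients to be 1, and the characters
  determine the rows of a matching.\<close>

lemma rows_of_overlap:
  assumes es: "set es \<subseteq> edges" "distinct es" "set es \<in> matchings k"
    and es': "set es' \<subseteq> edges" "length es' = k"
    and nz: "(\<integral>U. listmono es U * cnj (listmono es' U) \<partial>\<mu>) \<noteq> 0"
  shows "fst ` set es' = fst ` set es"
proof -
  have len: "length es = k" using es by (simp add: matchings_def distinct_card)
  have "es ! t \<in> edges \<and> es' ! t \<in> edges" if "t < k" for t
    using subsetD[OF es(1) nth_mem[of t es]] subsetD[OF es'(1) nth_mem[of t es']] that len es'(2) by simp
  then have lt: "fst (es ! t) < d" "snd (es ! t) < d" "fst (es' ! t) < d" "snd (es' ! t) < d" if "t < k" for t
    using that by (auto simp: edges_def mem_Times_iff)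
  have img: "(\<lambda>t. g (xs ! t)) ` {..<length xs} = g ` set xs" for g :: "nat \<times> nat \<Rightarrow> nat" and xs
    by (auto simp: set_conv_nth)
  have "(\<lambda>t. fst (es' ! t)) ` {..<k} = (\<lambda>t. fst (es ! t)) ` {..<k}"
  proof (rule characters_determine_image)
    show "inj_on (cls \<circ> (\<lambda>t. fst (es ! t))) {..<k}"
    proof (rule inj_onI)
      fix s t assume st: "s \<in> {..<k}" "t \<in> {..<k}" "(cls \<circ> (\<lambda>t. fst (es ! t))) s = (cls \<circ> (\<lambda>t. fst (es ! t))) t"
      then have "es ! s = es ! t"
        using inj_onD[OF matching_inj(5)[OF es(3)], of "es ! s" "es ! t"] len by simp
      then show "s = t" using st len es(2) by (simp add: nth_eq_iff_index_eq)
    qed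
    fix b assume b: "b < d"
    let ?g = "mat d d (\<lambda>(i, j). if i = j then chi bar b i else 0)"
    let ?X = "\<Prod>t<k. chi bar b (fst (es ! t))" and ?Y = "\<Prod>t<k. chi bar b (fst (es' ! t))"
    have m: "listmono xs (?g * U) = (\<Prod>t<k. chi bar b (fst (xs ! t))) * listmono xs U"
      if "U \<in> carrier_mat d d" "length xs = k" "\<And>t. t < k \<Longrightarrow> fst (xs ! t) < d \<and> snd (xs ! t) < d" for xs U
    proof -
      have "listmono xs (?g * U) = (\<Prod>t<k. chi bar b (fst (xs ! t)) * U $$ (xs ! t))"
        unfolding listmono_def that(2)
      proof (intro prod.cong refl)
        fix t assume "t \<in> {..<k}"
        then show "(?g * U) $$ (xs ! t) = chi bar b (fst (xs ! t)) * U $$ (xs ! t)"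
          using diag_mult_index[OF that(1), of "fst (xs ! t)" "snd (xs ! t)" "chi bar b"] that(3)[of t] by simp
      qed
      then show ?thesis by (simp add: prod.distrib listmono_def that(2))
    qed
    have "?X * cnj ?Y = 1"
    proof (rule ccontr)
      assume "?X * cnj ?Y \<noteq> 1"
      then have "(\<integral>U. listmono es U * cnj (listmono es' U) \<partial>\<mu>) = 0"
      proof (rule integral_zero_by_phase[OF phase_in[OF b], rotated 2])
        show "bm (\<lambda>U. listmono es U * cnj (listmono es' U))"
          by (intro bm_intros bm_listmono es(1) es'(1))
        fix U :: "complex mat" assume "U \<in> carrier_mat d d"
        then have "listmono es (?g * U) = ?X * listmono es U" "listmono es' (?g * U) = ?Y * listmono es' U"
          using m[OF _ len, of U] m[OF _ es'(2), of U] lt by blast+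
        then show "listmono es (?g * U) * cnj (listmono es' (?g * U)) = ?X * cnj ?Y * (listmono es U * cnj (listmono es' U))"
          by simp
      qed
      then show False using nz by simp
    qed
    moreover have "?Y * cnj ?Y = 1"
      unfolding cnj_prod prod.distrib[symmetric] chi_mult_cnj by simp
    ultimately show "?Y = ?X" by (rule eq_of_unit_products)
  qed (use lt in auto)
  then show ?thesis using img[of fst es] img[of fst es'] len es' by simp
qed

lemma overlap_moment:
  assumes "inj_on fst m" "inj_on fst m'" "fst ` m' = fst ` m"
  shows "(\<integral>U. monomial m U * cnj (monomial m' U) \<partial>\<mu>) = moment (fst ` m) (col_of m) (col_of m')"
  unfolding moment_def monomial_graph[OF assms(1)] monomial_graph[OF assms(2)] assms(3)
  by (simp add: prod.distrib)

text \<open>Left phases identify the rows. As there are as many distinct rows as entries,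
  \<open>es'\<close> has no repetition and the integral is a \<open>moment\<close>, whose vanishing
  criterion identifies the columns. Using the rows and columns of a matching once each makes
  \<open>set es'\<close> a matching too.\<close>

lemma overlap_nonzero:
  assumes es: "set es \<subseteq> edges" "distinct es" "set es \<in> matchings k" and k: "2 * k \<le> d"
    and es': "set es' \<subseteq> edges" "length es' = k"
    and nz: "(\<integral>U. listmono es U * cnj (listmono es' U) \<partial>\<mu>) \<noteq> 0"
  shows "distinct es' \<and> set es' \<in> matchings k \<and> fst ` set es' = fst ` set es \<and> snd ` set es' = snd ` set es"
proof -
  let ?A = "fst ` set es"
  have inj: "inj_on fst (set es)" using matching_inj[OF es(3)] by blast
  have rows: "fst ` set es' = ?A" using rows_of_overlap[OF es es' nz] .
  have "card ?A = k" using card_image[OF inj] es(3) by (simp add: matchings_def)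
  then have "card (fst ` set es') = length es'" using rows es' by simp
  then have cards: "card (set es') = length es'" "card (fst ` set es') = card (set es')"
    using card_image_le[of "set es'" fst] card_length[of es'] by auto
  have d': "distinct es'" using cards(1) by (rule card_distinct)
  have inj': "inj_on fst (set es')" using cards(2) by (intro eq_card_imp_inj_on) auto
  have fA: "finite ?A" by simp
  have Ad: "?A \<subseteq> {..<d}" using es(1) by (auto simp: edges_def)
  have c: "col_of (set es) a < d" if "a \<in> ?A" for a
    using that graph_col_of[OF inj] es(1) by (force simp: edges_def)
  have c': "col_of (set es') a < d" if "a \<in> ?A" for a
    using that graph_col_of[OF inj'] es'(1) unfolding rows by (force simp: edges_def)
  have nz': "moment ?A (col_of (set es)) (col_of (set es')) \<noteq> 0"
    using nz overlap_moment[OF inj inj' rows] by (simp add: listmono_distinct d' es(2))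
  have snd_eq: "snd ` m = col_of m ` fst ` m" if "inj_on fst m" for m
    using arg_cong[OF graph_col_of[OF that], of "(`) snd"] by (simp add: image_image)
  have "col_of (set es') ` ?A = col_of (set es) ` ?A"
  proof (rule characters_determine_image[OF fA c c'])
    show "inj_on (cls \<circ> col_of (set es)) ?A"
    proof (rule inj_onI)
      fix x y assume xy: "x \<in> ?A" "y \<in> ?A" "(cls \<circ> col_of (set es)) x = (cls \<circ> col_of (set es)) y"
      then have "(x, col_of (set es) x) \<in> set es" "(y, col_of (set es) y) \<in> set es"
        using graph_col_of[OF inj] by blast+
      then show "x = y"
        using inj_onD[OF matching_inj(6)[OF es(3)], of "(x, col_of (set es) x)" "(y, col_of (set es) y)"] xy(3)
        by simp
    qed
    fix b assume "b < d"
    then show "(\<Prod>t\<in>?A. chi bar b (col_of (set es') t)) = (\<Prod>t\<in>?A. chi bar b (col_of (set es) t))"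
      using moment_eq_0_of_characters[OF Ad matching_inj(3)[OF es(3)] _ _ c c', of b] nz' \<open>card ?A = k\<close> k by fastforce
  qed
  then have cols: "snd ` set es' = snd ` set es"
    using snd_eq[OF inj] snd_eq[OF inj'] rows by simp
  have "card (snd ` set es') = card (set es')"
    using cols card_image[OF matching_inj(2)[OF es(3)]] es(3) d' es'(2) by (simp add: matchings_def distinct_card)
  then have injs: "inj_on snd (set es')" by (auto intro: eq_card_imp_inj_on)
  have "\<not> conflict e e'" if "e \<in> set es'" "e' \<in> set es'" "e \<noteq> e'" for e e'
  proof -
    have "fst e \<noteq> fst e'" "snd e \<noteq> snd e'" using that inj' injs by (auto dest: inj_onD)
    moreover have "fst e \<in> ?A" "fst e' \<in> ?A" "snd e \<in> snd ` set es" "snd e' \<in> snd ` set es"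
      using that rows cols by blast+
    ultimately show ?thesis
      using matching_inj(3,4)[OF es(3)] by (auto simp: conflict_def dest: inj_onD)
  qed
  then have "set es' \<in> matchings k" using es' d' by (auto simp: matchings_def distinct_card)
  then show ?thesis using d' rows cols by blast
qed

lemma overlap_diagonal:
  assumes m: "m \<in> matchings T" and T: "T > 0" "2 * T\<^sup>2 \<le> d"
  shows "Re (\<integral>U. monomial m U * cnj (monomial m U) \<partial>\<mu>) \<ge> (1 - 2 * real T ^ 2 / d) / real d ^ T"
proof -
  have inj: "inj_on fst m" using matching_inj[OF m] by blast
  have cA: "card (fst ` m) = T" using card_image[OF inj] m by (simp add: matchings_def)
  have d: "d > 0" using T by (cases d) auto
  have sub: "m \<subseteq> edges" using m by (simp add: matchings_def)
  have "real d ^ card (fst ` m) * Re (moment (fst ` m) (col_of m) (col_of m)) \<ge> 1 - 2 * real (card (fst ` m)) ^ 2 / d"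
  proof (rule moment_diagonal_ge[OF _ matching_inj(3)[OF m] _ T])
    show "fst ` m \<subseteq> {..<d}" using sub by (auto simp: edges_def)
    show "col_of m a < d" if "a \<in> fst ` m" for a
      using that graph_col_of[OF inj] sub by (force simp: edges_def)
  qed (simp add: cA)
  then show ?thesis using d unfolding overlap_moment[OF inj inj refl] cA
    by (simp add: field_simps)
qed

text \<open>A nonzero overlap means equal rows and equal columns, so m' arises from m by permuting
  the columns with some \<rho> \<noteq> id, and the moment decays like \<theta> to the number of
  moved rows. The constant 4 is 2 from the sum over permutations times 2 from
  \<open>mbound_le\<close>.\<close>

lemma overlap_off_diagonal:
  fixes \<theta> :: real
  assumes m: "m \<in> matchings T" and T: "T > 0" "2 * T\<^sup>2 \<le> d"
    and \<theta>: "0 < \<theta>" "\<theta> \<le> 1" "\<theta>\<^sup>2 * d = 2 * real T" "T * \<theta> \<le> 1 / 2"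
  shows "(\<Sum>m'\<in>matchings T - {m}. cmod (\<integral>U. monomial m U * cnj (monomial m' U) \<partial>\<mu>)) \<le> 4 * T * \<theta> / real d ^ T"
proof -
  let ?A = "fst ` m" and ?c = "col_of m"
  let ?w = "\<lambda>m'. cmod (\<integral>U. monomial m U * cnj (monomial m' U) \<partial>\<mu>)"
  have T2: "2 * T \<le> d"
  proof -
    have "2 * T \<le> 2 * T\<^sup>2" by (simp add: power2_eq_square)
    then show ?thesis using T by linarith
  qed
  have d: "d > 0" using T by (cases d) auto
  have inj: "inj_on fst m" using matching_inj[OF m] by blast
  have cA: "card ?A = T" using card_image[OF inj] m by (simp add: matchings_def)
  have sub: "m \<subseteq> edges" and fm: "finite m" using m finite_matching[OF m] by (auto simp: matchings_def)
  have fA: "finite ?A" using fm by simp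
  have Ad: "?A \<subseteq> {..<d}" using sub by (auto simp: edges_def)
  have gr: "(a, ?c a) \<in> m" if "a \<in> ?A" for a using that graph_col_of[OF inj] by blast
  have cd: "?c a < d" if "a \<in> ?A" for a using gr[OF that] sub by (auto simp: edges_def)
  have injc: "inj_on ?c ?A"
  proof (rule inj_onI)
    fix x y assume "x \<in> ?A" "y \<in> ?A" "?c x = ?c y"
    then show "x = y" using gr[of x] gr[of y] inj_onD[OF matching_inj(2)[OF m]] by fastforce
  qed
  have K: "real d ^ T * mbound T \<le> 2" using T d by (intro mbound_le) auto
  have "(\<Sum>m'\<in>matchings T - {m}. ?w m') = (\<Sum>m'\<in>{m' \<in> matchings T - {m}. ?w m' \<noteq> 0}. ?w m')"
    by (rule sum.mono_neutral_right) auto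
  also have "\<dots> \<le> (\<Sum>\<rho>\<in>{\<rho>. \<rho> permutes ?A} - {id}. mbound T * \<theta> ^ card {a \<in> ?A. \<rho> a \<noteq> a})"
  proof (rule sum_le_included[where i = "\<lambda>\<rho>. (\<lambda>a. (a, ?c (\<rho> a))) ` ?A"])
    show "finite ({\<rho>. \<rho> permutes ?A} - {id})" using fA by (simp add: finite_permutations)
    show "\<forall>\<rho>\<in>{\<rho>. \<rho> permutes ?A} - {id}. 0 \<le> mbound T * \<theta> ^ card {a \<in> ?A. \<rho> a \<noteq> a}"
      using T2 \<theta> by (auto intro!: mult_nonneg_nonneg mbound_nonneg)
    show "\<forall>m'\<in>{m' \<in> matchings T - {m}. ?w m' \<noteq> 0}. \<exists>\<rho>\<in>{\<rho>. \<rho> permutes ?A} - {id}.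
       (\<lambda>a. (a, ?c (\<rho> a))) ` ?A = m' \<and> ?w m' \<le> mbound T * \<theta> ^ card {a \<in> ?A. \<rho> a \<noteq> a}"
    proof
      fix m' assume "m' \<in> {m' \<in> matchings T - {m}. ?w m' \<noteq> 0}"
      then have m': "m' \<in> matchings T" "m' \<noteq> m" "?w m' \<noteq> 0" by auto
      obtain es es' where l: "set es = m" "distinct es" "set es' = m'" "distinct es'"
        using finite_distinct_list[OF fm] finite_distinct_list[OF finite_matching[OF m'(1)]] by blast
      have "fst ` set es' = fst ` set es \<and> snd ` set es' = snd ` set es"
      proof -
        have "m \<subseteq> edges" "m' \<subseteq> edges" "card m' = T" using m m'(1) by (auto simp: matchings_def)
        moreover have "length es' = T" using \<open>card m' = T\<close> l distinct_card by metis
        moreover have "(\<integral>U. listmono es U * cnj (listmono es' U) \<partial>\<mu>) \<noteq> 0"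
          using m'(3) by (simp add: listmono_distinct l)
        ultimately show ?thesis using overlap_nonzero[of es T es'] l m T2 by simp
      qed
      then have rows: "fst ` m' = ?A" and cols: "snd ` m' = snd ` m" using l by auto
      have inj': "inj_on fst m'" using matching_inj[OF m'(1)] by blast
      let ?c' = "col_of m'"
      have gr': "(a, ?c' a) \<in> m'" if "a \<in> ?A" for a using that graph_col_of[OF inj'] rows by blast
      have injc': "inj_on ?c' ?A"
      proof (rule inj_onI)
        fix x y assume "x \<in> ?A" "y \<in> ?A" "?c' x = ?c' y"
        then show "x = y" using gr'[of x] gr'[of y] inj_onD[OF matching_inj(2)[OF m'(1)]] by fastforce
      qed
      have im: "?c ` ?A = snd ` m" "?c' ` ?A = snd ` m'"
        using arg_cong[OF graph_col_of[OF inj], of "(`) snd"] arg_cong[OF graph_col_of[OF inj'], of "(`) snd"] rows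
        by (simp_all add: image_image)
      define \<rho> where "\<rho> a = (if a \<in> ?A then inv_into ?A ?c (?c' a) else a)" for a
      have c\<rho>: "\<rho> a \<in> ?A" "?c (\<rho> a) = ?c' a" if "a \<in> ?A" for a
      proof -
        have "?c' a \<in> ?c ` ?A" using that im cols by blast
        then show "\<rho> a \<in> ?A" "?c (\<rho> a) = ?c' a"
          using that unfolding \<rho>_def by (simp_all only: if_True inv_into_into f_inv_into_f)
      qed
      have "inj_on \<rho> ?A" by (rule inj_onI) (metis c\<rho>(2) inj_onD[OF injc'])
      moreover have "\<rho> ` ?A \<subseteq> ?A" using c\<rho> by blast
      ultimately have "bij_betw \<rho> ?A ?A" using fA by (simp add: bij_betw_def endo_inj_surj)
      then have perm: "\<rho> permutes ?A" by (rule bij_imp_permutes) (simp add: \<rho>_def)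
      have img: "(\<lambda>a. (a, ?c (\<rho> a))) ` ?A = m'"
        using graph_col_of[OF inj'] c\<rho>(2) rows by (metis (mono_tags, lifting) image_cong)
      have "\<rho> \<noteq> id"
      proof
        assume "\<rho> = id"
        then have "m' = (\<lambda>a. (a, ?c a)) ` ?A" using img by simp
        also have "\<dots> = m" using graph_col_of[OF inj] by simp
        finally show False using m'(2) by simp
      qed
      moreover have "?w m' \<le> mbound T * \<theta> ^ card {a \<in> ?A. \<rho> a \<noteq> a}"
      proof -
        have "?w m' = cmod (moment ?A ?c ?c')" using overlap_moment[OF inj inj' rows] by simp
        also have "\<dots> \<le> mbound (card ?A) * \<theta> ^ card {a \<in> ?A. ?c a \<noteq> ?c' a}"
        proof (rule moment_decay[OF Ad matching_inj(3)[OF m] _ T2 \<theta>(1-3) cd])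
          show "?c' a < d" if "a \<in> ?A" for a using gr'[OF that] m'(1) by (auto simp: matchings_def edges_def)
        qed (simp_all add: cA)
        also have "{a \<in> ?A. ?c a \<noteq> ?c' a} = {a \<in> ?A. \<rho> a \<noteq> a}"
          using c\<rho> inj_onD[OF injc] by (metis (no_types, lifting))
        finally show ?thesis by (simp add: cA)
      qed
      ultimately show "\<exists>\<rho>\<in>{\<rho>. \<rho> permutes ?A} - {id}.
         (\<lambda>a. (a, ?c (\<rho> a))) ` ?A = m' \<and> ?w m' \<le> mbound T * \<theta> ^ card {a \<in> ?A. \<rho> a \<noteq> a}"
        using perm img by blast
    qed
  qed auto
  also have "\<dots> \<le> mbound T * (2 * T * \<theta>)"
    unfolding sum_distrib_left[symmetric] using fA \<theta> T2 sum_permutes_moved_le[of ?A \<theta>]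
    by (intro mult_left_mono mbound_nonneg) (auto simp: cA)
  also have "\<dots> \<le> 2 / real d ^ T * (2 * T * \<theta>)"
    using K d \<theta> by (intro mult_right_mono) (auto simp: field_simps)
  finally show ?thesis by simp
qed

section \<open>Expansion of a product of linear forms\<close>

definition elists :: "nat \<Rightarrow> (nat \<times> nat) list set" where
  "elists k = {es. set es \<subseteq> edges \<and> length es = k}"

definition glists :: "nat \<Rightarrow> (nat \<times> nat) list set" where
  "glists k = {es. length es = k \<and> distinct es \<and> set es \<in> matchings k}"

definition weight :: "(nat \<Rightarrow> nat \<times> nat \<Rightarrow> complex) \<Rightarrow> (nat \<times> nat) list \<Rightarrow> complex" where
  "weight N es = (\<Prod>t<length es. N t (es ! t))"

text \<open>For a set \<open>m\<close> of \<open>k\<close> edges, the coefficient of its monomial in \<open>(\<Prod>t<k. \<Sum>e. N t e * U $$ e)\<close>, summed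
  over the orderings of \<open>m\<close>.\<close>

primrec qcoef :: "(nat \<Rightarrow> nat \<times> nat \<Rightarrow> complex) \<Rightarrow> nat \<Rightarrow> (nat \<times> nat) set \<Rightarrow> complex" where
  "qcoef N 0 m = 1"
| "qcoef N (Suc k) m = (\<Sum>e\<in>m. N k e * qcoef N k (m - {e}))"

lemma finite_elists [simp]: "finite (elists k)"
  unfolding elists_def by (rule finite_lists_length_eq) simp

lemma glists_subset: "glists k \<subseteq> elists k"
  by (auto simp: glists_def elists_def matchings_def)

lemma finite_glists [simp]: "finite (glists k)"
  using finite_subset[OF glists_subset] by simp

lemma snoc_in_glists: "es @ [e] \<in> glists (Suc k) \<longleftrightarrow> es \<in> glists k \<and> e \<in> free_edges (set es)"
proof
  assume h: "es @ [e] \<in> glists (Suc k)"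
  then have m: "insert e (set es) \<in> matchings (Suc k)" "distinct es" "e \<notin> set es" "length es = k"
    by (auto simp: glists_def)
  have c: "\<not> conflict x y" if "x \<in> insert e (set es)" "y \<in> insert e (set es)" "x \<noteq> y" for x y
    using m(1) that by (auto simp: matchings_def)
  have "card (set es) = k" using m distinct_card by blast
  then have "set es \<in> matchings k" using m(1) c by (auto simp: matchings_def)
  moreover have "e \<in> edges" "\<not> conflict e e'" if "e' \<in> set es" for e'
    using m(1,3) c[of e e'] that by (auto simp: matchings_def)
  then have "e \<in> free_edges (set es)" using m(1) by (auto simp: free_edges_def matchings_def)
  ultimately show "es \<in> glists k \<and> e \<in> free_edges (set es)" using m by (simp add: glists_def)
next
  assume h: "es \<in> glists k \<and> e \<in> free_edges (set es)"
  then have m: "set es \<in> matchings k" "distinct es" "length es = k" "e \<in> edges" "\<forall>e'\<in>set es. \<not> conflict e e'"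
    by (auto simp: glists_def free_edges_def)
  then have en: "e \<notin> set es" by auto
  have "card (insert e (set es)) = Suc k" using en m distinct_card by fastforce
  moreover have "\<not> conflict x y" if "x \<in> insert e (set es)" "y \<in> insert e (set es)" "x \<noteq> y" for x y
    using m(1,5) that conflict_sym[of x y] by (auto simp: matchings_def)
  ultimately have "insert e (set es) \<in> matchings (Suc k)" using m by (auto simp: matchings_def)
  then show "es @ [e] \<in> glists (Suc k)" using m en by (simp add: glists_def)
qed

lemma sum_glists_Suc:
  fixes F :: "(nat \<times> nat) list \<Rightarrow> 'b::comm_monoid_add"
  shows "(\<Sum>es\<in>glists (Suc k). F es) = (\<Sum>es\<in>glists k. \<Sum>e\<in>free_edges (set es). F (es @ [e]))"
proof -
  have "(\<Sum>es\<in>glists k. \<Sum>e\<in>free_edges (set es). F (es @ [e]))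
    = (\<Sum>(es, e)\<in>Sigma (glists k) (\<lambda>es. free_edges (set es)). F (es @ [e]))"
    by (subst sum.Sigma) auto
  also have "\<dots> = (\<Sum>es\<in>glists (Suc k). F es)"
  proof (rule sum.reindex_bij_witness[of _ "\<lambda>es. (butlast es, last es)" "\<lambda>(es, e). es @ [e]"])
    fix es assume es: "es \<in> glists (Suc k)"
    then have "es \<noteq> []" by (auto simp: glists_def)
    then have eq: "butlast es @ [last es] = es" by simp
    then show "(case (butlast es, last es) of (es, e) \<Rightarrow> es @ [e]) = es" by simp
    show "(butlast es, last es) \<in> Sigma (glists k) (\<lambda>es. free_edges (set es))"
      using snoc_in_glists[of "butlast es" "last es" k] es eq by simp
  next
    fix a assume "a \<in> Sigma (glists k) (\<lambda>es. free_edges (set es))"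
    then show "(case a of (es, e) \<Rightarrow> es @ [e]) \<in> glists (Suc k)"
      using snoc_in_glists by auto
  qed auto
  finally show ?thesis by simp
qed

lemma sum_elists_Suc:
  fixes F :: "(nat \<times> nat) list \<Rightarrow> 'b::comm_monoid_add"
  shows "(\<Sum>es\<in>elists (Suc k). F es) = (\<Sum>es\<in>elists k. \<Sum>e\<in>edges. F (es @ [e]))"
proof -
  have "(\<Sum>es\<in>elists k. \<Sum>e\<in>edges. F (es @ [e])) = (\<Sum>(es, e)\<in>elists k \<times> edges. F (es @ [e]))"
    by (subst sum.Sigma) auto
  also have "\<dots> = (\<Sum>es\<in>elists (Suc k). F es)"
  proof (rule sum.reindex_bij_witness[of _ "\<lambda>es. (butlast es, last es)" "\<lambda>(es, e). es @ [e]"])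
    fix es assume es: "es \<in> elists (Suc k)"
    then have ne: "es \<noteq> []" by (auto simp: elists_def)
    then show "(case (butlast es, last es) of (es, e) \<Rightarrow> es @ [e]) = es" by simp
    show "(butlast es, last es) \<in> elists k \<times> edges"
      using es ne by (auto simp: elists_def dest: in_set_butlastD)
  qed (auto simp: elists_def)
  finally show ?thesis by simp
qed

lemma weight_snoc: "weight N (es @ [e]) = weight N es * N (length es) e"
  unfolding weight_def by (simp add: nth_append)

lemma listmono_snoc: "listmono (es @ [e]) U = listmono es U * U $$ e"
  unfolding listmono_def by (simp add: nth_append)

lemma matchings_0: "matchings 0 = {{}}"
proof -
  have "m = {}" if "m \<in> matchings 0" for m
    using that finite_matching[OF that] by (simp add: matchings_def)
  moreover have "{} \<in> matchings 0" by (simp add: matchings_def)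
  ultimately show ?thesis by blast
qed

text \<open>Ordered matchings are collected by their underlying set. The last edge ranges over the
  edges free of the earlier ones, so the induction step is the double counting of
  \<open>sum_matchings_Suc\<close>.\<close>

lemma sum_glists_weight:
  "(\<Sum>es\<in>glists k. weight N es * f (set es)) = (\<Sum>m\<in>matchings k. qcoef N k m * f m)"
proof (induction k arbitrary: f)
  case 0
  have "glists 0 = {[]}" by (auto simp: glists_def matchings_0)
  then show ?case by (simp add: weight_def matchings_0)
next
  case (Suc k)
  have "(\<Sum>es\<in>glists (Suc k). weight N es * f (set es))
    = (\<Sum>es\<in>glists k. weight N es * (\<Sum>e\<in>free_edges (set es). N k e * f (insert e (set es))))"
    unfolding sum_glists_Suc sum_distrib_left
    by (intro sum.cong refl) (auto simp: weight_snoc glists_def)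
  also have "\<dots> = (\<Sum>m\<in>matchings k. qcoef N k m * (\<Sum>e\<in>free_edges m. N k e * f (insert e m)))"
    by (rule Suc.IH)
  also have "\<dots> = (\<Sum>m\<in>matchings k. \<Sum>e\<in>free_edges m. qcoef N k m * N k e * f (insert e m))"
    by (simp add: sum_distrib_left mult.assoc)
  also have "\<dots> = (\<Sum>m\<in>matchings (Suc k). \<Sum>e\<in>m. qcoef N k (m - {e}) * N k e * f (insert e (m - {e})))"
    by (rule sum_matchings_Suc[symmetric, where f = "\<lambda>m e. qcoef N k m * N k e * f (insert e m)"])
  also have "\<dots> = (\<Sum>m\<in>matchings (Suc k). qcoef N (Suc k) m * f m)"
    unfolding qcoef.simps(2) sum_distrib_right
    by (intro sum.cong refl) (simp add: insert_absorb mult_ac)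
  finally show ?case .
qed

lemma prod_linear_expand:
  "(\<Prod>t<k. \<Sum>e\<in>edges. N t e * U $$ e) = (\<Sum>es\<in>elists k. weight N es * listmono es U)"
proof (induction k)
  case 0
  have "elists 0 = {[]}" by (auto simp: elists_def)
  then show ?case by (simp add: weight_def listmono_def)
next
  case (Suc k)
  have "(\<Sum>es\<in>elists (Suc k). weight N es * listmono es U)
    = (\<Sum>es\<in>elists k. \<Sum>e\<in>edges. (weight N es * listmono es U) * (N k e * U $$ e))"
    unfolding sum_elists_Suc
    by (intro sum.cong refl) (auto simp: weight_snoc listmono_snoc elists_def)
  also have "\<dots> = (\<Sum>es\<in>elists k. weight N es * listmono es U) * (\<Sum>e\<in>edges. N k e * U $$ e)"
    by (rule sum_product[symmetric])
  finally show ?case using Suc by simp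
qed

lemma integral_norm_square_ge_part:
  assumes f: "bm f" and g: "bm g" and orth: "(\<integral>U. f U * cnj (g U) \<partial>\<mu>) = 0"
  shows "(\<integral>U. (cmod (f U))\<^sup>2 \<partial>\<mu>) \<le> (\<integral>U. (cmod (f U + g U))\<^sup>2 \<partial>\<mu>)"
proof -
  have eq: "(cmod (f U + g U))\<^sup>2 = (cmod (f U))\<^sup>2 + (cmod (g U))\<^sup>2 + 2 * Re (f U * cnj (g U))" for U
    by (simp add: cmod_power2) (simp add: power2_eq_square algebra_simps)
  have i: "integrable \<mu> (\<lambda>U. (cmod (f U))\<^sup>2)" "integrable \<mu> (\<lambda>U. (cmod (g U))\<^sup>2)"
    "integrable \<mu> (\<lambda>U. f U * cnj (g U))"
    using bm_integrable[OF bm_norm_square[OF f]] bm_integrable[OF bm_norm_square[OF g]]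
      bm_integrable[OF bm_mult[OF f bm_cnj[OF g]]] by auto
  define r where "r U = Re (f U * cnj (g U))" for U
  have ir: "integrable \<mu> r" unfolding r_def[abs_def] by (rule integrable_Re[OF i(3)])
  have "(\<integral>U. (cmod (f U + g U))\<^sup>2 \<partial>\<mu>) = (\<integral>U. (cmod (f U))\<^sup>2 \<partial>\<mu>) + (\<integral>U. (cmod (g U))\<^sup>2 \<partial>\<mu>)
     + 2 * (\<integral>U. r U \<partial>\<mu>)"
    unfolding eq r_def[symmetric] using i ir by simp
  also have "(\<integral>U. r U \<partial>\<mu>) = 0"
    unfolding r_def integral_Re[OF i(3)] orth by simp
  finally show ?thesis by simp
qed

lemma good_part_le:
  assumes "2 * T \<le> d"
  shows "(\<integral>U. (cmod (\<Sum>m\<in>matchings T. qcoef N T m * monomial m U))\<^sup>2 \<partial>\<mu>)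
    \<le> (\<integral>U. (cmod (\<Prod>t<T. \<Sum>e\<in>edges. N t e * U $$ e))\<^sup>2 \<partial>\<mu>)"
proof -
  define f where "f U = (\<Sum>es\<in>glists T. weight N es * listmono es U)" for U
  define g where "g U = (\<Sum>es\<in>elists T - glists T. weight N es * listmono es U)" for U
  have sub: "set es \<subseteq> edges" if "es \<in> elists T" for es using that by (auto simp: elists_def)
  have bf: "bm f" "bm g" unfolding f_def[abs_def] g_def[abs_def]
    using glists_subset sub by (auto intro!: bm_intros bm_listmono)
  have "(\<integral>U. f U * cnj (g U) \<partial>\<mu>) = (\<integral>U. (\<Sum>es\<in>glists T. \<Sum>es'\<in>elists T - glists T.
       (weight N es * cnj (weight N es')) * (listmono es U * cnj (listmono es' U))) \<partial>\<mu>)"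
    unfolding f_def g_def cnj_sum sum_product by (simp add: mult_ac)
  also have "\<dots> = (\<Sum>es\<in>glists T. \<Sum>es'\<in>elists T - glists T.
       (weight N es * cnj (weight N es')) * (\<integral>U. listmono es U * cnj (listmono es' U) \<partial>\<mu>))"
    using glists_subset sub
    by (subst Bochner_Integration.integral_sum, force intro!: bm_integrable bm_intros bm_listmono)
       (intro sum.cong refl, subst Bochner_Integration.integral_sum,
        auto intro!: bm_integrable bm_intros bm_listmono)
  also have "\<dots> = 0"
  proof (intro sum.neutral ballI)
    fix es es' assume es: "es \<in> glists T" and es': "es' \<in> elists T - glists T"
    have "(\<integral>U. listmono es U * cnj (listmono es' U) \<partial>\<mu>) = 0"
    proof (rule ccontr)
      assume "\<not> ?thesis"
      then have "distinct es' \<and> set es' \<in> matchings T"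
        using overlap_nonzero[of es T es'] es es' assms glists_subset by (auto simp: glists_def elists_def)
      then show False using es' by (auto simp: glists_def elists_def)
    qed
    then show "(weight N es * cnj (weight N es')) * (\<integral>U. listmono es U * cnj (listmono es' U) \<partial>\<mu>) = 0" by simp
  qed
  finally have orth: "(\<integral>U. f U * cnj (g U) \<partial>\<mu>) = 0" .
  have fg: "(\<Prod>t<T. \<Sum>e\<in>edges. N t e * U $$ e) = f U + g U" for U
    unfolding prod_linear_expand f_def g_def
    using sum.subset_diff[OF glists_subset finite_elists, of "\<lambda>es. weight N es * listmono es U" T] by (simp add: add.commute)
  have f: "f U = (\<Sum>m\<in>matchings T. qcoef N T m * monomial m U)" for U
  proof -
    have "f U = (\<Sum>es\<in>glists T. weight N es * monomial (set es) U)"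
      unfolding f_def by (intro sum.cong) (auto simp: glists_def listmono_distinct)
    then show ?thesis by (simp add: sum_glists_weight[where f = "\<lambda>m. monomial m U"])
  qed
  show ?thesis using integral_norm_square_ge_part[OF bf orth] unfolding fg f .
qed

text \<open>In the quadratic form of the Gram matrix, 2 |q m| |q m'| is at most the sum of the two
  squares. The moduli of the Gram entries are symmetric, so each |q m|^2 is charged exactly one
  off-diagonal row sum.\<close>

lemma gershgorin_lower_bound:
  assumes diag: "\<And>m. m \<in> M \<Longrightarrow> Re (\<integral>U. monomial m U * cnj (monomial m U) \<partial>\<mu>) \<ge> a"
    and off: "\<And>m. m \<in> M \<Longrightarrow> (\<Sum>m'\<in>M - {m}. cmod (\<integral>U. monomial m U * cnj (monomial m' U) \<partial>\<mu>)) \<le> b"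
    and M: "finite M" "\<And>m. m \<in> M \<Longrightarrow> m \<subseteq> edges"
  shows "(\<integral>U. (cmod (\<Sum>m\<in>M. q m * monomial m U))\<^sup>2 \<partial>\<mu>) \<ge> (a - b) * (\<Sum>m\<in>M. (cmod (q m))\<^sup>2)"
proof -
  define w where "w m m' = (\<integral>U. monomial m U * cnj (monomial m' U) \<partial>\<mu>)" for m m'
  have wsym: "cmod (w m m') = cmod (w m' m)" for m m'
  proof -
    have "w m' m = (\<integral>U. cnj (monomial m U * cnj (monomial m' U)) \<partial>\<mu>)"
      unfolding w_def by (simp add: mult.commute)
    also have "\<dots> = cnj (w m m')" unfolding w_def by (rule Bochner_Integration.integral_cnj)
    finally have "w m' m = cnj (w m m')" .
    then show ?thesis by simp
  qed
  have "complex_of_real (\<integral>U. (cmod (\<Sum>m\<in>M. q m * monomial m U))\<^sup>2 \<partial>\<mu>)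
    = (\<integral>U. of_real ((cmod (\<Sum>m\<in>M. q m * monomial m U))\<^sup>2) \<partial>\<mu>)"
    by (simp only: integral_complex_of_real)
  also have "\<dots> = (\<integral>U. (\<Sum>m\<in>M. \<Sum>m'\<in>M. (q m * cnj (q m')) * (monomial m U * cnj (monomial m' U))) \<partial>\<mu>)"
    by (intro Bochner_Integration.integral_cong refl, simp only: complex_norm_square cnj_sum sum_product)
       (simp add: mult_ac)
  also have "\<dots> = (\<Sum>m\<in>M. \<Sum>m'\<in>M. (q m * cnj (q m')) * w m m')"
    unfolding w_def using M
    by (subst Bochner_Integration.integral_sum, force intro!: bm_integrable bm_intros bm_monomial)
       (intro sum.cong refl, subst Bochner_Integration.integral_sum,
        auto intro!: bm_integrable bm_intros bm_monomial)
  finally have "(\<integral>U. (cmod (\<Sum>m\<in>M. q m * monomial m U))\<^sup>2 \<partial>\<mu>) = Re (\<Sum>m\<in>M. \<Sum>m'\<in>M. (q m * cnj (q m')) * w m m')"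
    by (metis Re_complex_of_real)
  also have "\<dots> = (\<Sum>m\<in>M. (cmod (q m))\<^sup>2 * Re (w m m) + (\<Sum>m'\<in>M - {m}. Re ((q m * cnj (q m')) * w m m')))"
    unfolding Re_sum
  proof (intro sum.cong refl)
    fix m assume m: "m \<in> M"
    have "(q m * cnj (q m)) * w m m = of_real ((cmod (q m))\<^sup>2) * w m m" by (simp only: complex_norm_square)
    then have "Re ((q m * cnj (q m)) * w m m) = (cmod (q m))\<^sup>2 * Re (w m m)"
      by (simp only: times_complex.sel Re_complex_of_real Im_complex_of_real)
    then show "(\<Sum>m'\<in>M. Re ((q m * cnj (q m')) * w m m'))
      = (cmod (q m))\<^sup>2 * Re (w m m) + (\<Sum>m'\<in>M - {m}. Re ((q m * cnj (q m')) * w m m'))"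
      using sum.remove[OF M(1) m, of "\<lambda>m'. Re ((q m * cnj (q m')) * w m m')"] by simp
  qed
  also have "\<dots> \<ge> (\<Sum>m\<in>M. (cmod (q m))\<^sup>2 * a + (\<Sum>m'\<in>M - {m}. - (((cmod (q m))\<^sup>2 + (cmod (q m'))\<^sup>2) / 2 * cmod (w m m'))))"
  proof (intro sum_mono add_mono mult_left_mono)
    fix m m' assume "m \<in> M"
    show "a \<le> Re (w m m)" using diag[OF \<open>m \<in> M\<close>] by (simp add: w_def)
  next
    fix m m'
    have "- Re ((q m * cnj (q m')) * w m m') \<le> cmod ((q m * cnj (q m')) * w m m')"
      using abs_Re_le_cmod[of "(q m * cnj (q m')) * w m m'"] by linarith
    also have "\<dots> = cmod (q m) * cmod (q m') * cmod (w m m')" by (simp add: norm_mult)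
    also have "\<dots> \<le> ((cmod (q m))\<^sup>2 + (cmod (q m'))\<^sup>2) / 2 * cmod (w m m')"
    proof (intro mult_right_mono)
      have "0 \<le> (cmod (q m) - cmod (q m'))\<^sup>2" by simp
      then show "cmod (q m) * cmod (q m') \<le> ((cmod (q m))\<^sup>2 + (cmod (q m'))\<^sup>2) / 2"
        by (simp add: power2_diff)
    qed simp
    finally show "- (((cmod (q m))\<^sup>2 + (cmod (q m'))\<^sup>2) / 2 * cmod (w m m')) \<le> Re ((q m * cnj (q m')) * w m m')" by simp
  qed simp
  also have "(\<Sum>m\<in>M. (cmod (q m))\<^sup>2 * a + (\<Sum>m'\<in>M - {m}. - (((cmod (q m))\<^sup>2 + (cmod (q m'))\<^sup>2) / 2 * cmod (w m m'))))
    = (\<Sum>m\<in>M. (cmod (q m))\<^sup>2 * a) - (\<Sum>m\<in>M. (cmod (q m))\<^sup>2 * (\<Sum>m'\<in>M - {m}. cmod (w m m')))"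
  proof -
    have sw: "(\<Sum>m\<in>M. \<Sum>m'\<in>M - {m}. (cmod (q m'))\<^sup>2 * cmod (w m m'))
       = (\<Sum>m\<in>M. \<Sum>m'\<in>M - {m}. (cmod (q m))\<^sup>2 * cmod (w m m'))"
    proof -
      have "(\<Sum>m\<in>M. \<Sum>m'\<in>M - {m}. (cmod (q m'))\<^sup>2 * cmod (w m m'))
        = (\<Sum>m\<in>M. \<Sum>m'\<in>M. if m' \<noteq> m then (cmod (q m'))\<^sup>2 * cmod (w m m') else 0)"
        using M by (intro sum.cong refl sum.mono_neutral_cong_left) auto
      also have "\<dots> = (\<Sum>m'\<in>M. \<Sum>m\<in>M. if m' \<noteq> m then (cmod (q m'))\<^sup>2 * cmod (w m' m) else 0)"
        by (subst sum.swap, intro sum.cong refl) (simp add: wsym)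
      also have "\<dots> = (\<Sum>m\<in>M. \<Sum>m'\<in>M - {m}. (cmod (q m))\<^sup>2 * cmod (w m m'))"
        using M by (intro sum.cong refl sum.mono_neutral_cong_right) auto
      finally show ?thesis .
    qed
    have "(\<Sum>m\<in>M. \<Sum>m'\<in>M - {m}. - (((cmod (q m))\<^sup>2 + (cmod (q m'))\<^sup>2) / 2 * cmod (w m m')))
       = (\<Sum>m\<in>M. \<Sum>m'\<in>M - {m}. - 1 / 2 * ((cmod (q m))\<^sup>2 * cmod (w m m'))
           + - 1 / 2 * ((cmod (q m'))\<^sup>2 * cmod (w m m')))"
      by (intro sum.cong refl) (simp add: field_simps)
    also have "\<dots> = - 1 / 2 * (\<Sum>m\<in>M. \<Sum>m'\<in>M - {m}. (cmod (q m))\<^sup>2 * cmod (w m m'))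
         + - 1 / 2 * (\<Sum>m\<in>M. \<Sum>m'\<in>M - {m}. (cmod (q m'))\<^sup>2 * cmod (w m m'))"
      by (simp only: sum.distrib sum_distrib_left)
    also have "\<dots> = - (\<Sum>m\<in>M. \<Sum>m'\<in>M - {m}. (cmod (q m))\<^sup>2 * cmod (w m m'))"
      unfolding sw by simp
    finally show ?thesis by (simp only: sum.distrib sum_distrib_left)
  qed
  finally have "(\<integral>U. (cmod (\<Sum>m\<in>M. q m * monomial m U))\<^sup>2 \<partial>\<mu>)
     \<ge> (\<Sum>m\<in>M. (cmod (q m))\<^sup>2 * a) - (\<Sum>m\<in>M. (cmod (q m))\<^sup>2 * (\<Sum>m'\<in>M - {m}. cmod (w m m')))" .
  moreover have "(\<Sum>m\<in>M. (cmod (q m))\<^sup>2 * (\<Sum>m'\<in>M - {m}. cmod (w m m'))) \<le> (\<Sum>m\<in>M. (cmod (q m))\<^sup>2 * b)"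
    using off unfolding w_def by (intro sum_mono mult_left_mono) auto
  moreover have sx: "(\<Sum>m\<in>M. (cmod (q m))\<^sup>2 * x) = x * (\<Sum>m\<in>M. (cmod (q m))\<^sup>2)" for x
    by (simp add: sum_distrib_left mult.commute)
  ultimately show ?thesis unfolding left_diff_distrib sx[of a] sx[of b] by linarith
qed

text \<open>\<open>extend_matchings_norm\<close> is iterated with \<kappa> relative to the mass of
  each form. The loss 4 k \<kappa> of step k is replaced by 4 T \<kappa> to make it uniform.\<close>

lemma qcoef_norm_ge:
  fixes T :: nat
  assumes row: "\<And>t e. t < T \<Longrightarrow> e \<in> edges \<Longrightarrow>
       (\<Sum>e'\<in>{e' \<in> edges. cls (fst e') = cls (fst e)}. (cmod (N t e'))\<^sup>2) \<le> \<kappa> * (\<Sum>e\<in>edges. (cmod (N t e))\<^sup>2)"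
    and col: "\<And>t e. t < T \<Longrightarrow> e \<in> edges \<Longrightarrow>
       (\<Sum>e'\<in>{e' \<in> edges. cls (snd e') = cls (snd e)}. (cmod (N t e'))\<^sup>2) \<le> \<kappa> * (\<Sum>e\<in>edges. (cmod (N t e))\<^sup>2)"
    and \<kappa>: "0 \<le> \<kappa>" "4 * real T * \<kappa> \<le> 1" and k: "k \<le> T"
  shows "(1 - 4 * real T * \<kappa>) ^ k * (\<Prod>t<k. \<Sum>e\<in>edges. (cmod (N t e))\<^sup>2) \<le> (\<Sum>m\<in>matchings k. (cmod (qcoef N k m))\<^sup>2)"
  using k
proof (induction k)
  case 0
  show ?case by (simp add: matchings_0)
next
  case (Suc k)
  define s where "s t = (\<Sum>e\<in>edges. (cmod (N t e))\<^sup>2)" for t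
  have s0: "s t \<ge> 0" for t by (simp add: s_def sum_nonneg)
  have "(1 - 4 * real T * \<kappa>) ^ Suc k * (\<Prod>t<Suc k. s t)
    = ((1 - 4 * real T * \<kappa>) * s k) * ((1 - 4 * real T * \<kappa>) ^ k * (\<Prod>t<k. s t))" by simp
  also have "\<dots> \<le> (s k - 4 * real k * (\<kappa> * s k)) * (\<Sum>m\<in>matchings k. (cmod (qcoef N k m))\<^sup>2)"
  proof (rule mult_mono)
    have "4 * real k * \<kappa> * s k \<le> 4 * real T * \<kappa> * s k"
      using Suc.prems \<kappa> s0 by (intro mult_right_mono) auto
    then show "(1 - 4 * real T * \<kappa>) * s k \<le> s k - 4 * real k * (\<kappa> * s k)" by (simp add: algebra_simps)
    have "4 * real k * \<kappa> \<le> 4 * real T * \<kappa>" using Suc.prems \<kappa> by (intro mult_right_mono) auto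
    then have "4 * real k * \<kappa> * s k \<le> 1 * s k" using \<kappa> s0 by (intro mult_right_mono) auto
    then show "0 \<le> s k - 4 * real k * (\<kappa> * s k)" by (simp add: algebra_simps)
    show "(1 - 4 * real T * \<kappa>) ^ k * (\<Prod>t<k. s t) \<le> (\<Sum>m\<in>matchings k. (cmod (qcoef N k m))\<^sup>2)"
      using Suc by (simp add: s_def)
    show "0 \<le> (1 - 4 * real T * \<kappa>) ^ k * (\<Prod>t<k. s t)"
      using \<kappa> s0 by (intro mult_nonneg_nonneg zero_le_power prod_nonneg) auto
  qed
  also have "\<dots> \<le> (\<Sum>m\<in>matchings (Suc k). (cmod (qcoef N (Suc k) m))\<^sup>2)"
    unfolding s_def qcoef.simps(2) using Suc.prems row col by (intro extend_matchings_norm) auto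
  finally show ?case by (simp add: s_def)
qed

text \<open>The Gram estimates give (1 - x) / d^T times the squared norm Q of the matching
  coefficients, where x collects the diagonal and off-diagonal errors. Bernoulli's inequality turns
  the T-fold loss in Q into y = 4 T^2 \<kappa>.\<close>

lemma flat_product_lower_bound:
  assumes row: "\<And>t e. t < T \<Longrightarrow> e \<in> edges \<Longrightarrow>
       (\<Sum>e'\<in>{e' \<in> edges. cls (fst e') = cls (fst e)}. (cmod (N t e'))\<^sup>2) \<le> \<kappa> * (\<Sum>e\<in>edges. (cmod (N t e))\<^sup>2)"
    and col: "\<And>t e. t < T \<Longrightarrow> e \<in> edges \<Longrightarrow>
       (\<Sum>e'\<in>{e' \<in> edges. cls (snd e') = cls (snd e)}. (cmod (N t e'))\<^sup>2) \<le> \<kappa> * (\<Sum>e\<in>edges. (cmod (N t e))\<^sup>2)"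
    and \<kappa>: "0 \<le> \<kappa>" "4 * real T * \<kappa> \<le> 1"
    and T: "T > 0" "2 * T\<^sup>2 \<le> d" "T * sqrt (2 * T / d) \<le> 1 / 8"
  shows "(1 - 2 * real T ^ 2 / d - 4 * T * sqrt (2 * T / d) - 4 * real T ^ 2 * \<kappa>)
      * (\<Prod>t<T. (\<Sum>e\<in>edges. (cmod (N t e))\<^sup>2) / d)
    \<le> (\<integral>U. (\<Prod>t<T. (cmod (\<Sum>e\<in>edges. N t e * U $$ e))\<^sup>2) \<partial>\<mu>)"
proof -
  define \<theta> where "\<theta> = sqrt (2 * T / d)"
  define s where "s t = (\<Sum>e\<in>edges. (cmod (N t e))\<^sup>2)" for t
  define x where "x = 2 * real T ^ 2 / d + 4 * T * \<theta>"
  define y where "y = 4 * real T ^ 2 * \<kappa>"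
  define Q where "Q = (\<Sum>m\<in>matchings T. (cmod (qcoef N T m))\<^sup>2)"
  have d: "d > 0" using T by (cases d) auto
  have T2: "2 * T \<le> d"
  proof -
    have "2 * T \<le> 2 * T\<^sup>2" by (simp add: power2_eq_square)
    then show ?thesis using T by linarith
  qed
  have "real (2 * T) \<le> real d" using T2 of_nat_le_iff by blast
  then have th: "0 < \<theta>" "\<theta> \<le> 1" "\<theta>\<^sup>2 * d = 2 * real T" "T * \<theta> \<le> 1 / 2" "4 * T * \<theta> \<le> 1 / 2"
    using T d by (simp_all add: \<theta>_def)
  have xp: "x \<ge> 0" using th by (simp add: x_def)
  have yp: "y \<ge> 0" using \<kappa> by (simp add: y_def)
  have sp: "(\<Prod>t<T. s t) \<ge> 0" by (intro prod_nonneg) (auto simp: s_def sum_nonneg)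
  have main: "((1 - 2 * real T ^ 2 / d) / real d ^ T - 4 * T * \<theta> / real d ^ T) * Q
    \<le> (\<integral>U. (cmod (\<Prod>t<T. \<Sum>e\<in>edges. N t e * U $$ e))\<^sup>2 \<partial>\<mu>)"
  proof -
    have "((1 - 2 * real T ^ 2 / d) / real d ^ T - 4 * T * \<theta> / real d ^ T) * Q
      \<le> (\<integral>U. (cmod (\<Sum>m\<in>matchings T. qcoef N T m * monomial m U))\<^sup>2 \<partial>\<mu>)"
      unfolding Q_def
      using overlap_diagonal[OF _ T(1,2)] overlap_off_diagonal[OF _ T(1,2) th(1-4)]
      by (intro gershgorin_lower_bound) (auto simp: matchings_def)
    also have "\<dots> \<le> (\<integral>U. (cmod (\<Prod>t<T. \<Sum>e\<in>edges. N t e * U $$ e))\<^sup>2 \<partial>\<mu>)"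
      by (rule good_part_le[OF T2])
    finally show ?thesis .
  qed
  have eq: "((1 - 2 * real T ^ 2 / d) / real d ^ T - 4 * T * \<theta> / real d ^ T) * Q = (1 - x) / real d ^ T * Q"
    by (simp add: x_def diff_divide_distrib add_divide_distrib algebra_simps)
  have Qge: "(1 - y) * (\<Prod>t<T. s t) \<le> Q"
  proof -
    have "1 + real T * (- (4 * real T * \<kappa>)) \<le> (1 + (- (4 * real T * \<kappa>))) ^ T"
      using \<kappa> by (intro Bernoulli_inequality) simp
    then have "(1 - y) * (\<Prod>t<T. s t) \<le> (1 - 4 * real T * \<kappa>) ^ T * (\<Prod>t<T. s t)"
      using sp by (intro mult_right_mono) (simp_all add: y_def power2_eq_square algebra_simps)
    also have "\<dots> \<le> Q" unfolding Q_def s_def using row col \<kappa> by (intro qcoef_norm_ge) auto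
    finally show ?thesis .
  qed
  \<comment> \<open>Multiplying \<open>Qge\<close> by 1 - x needs a nonnegative factor. For x > 1
    the claimed lower bound is at most 0, while the integral is nonnegative.\<close>
  have "(1 - x - y) * (\<Prod>t<T. s t) \<le> (1 - x) * Q \<or> x > 1"
  proof (cases "x > 1")
    case False
    have "(1 - x - y) * (\<Prod>t<T. s t) \<le> (1 - x) * (1 - y) * (\<Prod>t<T. s t)"
      using sp xp yp by (intro mult_right_mono) (auto simp: algebra_simps)
    also have "\<dots> \<le> (1 - x) * Q" unfolding mult.assoc using Qge False by (intro mult_left_mono) auto
    finally show ?thesis by simp
  qed simp
  moreover have pos: "0 \<le> (\<integral>U. (cmod (\<Prod>t<T. \<Sum>e\<in>edges. N t e * U $$ e))\<^sup>2 \<partial>\<mu>)"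
    by (intro Bochner_Integration.integral_nonneg) simp
  ultimately have "(1 - x - y) * (\<Prod>t<T. s t) / real d ^ T \<le> (\<integral>U. (cmod (\<Prod>t<T. \<Sum>e\<in>edges. N t e * U $$ e))\<^sup>2 \<partial>\<mu>)"
  proof (elim disjE)
    assume "(1 - x - y) * (\<Prod>t<T. s t) \<le> (1 - x) * Q"
    then have "(1 - x - y) * (\<Prod>t<T. s t) / real d ^ T \<le> (1 - x) * Q / real d ^ T"
      by (intro divide_right_mono) auto
    then show ?thesis using main unfolding eq by simp
  next
    assume "x > 1"
    then have "(1 - x - y) * (\<Prod>t<T. s t) / real d ^ T \<le> 0"
      using yp sp by (intro divide_nonpos_nonneg mult_nonpos_nonneg) auto
    then show ?thesis using pos by linarith
  qed
  moreover have "1 - x - y = 1 - 2 * real T ^ 2 / d - 4 * T * sqrt (2 * T / d) - 4 * real T ^ 2 * \<kappa>"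
    by (simp add: x_def y_def \<theta>_def)
  moreover have "(\<Prod>t<T. s t / d) = (\<Prod>t<T. s t) / real d ^ T"
    by (simp add: prod_dividef)
  ultimately show ?thesis by (simp add: s_def prod_norm[symmetric] prod_power_distrib)
qed

end

section \<open>The unitary and orthogonal groups\<close>

context haar_measure begin

text \<open>Letting the row of the k-th pair run over all d rows and summing replaces the pair by a
  Kronecker delta, by orthonormality of columns. Hence d copies of the moment differ from the lower
  moment by the total cost of moving the pair from row k to the rows i.\<close>

lemma moment_recursion_of_rows:
  assumes A: "finite A" "A \<subseteq> {..<d}" "k \<in> A" and c: "\<And>a. a \<in> A \<Longrightarrow> c a < d" "\<And>a. a \<in> A \<Longrightarrow> c' a < d"
    and Z: "\<And>i. i < d \<Longrightarrow> cmod ((\<integral>U. U $$ (i, c k) * cnj (U $$ (i, c' k)) *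
        (\<Prod>a\<in>A - {k}. U $$ (a, c a) * cnj (U $$ (a, c' a))) \<partial>\<mu>) - moment A c c') \<le> Z i"
  shows "cmod (of_nat d * moment A c c' - (if c k = c' k then moment (A - {k}) c c' else 0)) \<le> (\<Sum>i<d. Z i)"
proof -
  define h where "h U = (\<Prod>a\<in>A - {k}. U $$ (a, c a) * cnj (U $$ (a, c' a)))" for U :: "complex mat"
  define e where "e i = (\<integral>U. U $$ (i, c k) * cnj (U $$ (i, c' k)) * h U \<partial>\<mu>)" for i
  have bh: "bm h" unfolding h_def[abs_def] using A c by (intro bm_intros) auto
  have be: "bm (\<lambda>U. U $$ (i, c k) * cnj (U $$ (i, c' k)) * h U)" if "i < d" for i
    using A c that by (intro bm_intros bh) auto
  have "(\<Sum>i<d. e i) = (\<integral>U. (\<Sum>i<d. U $$ (i, c k) * cnj (U $$ (i, c' k)) * h U) \<partial>\<mu>)"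
    unfolding e_def using be by (intro Bochner_Integration.integral_sum[symmetric] bm_integrable) auto
  also have "\<dots> = (\<integral>U. (if c k = c' k then 1 else 0) * h U \<partial>\<mu>)"
  proof (rule integral_cong_AE)
    show "AE U in \<mu>. (\<Sum>i<d. U $$ (i, c k) * cnj (U $$ (i, c' k)) * h U) = (if c k = c' k then 1 else 0) * h U"
      using AE_in_group
    proof eventually_elim
      case (elim U)
      then have "(\<Sum>i<d. U $$ (i, c k) * cnj (U $$ (i, c' k))) = (if c k = c' k then 1 else 0)"
        using unitary A c by (intro unitary_cols) auto
      then show ?case by (simp add: sum_distrib_right[symmetric])
    qed
    show "(\<lambda>U. \<Sum>i<d. U $$ (i, c k) * cnj (U $$ (i, c' k)) * h U) \<in> borel_measurable \<mu>"
      using be by (intro bm_measurable bm_sum) auto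
    show "(\<lambda>U. (if c k = c' k then 1 else 0) * h U) \<in> borel_measurable \<mu>"
      by (intro bm_measurable bm_mult bm_const bh)
  qed
  also have "\<dots> = (if c k = c' k then moment (A - {k}) c c' else 0)"
    by (simp add: moment_def h_def)
  finally have sum: "(\<Sum>i<d. e i) = (if c k = c' k then moment (A - {k}) c c' else 0)" .
  have "of_nat d * moment A c c' - (\<Sum>i<d. e i) = (\<Sum>i<d. moment A c c' - e i)"
    by (simp add: sum_subtractf)
  also have "cmod \<dots> \<le> (\<Sum>i<d. Z i)"
    using Z unfolding e_def h_def by (intro sum_norm_le) (auto simp: norm_minus_commute)
  finally show ?thesis unfolding sum .
qed

lemma moment_remove:
  assumes "finite A" "k \<in> A"
  shows "moment A c c' = (\<integral>U. U $$ (k, c k) * cnj (U $$ (k, c' k)) *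
        (\<Prod>a\<in>A - {k}. U $$ (a, c a) * cnj (U $$ (a, c' a))) \<partial>\<mu>)"
  unfolding moment_def using prod.remove[OF assms] by (intro Bochner_Integration.integral_cong) auto

lemma moment_remove_two:
  assumes "finite A" "a \<in> A" "k \<in> A" "a \<noteq> k"
  shows "moment A c c' = (\<integral>U. (U $$ (a, c a) * cnj (U $$ (a, c' a))) * (U $$ (k, c k) * cnj (U $$ (k, c' k))) *
        (\<Prod>x\<in>A - {a, k}. U $$ (x, c x) * cnj (U $$ (x, c' x))) \<partial>\<mu>)"
  unfolding moment_def using prod_remove_two[OF assms] by (intro Bochner_Integration.integral_cong) auto

text \<open>The rotation moves no row of A except k. The derivative of the integral with the plain
  entry in row i and the conjugated one in row k is the pair in row k minus the pair in row i, so
  these two have equal integrals.\<close>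

lemma row_replacement_free:
  assumes A: "finite A" "A \<subseteq> {..<d}" "k \<in> A" "i < d" and c: "\<And>a. a \<in> A \<Longrightarrow> c a < d" "\<And>a. a \<in> A \<Longrightarrow> c' a < d"
    and rot: "\<And>r s :: real. r\<^sup>2 + s\<^sup>2 = 1 \<Longrightarrow> \<exists>g\<in>G. \<forall>U\<in>carrier_mat d d. \<forall>p<d.
       (g * U) $$ (i, p) = of_real r * U $$ (i, p) + of_real s * U $$ (k, p) \<and>
       (g * U) $$ (k, p) = of_real r * U $$ (k, p) + of_real s * (- U $$ (i, p)) \<and>
       (\<forall>x\<in>A - {k}. (g * U) $$ (x, p) = U $$ (x, p))"
  shows "(\<integral>U. U $$ (i, c k) * cnj (U $$ (i, c' k)) *
        (\<Prod>a\<in>A - {k}. U $$ (a, c a) * cnj (U $$ (a, c' a))) \<partial>\<mu>) = moment A c c'"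
proof -
  define h where "h U = (\<Prod>a\<in>A - {k}. U $$ (a, c a) * cnj (U $$ (a, c' a)))" for U :: "complex mat"
  have bh: "bm h" unfolding h_def[abs_def] using A c by (intro bm_intros) auto
  have kd: "k < d" "c k < d" "c' k < d" using A c by auto
  let ?I = "\<integral>U. U $$ (i, c k) * cnj (U $$ (k, c' k)) * h U \<partial>\<mu>"
  have "(\<integral>U. U $$ (k, c k) * cnj (U $$ (k, c' k)) * h U \<partial>\<mu>) + (\<integral>U. U $$ (i, c k) * - cnj (U $$ (i, c' k)) * h U \<partial>\<mu>) = 0"
  proof (rule integral_rotation_derivative2[where I = ?I])
    fix r s :: real assume "r\<^sup>2 + s\<^sup>2 = 1"
    then obtain g where g: "g \<in> G" "\<And>U p. U \<in> carrier_mat d d \<Longrightarrow> p < d \<Longrightarrow>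
       (g * U) $$ (i, p) = of_real r * U $$ (i, p) + of_real s * U $$ (k, p) \<and>
       (g * U) $$ (k, p) = of_real r * U $$ (k, p) + of_real s * (- U $$ (i, p)) \<and>
       (\<forall>x\<in>A - {k}. (g * U) $$ (x, p) = U $$ (x, p))" using rot by blast
    have "?I = (\<integral>U. (g * U) $$ (i, c k) * cnj ((g * U) $$ (k, c' k)) * h (g * U) \<partial>\<mu>)"
      using A kd by (intro integral_left_mult[symmetric, where f = "\<lambda>U. U $$ (i, c k) * cnj (U $$ (k, c' k)) * h U", OF g(1)]
         bm_measurable bm_mult bm_entry bm_cnj bh)
    also have "\<dots> = (\<integral>U. (of_real r * U $$ (i, c k) + of_real s * U $$ (k, c k)) *
        (of_real r * cnj (U $$ (k, c' k)) + of_real s * - cnj (U $$ (i, c' k))) * h U \<partial>\<mu>)"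
    proof (intro Bochner_Integration.integral_cong refl)
      fix U assume "U \<in> space \<mu>"
      then have U: "U \<in> carrier_mat d d" by simp
      have "h (g * U) = h U" unfolding h_def using g(2)[OF U] c by (intro prod.cong) auto
      then show "(g * U) $$ (i, c k) * cnj ((g * U) $$ (k, c' k)) * h (g * U)
        = (of_real r * U $$ (i, c k) + of_real s * U $$ (k, c k)) *
        (of_real r * cnj (U $$ (k, c' k)) + of_real s * - cnj (U $$ (i, c' k))) * h U"
        using g(2)[OF U kd(2)] g(2)[OF U kd(3)] by simp
    qed
    finally show "(\<integral>U. (of_real r * U $$ (i, c k) + of_real s * U $$ (k, c k)) *
        (of_real r * cnj (U $$ (k, c' k)) + of_real s * - cnj (U $$ (i, c' k))) * h U \<partial>\<mu>) = ?I" by simp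
  qed (use A kd bh in \<open>auto intro!: bm_intros\<close>)
  then show ?thesis unfolding moment_remove[OF A(1,3)] h_def[symmetric] by simp
qed

text \<open>Here row \<open>a\<close> is also moved by the rotation: for \<open>i = a\<close> it turns into \<open>l = k\<close>, and in the
  symplectic case with \<open>i\<close> the partner of \<open>a\<close> it turns into the partner \<open>l\<close> of \<open>k\<close>.\<close>

lemma row_replacement_occupied:
  fixes \<sigma> :: real
  assumes A: "finite A" "A \<subseteq> {..<d}" "k \<in> A" "a \<in> A" "a \<noteq> k" "i < d" "l < d"
    and c: "\<And>a. a \<in> A \<Longrightarrow> c a < d" "\<And>a. a \<in> A \<Longrightarrow> c' a < d"
    and rot: "\<And>r s :: real. r\<^sup>2 + s\<^sup>2 = 1 \<Longrightarrow> \<exists>g\<in>G. \<forall>U\<in>carrier_mat d d. \<forall>p<d.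
       (g * U) $$ (i, p) = of_real r * U $$ (i, p) + of_real s * U $$ (k, p) \<and>
       (g * U) $$ (k, p) = of_real r * U $$ (k, p) + of_real s * (- U $$ (i, p)) \<and>
       (g * U) $$ (a, p) = of_real r * U $$ (a, p) + of_real s * (of_real \<sigma> * U $$ (l, p)) \<and>
       (\<forall>x\<in>A - {a, k}. (g * U) $$ (x, p) = U $$ (x, p))"
  shows "(\<integral>U. U $$ (i, c k) * cnj (U $$ (i, c' k)) *
        (\<Prod>x\<in>A - {k}. U $$ (x, c x) * cnj (U $$ (x, c' x))) \<partial>\<mu>) = moment A c c'
     + of_real \<sigma> * (\<integral>U. U $$ (i, c k) * cnj (U $$ (k, c' k)) * U $$ (l, c a) * cnj (U $$ (a, c' a)) *
        (\<Prod>x\<in>A - {a, k}. U $$ (x, c x) * cnj (U $$ (x, c' x))) \<partial>\<mu>)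
     + of_real \<sigma> * (\<integral>U. U $$ (i, c k) * cnj (U $$ (k, c' k)) * U $$ (a, c a) * cnj (U $$ (l, c' a)) *
        (\<Prod>x\<in>A - {a, k}. U $$ (x, c x) * cnj (U $$ (x, c' x))) \<partial>\<mu>)"
proof -
  define h where "h U = (\<Prod>x\<in>A - {a, k}. U $$ (x, c x) * cnj (U $$ (x, c' x)))" for U :: "complex mat"
  have bh: "bm h" unfolding h_def[abs_def] using A c by (intro bm_intros) auto
  have kd: "k < d" "c k < d" "c' k < d" "a < d" "c a < d" "c' a < d" using A c by auto
  let ?I = "\<integral>U. U $$ (i, c k) * cnj (U $$ (k, c' k)) * U $$ (a, c a) * cnj (U $$ (a, c' a)) * h U \<partial>\<mu>"
  \<comment> \<open>The derivative at angle zero of the mixed product \<open>?I\<close>. Its first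
    two terms are the moment and the moment with the pair in row i; the last two come from the
    motion of row a.\<close>
  have "(\<integral>U. U $$ (k, c k) * cnj (U $$ (k, c' k)) * U $$ (a, c a) * cnj (U $$ (a, c' a)) * h U \<partial>\<mu>)
    + (\<integral>U. U $$ (i, c k) * (- cnj (U $$ (i, c' k))) * U $$ (a, c a) * cnj (U $$ (a, c' a)) * h U \<partial>\<mu>)
    + (\<integral>U. U $$ (i, c k) * cnj (U $$ (k, c' k)) * (of_real \<sigma> * U $$ (l, c a)) * cnj (U $$ (a, c' a)) * h U \<partial>\<mu>)
    + (\<integral>U. U $$ (i, c k) * cnj (U $$ (k, c' k)) * U $$ (a, c a) * (of_real \<sigma> * cnj (U $$ (l, c' a))) * h U \<partial>\<mu>) = 0"
  proof (rule integral_rotation_derivative4[where I = ?I])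
    fix r s :: real assume "r\<^sup>2 + s\<^sup>2 = 1"
    then obtain g where g: "g \<in> G" "\<And>U p. U \<in> carrier_mat d d \<Longrightarrow> p < d \<Longrightarrow>
       (g * U) $$ (i, p) = of_real r * U $$ (i, p) + of_real s * U $$ (k, p) \<and>
       (g * U) $$ (k, p) = of_real r * U $$ (k, p) + of_real s * (- U $$ (i, p)) \<and>
       (g * U) $$ (a, p) = of_real r * U $$ (a, p) + of_real s * (of_real \<sigma> * U $$ (l, p)) \<and>
       (\<forall>x\<in>A - {a, k}. (g * U) $$ (x, p) = U $$ (x, p))" using rot by blast
    have "?I = (\<integral>U. (g * U) $$ (i, c k) * cnj ((g * U) $$ (k, c' k)) * (g * U) $$ (a, c a) * cnj ((g * U) $$ (a, c' a)) * h (g * U) \<partial>\<mu>)"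
      using A kd by (intro integral_left_mult[symmetric,
          where f = "\<lambda>U. U $$ (i, c k) * cnj (U $$ (k, c' k)) * U $$ (a, c a) * cnj (U $$ (a, c' a)) * h U", OF g(1)]
         bm_measurable bm_mult bm_entry bm_cnj bh)
    also have "\<dots> = (\<integral>U. (of_real r * U $$ (i, c k) + of_real s * U $$ (k, c k)) *
        (of_real r * cnj (U $$ (k, c' k)) + of_real s * - cnj (U $$ (i, c' k))) *
        (of_real r * U $$ (a, c a) + of_real s * (of_real \<sigma> * U $$ (l, c a))) *
        (of_real r * cnj (U $$ (a, c' a)) + of_real s * (of_real \<sigma> * cnj (U $$ (l, c' a)))) * h U \<partial>\<mu>)"
    proof (intro Bochner_Integration.integral_cong refl)
      fix U assume "U \<in> space \<mu>"
      then have U: "U \<in> carrier_mat d d" by simp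
      have "h (g * U) = h U" unfolding h_def using g(2)[OF U] c by (intro prod.cong) auto
      then show "(g * U) $$ (i, c k) * cnj ((g * U) $$ (k, c' k)) * (g * U) $$ (a, c a) * cnj ((g * U) $$ (a, c' a)) * h (g * U)
        = (of_real r * U $$ (i, c k) + of_real s * U $$ (k, c k)) *
        (of_real r * cnj (U $$ (k, c' k)) + of_real s * - cnj (U $$ (i, c' k))) *
        (of_real r * U $$ (a, c a) + of_real s * (of_real \<sigma> * U $$ (l, c a))) *
        (of_real r * cnj (U $$ (a, c' a)) + of_real s * (of_real \<sigma> * cnj (U $$ (l, c' a)))) * h U"
        using g(2)[OF U kd(2)] g(2)[OF U kd(3)] g(2)[OF U kd(5)] g(2)[OF U kd(6)] by simp
    qed
    finally show "(\<integral>U. (of_real r * U $$ (i, c k) + of_real s * U $$ (k, c k)) *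
        (of_real r * cnj (U $$ (k, c' k)) + of_real s * - cnj (U $$ (i, c' k))) *
        (of_real r * U $$ (a, c a) + of_real s * (of_real \<sigma> * U $$ (l, c a))) *
        (of_real r * cnj (U $$ (a, c' a)) + of_real s * (of_real \<sigma> * cnj (U $$ (l, c' a)))) * h U \<partial>\<mu>) = ?I" by simp
  qed (use A kd bh in \<open>auto intro!: bm_intros\<close>)
  moreover have "(\<integral>U. U $$ (k, c k) * cnj (U $$ (k, c' k)) * U $$ (a, c a) * cnj (U $$ (a, c' a)) * h U \<partial>\<mu>) = moment A c c'"
    unfolding moment_remove_two[OF A(1,4,3,5)] h_def by (simp add: mult_ac)
  moreover have "(\<integral>U. U $$ (i, c k) * (- cnj (U $$ (i, c' k))) * U $$ (a, c a) * cnj (U $$ (a, c' a)) * h U \<partial>\<mu>)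
    = - (\<integral>U. U $$ (i, c k) * cnj (U $$ (i, c' k)) * (\<Prod>x\<in>A - {k}. U $$ (x, c x) * cnj (U $$ (x, c' x))) \<partial>\<mu>)"
  proof -
    have "A - {k} - {a} = A - {a, k}" by auto
    then have "(\<Prod>x\<in>A - {k}. U $$ (x, c x) * cnj (U $$ (x, c' x))) = U $$ (a, c a) * cnj (U $$ (a, c' a)) * h U" for U :: "complex mat"
      using prod.remove[of "A - {k}" a "\<lambda>x. U $$ (x, c x) * cnj (U $$ (x, c' x))"] A by (simp add: h_def)
    then show ?thesis by (simp add: mult_ac)
  qed
  moreover have "(\<integral>U. U $$ (i, c k) * cnj (U $$ (k, c' k)) * (of_real \<sigma> * U $$ (l, c a)) * cnj (U $$ (a, c' a)) * h U \<partial>\<mu>)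
    = of_real \<sigma> * (\<integral>U. U $$ (i, c k) * cnj (U $$ (k, c' k)) * U $$ (l, c a) * cnj (U $$ (a, c' a)) * h U \<partial>\<mu>)"
    unfolding integral_mult_right_zero[symmetric] by (simp add: mult_ac)
  moreover have "(\<integral>U. U $$ (i, c k) * cnj (U $$ (k, c' k)) * U $$ (a, c a) * (of_real \<sigma> * cnj (U $$ (l, c' a))) * h U \<partial>\<mu>)
    = of_real \<sigma> * (\<integral>U. U $$ (i, c k) * cnj (U $$ (k, c' k)) * U $$ (a, c a) * cnj (U $$ (l, c' a)) * h U \<partial>\<mu>)"
    unfolding integral_mult_right_zero[symmetric] by (simp add: mult_ac)
  ultimately show ?thesis unfolding h_def[symmetric] by (simp add: add_eq_0_iff algebra_simps)
qed

lemma swap_columns_moment: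
  assumes A: "finite A" "k \<in> A" "a \<in> A" "a \<noteq> k"
  shows "(\<integral>U. U $$ (a, c k) * cnj (U $$ (k, c' k)) * U $$ (k, c a) * cnj (U $$ (a, c' a)) *
        (\<Prod>x\<in>A - {a, k}. U $$ (x, c x) * cnj (U $$ (x, c' x))) \<partial>\<mu>)
     = moment A (c(a := c k, k := c a)) c'"
proof -
  have h: "(\<Prod>x\<in>A - {a, k}. U $$ (x, (c(a := c k, k := c a)) x) * cnj (U $$ (x, c' x)))
     = (\<Prod>x\<in>A - {a, k}. U $$ (x, c x) * cnj (U $$ (x, c' x)))" for U :: "complex mat"
    by (intro prod.cong) auto
  show ?thesis unfolding moment_remove_two[OF A(1,3,2,4), of "c(a := c k, k := c a)"] h
    using A by (simp add: mult_ac)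
qed

end

lemma diag_unitary:
  assumes "\<And>i. i < d \<Longrightarrow> cmod (f i) = 1"
  shows "mat d d (\<lambda>(i, j). if i = j then f i else 0) \<in> unitary_group d"
proof -
  have u: "cnj (f i) * f i = 1" "f i * cnj (f i) = 1" if "i < d" for i
    using assms[OF that] complex_norm_square[of "f i"] by (simp_all add: mult.commute)
  let ?D = "mat d d (\<lambda>(i, j). if i = j then f i else 0)"
  have "adj ?D * ?D = 1\<^sub>m d"
  proof (intro eq_matI)
    fix x y assume "x < dim_row (1\<^sub>m d :: complex mat)" "y < dim_col (1\<^sub>m d :: complex mat)"
    then have xy: "x < d" "y < d" by auto
    have "(adj ?D * ?D) $$ (x, y) = (\<Sum>l<d. adj ?D $$ (x, l) * ?D $$ (l, y))"
      using xy by (intro mat_mult_index_sum) auto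
    also have "\<dots> = (\<Sum>l<d. if l = x then (if x = y then 1 else 0) else 0)"
      using xy u by (intro sum.cong) (auto simp: adj_def)
    finally show "(adj ?D * ?D) $$ (x, y) = 1\<^sub>m d $$ (x, y)" using xy by simp
  qed (auto simp: adj_def)
  moreover have "?D * adj ?D = 1\<^sub>m d"
  proof (intro eq_matI)
    fix x y assume "x < dim_row (1\<^sub>m d :: complex mat)" "y < dim_col (1\<^sub>m d :: complex mat)"
    then have xy: "x < d" "y < d" by auto
    have "(?D * adj ?D) $$ (x, y) = (\<Sum>l<d. ?D $$ (x, l) * adj ?D $$ (l, y))"
      using xy by (intro mat_mult_index_sum) auto
    also have "\<dots> = (\<Sum>l<d. if l = x then (if x = y then 1 else 0) else 0)"
      using xy u by (intro sum.cong) (auto simp: adj_def)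
    finally show "(?D * adj ?D) $$ (x, y) = 1\<^sub>m d $$ (x, y)" using xy by simp
  qed (auto simp: adj_def)
  ultimately show ?thesis by (simp add: unitary_group_def)
qed

lemma involution_id: "involution d (\<lambda>i. i)" by unfold_locales auto

lemma chi_id: "chi (\<lambda>i. i) b i = (if i = b then -1 else 1)"
  by (simp add: chi_def)

lemma plane_rot_rows:
  assumes "i < d" "k < d" "i \<noteq> k" "k \<notin> X" "i \<notin> X" "X \<subseteq> {..<d}" "U \<in> carrier_mat d d" "p < d"
  shows "(plane_rot d i k r s * U) $$ (i, p) = of_real r * U $$ (i, p) + of_real s * U $$ (k, p) \<and>
       (plane_rot d i k r s * U) $$ (k, p) = of_real r * U $$ (k, p) + of_real s * (- U $$ (i, p)) \<and>
       (\<forall>x\<in>X. (plane_rot d i k r s * U) $$ (x, p) = U $$ (x, p))"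
  using assms plane_rot_mult[OF assms(7) assms(1-3) _ assms(8), of _ r s]
  by (auto simp: subset_iff)

text \<open>A row i outside A causes no error. For i in A the derivative has two extra terms: the
  column swap, and the term of \<open>T3\<close>, with both plain entries in row a and both
  conjugated ones in row k. The latter is where the unitary and orthogonal groups differ.\<close>

lemma haar_symmetric_of_plane_rot:
  assumes "haar_prob d G \<mu>" "G \<subseteq> unitary_group d"
    and phase: "\<And>b. b < d \<Longrightarrow> mat d d (\<lambda>(i, j). if i = j then chi (\<lambda>i. i) b i else 0) \<in> G"
    and rot: "\<And>i k c s. i < d \<Longrightarrow> k < d \<Longrightarrow> i \<noteq> k \<Longrightarrow> c\<^sup>2 + s\<^sup>2 = 1 \<Longrightarrow> plane_rot d i k c s \<in> G"
    and T3: "\<And>A a k c c'. A \<subseteq> {..<d} \<Longrightarrow> finite A \<Longrightarrow> a \<in> A \<Longrightarrow> k \<in> A \<Longrightarrow> a \<noteq> k \<Longrightarrow>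
        (\<And>a. a \<in> A \<Longrightarrow> c a < d) \<Longrightarrow> (\<And>a. a \<in> A \<Longrightarrow> c' a < d) \<Longrightarrow>
        cmod (\<integral>U. U $$ (a, c k) * cnj (U $$ (k, c' k)) * U $$ (a, c a) * cnj (U $$ (k, c' a)) *
          (\<Prod>x\<in>A - {a, k}. U $$ (x, c x) * cnj (U $$ (x, c' x))) \<partial>\<mu>)
        \<le> cmod (haar_measure.moment \<mu> A (c(k := c' a)) (c'(a := c k)))"
  shows "haar_symmetric d G \<mu> (\<lambda>i. i)"
proof -
  interpret haar_measure d G \<mu> using assms by unfold_locales
  interpret involution d "\<lambda>i. i" by (rule involution_id)
  show ?thesis
  proof
    fix A k and c c' :: "nat \<Rightarrow> nat"
    assume A: "A \<subseteq> {..<d}" "k \<in> A" and c: "\<And>a. a \<in> A \<Longrightarrow> c a < d" "\<And>a. a \<in> A \<Longrightarrow> c' a < d"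
    have fA: "finite A" using A finite_subset by blast
    have kd: "k < d" using A by auto
    let ?z = "\<lambda>a. cmod (moment A (c(a := c k, k := c a)) c') + cmod (moment A (c(k := c' a)) (c'(a := c k)))"
    have "cmod (of_nat d * moment A c c' - (if c k = c' k then moment (A - {k}) c c' else 0))
      \<le> (\<Sum>i<d. if i \<in> A - {k} then ?z i else 0)"
    proof (rule moment_recursion_of_rows[OF fA A c])
      fix i assume i: "i < d"
      let ?e = "\<integral>U. U $$ (i, c k) * cnj (U $$ (i, c' k)) * (\<Prod>a\<in>A - {k}. U $$ (a, c a) * cnj (U $$ (a, c' a))) \<partial>\<mu>"
      have *: "e - y = s + w" if "e = y + of_real 1 * x + of_real 1 * w" "x = s" for e y x w s :: complex
        using that by simp
      have sub1: "A - {k} \<subseteq> {..<d}" and sub2: "A - {i, k} \<subseteq> {..<d}" using A by auto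
      consider "i = k" | "i \<notin> A" | "i \<in> A" "i \<noteq> k" by blast
      then show "cmod (?e - moment A c c') \<le> (if i \<in> A - {k} then ?z i else 0)"
      proof cases
        case 1
        then show ?thesis using moment_remove[OF fA A(2), of c c'] by simp
      next
        case 2
        then have ik: "i \<noteq> k" using A by auto
        have "?e = moment A c c'"
        proof (rule row_replacement_free[OF fA A i c])
          fix r s :: real assume "r\<^sup>2 + s\<^sup>2 = 1"
          then show "\<exists>g\<in>G. \<forall>U\<in>carrier_mat d d. \<forall>p<d.
           (g * U) $$ (i, p) = of_real r * U $$ (i, p) + of_real s * U $$ (k, p) \<and>
           (g * U) $$ (k, p) = of_real r * U $$ (k, p) + of_real s * (- U $$ (i, p)) \<and>
           (\<forall>x\<in>A - {k}. (g * U) $$ (x, p) = U $$ (x, p))"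
            using plane_rot_rows[OF i kd ik _ _ sub1] 2 rot[OF i kd ik]
            by (intro bexI[of _ "plane_rot d i k r s"] ballI allI impI) simp_all
        qed
        then show ?thesis using 2 by simp
      next
        case 3
        have "?e = moment A c c'
         + of_real 1 * (\<integral>U. U $$ (i, c k) * cnj (U $$ (k, c' k)) * U $$ (k, c i) * cnj (U $$ (i, c' i)) *
            (\<Prod>x\<in>A - {i, k}. U $$ (x, c x) * cnj (U $$ (x, c' x))) \<partial>\<mu>)
         + of_real 1 * (\<integral>U. U $$ (i, c k) * cnj (U $$ (k, c' k)) * U $$ (i, c i) * cnj (U $$ (k, c' i)) *
            (\<Prod>x\<in>A - {i, k}. U $$ (x, c x) * cnj (U $$ (x, c' x))) \<partial>\<mu>)"
        proof (rule row_replacement_occupied[OF fA A 3 i kd c])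
          fix r s :: real assume "r\<^sup>2 + s\<^sup>2 = 1"
          then show "\<exists>g\<in>G. \<forall>U\<in>carrier_mat d d. \<forall>p<d.
           (g * U) $$ (i, p) = of_real r * U $$ (i, p) + of_real s * U $$ (k, p) \<and>
           (g * U) $$ (k, p) = of_real r * U $$ (k, p) + of_real s * (- U $$ (i, p)) \<and>
           (g * U) $$ (i, p) = of_real r * U $$ (i, p) + of_real s * (of_real 1 * U $$ (k, p)) \<and>
           (\<forall>x\<in>A - {i, k}. (g * U) $$ (x, p) = U $$ (x, p))"
            using plane_rot_rows[OF i kd 3(2) _ _ sub2] rot[OF i kd 3(2)]
            by (intro bexI[of _ "plane_rot d i k r s"] ballI allI impI) simp_all
        qed
        then have e: "?e - moment A c c' = moment A (c(i := c k, k := c i)) c'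
           + (\<integral>U. U $$ (i, c k) * cnj (U $$ (k, c' k)) * U $$ (i, c i) * cnj (U $$ (k, c' i)) *
            (\<Prod>x\<in>A - {i, k}. U $$ (x, c x) * cnj (U $$ (x, c' x))) \<partial>\<mu>)"
          by (rule *[OF _ swap_columns_moment[OF fA A(2) 3, of c c']])
        have "cmod (?e - moment A c c') \<le> ?z i"
          unfolding e using T3[OF A(1) fA 3(1) A(2) 3(2) c] by (intro norm_triangle_mono order_refl)
        then show ?thesis using 3 by simp
      qed
    qed
    also have "\<dots> = (\<Sum>a\<in>A - {k}. ?z a)"
      using A by (intro sum.mono_neutral_cong_right) auto
    finally show "cmod (of_nat d * moment A c c' - (if c k = c' k then moment (A - {k}) c c' else 0)) \<le> (\<Sum>a\<in>A - {k}. ?z a)" .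
  qed (use phase in auto)
qed

text \<open>Multiplying row a by the imaginary unit gives its two plain entries the factor -1, so
  the extra term vanishes. A sign would cancel, because row a occurs twice.\<close>

lemma unitary_haar_symmetric:
  assumes "haar_prob d (unitary_group d) \<mu>"
  shows "haar_symmetric d (unitary_group d) \<mu> (\<lambda>i. i)"
proof (rule haar_symmetric_of_plane_rot[OF assms])
  interpret haar_measure d "unitary_group d" \<mu> using assms by unfold_locales auto
  show "mat d d (\<lambda>(i, j). if i = j then chi (\<lambda>i. i) b i else 0) \<in> unitary_group d" for b
    by (rule diag_unitary) (simp add: chi_id)
  show "plane_rot d i k c s \<in> unitary_group d" if "i < d" "k < d" "i \<noteq> k" "c\<^sup>2 + s\<^sup>2 = 1" for i k c s
    using that by (rule plane_rot_unitary)
  fix A a k and c c' :: "nat \<Rightarrow> nat"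
  assume A: "A \<subseteq> {..<d}" "finite A" "a \<in> A" "k \<in> A" "a \<noteq> k"
    and c: "\<And>a. a \<in> A \<Longrightarrow> c a < d" "\<And>a. a \<in> A \<Longrightarrow> c' a < d"
  have lt: "a < d" "k < d" "c a < d" "c' a < d" "c k < d" "c' k < d" using A c by auto
  let ?f = "\<lambda>U. U $$ (a, c k) * cnj (U $$ (k, c' k)) * U $$ (a, c a) * cnj (U $$ (k, c' a)) *
          (\<Prod>x\<in>A - {a, k}. U $$ (x, c x) * cnj (U $$ (x, c' x)))"
  let ?D = "mat d d (\<lambda>(i, j). if i = j then (if i = a then \<i> else 1) else 0)"
  have "(\<integral>U. ?f U \<partial>\<mu>) = 0"
  proof (rule integral_zero_by_phase[of ?D])
    show "?D \<in> unitary_group d" by (rule diag_unitary) simp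
    show "bm ?f" using A c lt by (intro bm_intros) auto
    fix U :: "complex mat" assume U: "U \<in> carrier_mat d d"
    have "(\<Prod>x\<in>A - {a, k}. (?D * U) $$ (x, c x) * cnj ((?D * U) $$ (x, c' x)))
      = (\<Prod>x\<in>A - {a, k}. U $$ (x, c x) * cnj (U $$ (x, c' x)))"
      using A c by (intro prod.cong refl) (auto simp: diag_mult_index[OF U] subset_iff)
    moreover have "(?D * U) $$ (a, c k) = \<i> * U $$ (a, c k)" "(?D * U) $$ (a, c a) = \<i> * U $$ (a, c a)"
      "(?D * U) $$ (k, c' k) = U $$ (k, c' k)" "(?D * U) $$ (k, c' a) = U $$ (k, c' a)"
      using lt A(5) by (simp_all add: diag_mult_index[OF U])
    moreover have "\<i> * x * y * (\<i> * z) * v * h = - 1 * (x * y * z * v * h)" for x y z v h :: complex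
      by (metis complex_i_mult_minus mult.assoc mult.left_commute mult_minus1)
    ultimately show "?f (?D * U) = - 1 * ?f U" by (simp only:)
  qed simp
  then show "cmod (\<integral>U. ?f U \<partial>\<mu>) \<le> cmod (moment A (c(k := c' a)) (c'(a := c k)))" by simp
qed simp

lemma orthogonal_group_subset: "orthogonal_group d \<subseteq> unitary_group d"
  by (auto simp: orthogonal_group_def)

lemma orthogonal_real:
  assumes "Q \<in> orthogonal_group d" "i < d" "j < d" shows "cnj (Q $$ (i, j)) = Q $$ (i, j)"
proof -
  have Q: "Q \<in> carrier_mat d d" "transpose_mat Q = adj Q"
    using assms by (auto simp: orthogonal_group_def unitary_group_def)
  have "transpose_mat Q $$ (j, i) = adj Q $$ (j, i)" by (simp add: Q)
  then show ?thesis using Q(1) assms by (auto simp: carrier_matD)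
qed

text \<open>Entries are real, so a conjugation can be moved between the two factors of a row. The
  extra term then is a moment in which one column of c and one of c' are crossed.\<close>

lemma orthogonal_haar_symmetric:
  assumes "haar_prob d (orthogonal_group d) \<mu>"
  shows "haar_symmetric d (orthogonal_group d) \<mu> (\<lambda>i. i)"
proof (rule haar_symmetric_of_plane_rot[OF assms orthogonal_group_subset])
  interpret haar_measure d "orthogonal_group d" \<mu> using assms orthogonal_group_subset by unfold_locales auto
  show "mat d d (\<lambda>(i, j). if i = j then chi (\<lambda>i. i) b i else 0) \<in> orthogonal_group d" for b
    unfolding orthogonal_group_def
    using diag_unitary[of d "chi (\<lambda>i. i) b"] by (auto simp: chi_id adj_def intro!: eq_matI)
  show "plane_rot d i k c s \<in> orthogonal_group d" if "i < d" "k < d" "i \<noteq> k" "c\<^sup>2 + s\<^sup>2 = 1" for i k c s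
    using that by (rule plane_rot_orthogonal)
  fix A a k and c c' :: "nat \<Rightarrow> nat"
  assume A: "A \<subseteq> {..<d}" "finite A" "a \<in> A" "k \<in> A" "a \<noteq> k"
    and c: "\<And>a. a \<in> A \<Longrightarrow> c a < d" "\<And>a. a \<in> A \<Longrightarrow> c' a < d"
  have lt: "a < d" "k < d" "c a < d" "c' a < d" "c k < d" "c' k < d" using A c by auto
  let ?h = "\<lambda>U. \<Prod>x\<in>A - {a, k}. U $$ (x, c x) * cnj (U $$ (x, c' x))"
  let ?f = "\<lambda>U. U $$ (a, c k) * cnj (U $$ (k, c' k)) * U $$ (a, c a) * cnj (U $$ (k, c' a)) * ?h U"
  let ?g = "\<lambda>U. (U $$ (a, c a) * cnj (U $$ (a, c k))) * (U $$ (k, c' a) * cnj (U $$ (k, c' k))) * ?h U"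
  have "(\<integral>U. ?f U \<partial>\<mu>) = (\<integral>U. ?g U \<partial>\<mu>)"
  proof (rule integral_cong_AE)
    have bh: "bm ?h" using A c by (intro bm_intros) auto
    show "?f \<in> borel_measurable \<mu>" by (intro bm_measurable bm_mult bm_cnj bm_entry lt bh)
    show "?g \<in> borel_measurable \<mu>" by (intro bm_measurable bm_mult bm_cnj bm_entry lt bh)
    show "AE U in \<mu>. ?f U = ?g U"
      using AE_in_group
    proof eventually_elim
      case (elim U)
      have "cnj (U $$ (k, c' a)) = U $$ (k, c' a)" "cnj (U $$ (a, c k)) = U $$ (a, c k)"
        using orthogonal_real[OF elim] lt by auto
      then show "?f U = ?g U" by (simp only: mult_ac)
    qed
  qed
  also have "\<dots> = moment A (c(k := c' a)) (c'(a := c k))"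
  proof -
    have "(\<Prod>x\<in>A - {a, k}. U $$ (x, (c(k := c' a)) x) * cnj (U $$ (x, (c'(a := c k)) x))) = ?h U" for U
      by (intro prod.cong) auto
    then show ?thesis unfolding moment_remove_two[OF A(2,3,4,5)] using A by simp
  qed
  finally show "cmod (\<integral>U. ?f U \<partial>\<mu>) \<le> cmod (moment A (c(k := c' a)) (c'(a := c k)))" by simp
qed

section \<open>The symplectic group\<close>

definition spbar :: "nat \<Rightarrow> nat \<Rightarrow> nat" where
  "spbar m i = (if i < m then i + m else i - m)"

text \<open>The sign of the only nonzero entry in row i of \<open>sympJ\<close>, which stands in
  column \<open>spbar m i\<close>.\<close>

definition speta :: "nat \<Rightarrow> nat \<Rightarrow> real" where
  "speta m i = (if i < m then 1 else -1)"

lemma involution_spbar: "involution (2 * m) (spbar m)"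
  by unfold_locales (auto simp: spbar_def)

lemma spbar_less: "i < 2 * m \<Longrightarrow> spbar m i < 2 * m" by (auto simp: spbar_def)

lemma spbar_spbar: "i < 2 * m \<Longrightarrow> spbar m (spbar m i) = i" by (auto simp: spbar_def)

lemma spbar_neq: "i < 2 * m \<Longrightarrow> spbar m i \<noteq> i" by (auto simp: spbar_def)

lemma speta_spbar: "i < 2 * m \<Longrightarrow> speta m (spbar m i) = - speta m i"
  by (auto simp: spbar_def speta_def)

lemma speta_square: "speta m i * speta m i = 1" by (simp add: speta_def)

lemma sympJ_index:
  assumes "x < 2 * m" "y < 2 * m"
  shows "sympJ (2 * m) $$ (x, y) = (if y = spbar m x then of_real (speta m x) else 0)"
  using assms by (auto simp: sympJ_def spbar_def speta_def)

text \<open>Each row and column of J has one nonzero entry, so the defining equation can be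
  multiplied out entrywise. In this form membership of rotations and phases is checked and
  conjugates inside moments are converted.\<close>

lemma symplectic_iff:
  "S \<in> symplectic_group (2 * m) \<longleftrightarrow> S \<in> unitary_group (2 * m) \<and>
    (\<forall>i<2 * m. \<forall>j<2 * m. cnj (S $$ (i, j)) = of_real (speta m i * speta m j) * S $$ (spbar m i, spbar m j))"
proof (cases "S \<in> unitary_group (2 * m)")
  case True
  let ?d = "2 * m"
  let ?J = "sympJ ?d"
  have S: "S \<in> carrier_mat ?d ?d" using True unitary_group_carrier by blast
  have J: "?J \<in> carrier_mat ?d ?d" by (simp add: sympJ_def)
  have JS: "?J * transpose_mat S \<in> carrier_mat ?d ?d" using S J by simp
  have mJ: "(- ?J) $$ (l, y) = (if l = spbar m y then of_real (speta m y) else 0)" if "l < ?d" "y < ?d" for l y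
    using sympJ_index[OF that] that by (auto simp: sympJ_def spbar_def speta_def)
  have idx: "(?J * transpose_mat S * (- ?J)) $$ (x, y) = of_real (speta m x * speta m y) * S $$ (spbar m y, spbar m x)"
    if xy: "x < ?d" "y < ?d" for x y
  proof -
    have 1: "(?J * transpose_mat S) $$ (x, l) = of_real (speta m x) * S $$ (l, spbar m x)" if l: "l < ?d" for l
    proof -
      have "(?J * transpose_mat S) $$ (x, l) = (\<Sum>k<?d. ?J $$ (x, k) * transpose_mat S $$ (k, l))"
        using S J xy l by (intro mat_mult_index_sum) auto
      also have "\<dots> = (\<Sum>k<?d. if k = spbar m x then of_real (speta m x) * S $$ (l, k) else 0)"
        using S xy l by (intro sum.cong refl) (auto simp: sympJ_index carrier_matD)
      finally show ?thesis using spbar_less[OF xy(1)] by simp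
    qed
    have "(?J * transpose_mat S * (- ?J)) $$ (x, y) = (\<Sum>l<?d. (?J * transpose_mat S) $$ (x, l) * (- ?J) $$ (l, y))"
      using JS J xy by (intro mat_mult_index_sum) auto
    also have "\<dots> = (\<Sum>l<?d. if l = spbar m y then of_real (speta m x * speta m y) * S $$ (l, spbar m x) else 0)"
      using xy by (intro sum.cong refl) (auto simp: 1 mJ simp del: index_uminus_mat)
    finally show ?thesis using spbar_less[OF xy(2)] by simp
  qed
  have "?J * transpose_mat S * (- ?J) = adj S \<longleftrightarrow>
    (\<forall>x<?d. \<forall>y<?d. (?J * transpose_mat S * (- ?J)) $$ (x, y) = adj S $$ (x, y))"
  proof
    assume h: "\<forall>x<?d. \<forall>y<?d. (?J * transpose_mat S * (- ?J)) $$ (x, y) = adj S $$ (x, y)"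
    show "?J * transpose_mat S * (- ?J) = adj S"
      using h S J by (intro eq_matI) (auto simp: adj_def simp del: index_mult_mat(1))
  qed simp
  also have "\<dots> \<longleftrightarrow> (\<forall>i<?d. \<forall>j<?d. cnj (S $$ (i, j)) = of_real (speta m i * speta m j) * S $$ (spbar m i, spbar m j))"
  proof (intro iffI allI impI)
    fix i j assume h: "\<forall>x<?d. \<forall>y<?d. (?J * transpose_mat S * (- ?J)) $$ (x, y) = adj S $$ (x, y)"
      and ij: "i < ?d" "j < ?d"
    have "of_real (speta m j * speta m i) * S $$ (spbar m i, spbar m j) = adj S $$ (j, i)"
      using h ij idx[OF ij(2,1)] by simp
    then show "cnj (S $$ (i, j)) = of_real (speta m i * speta m j) * S $$ (spbar m i, spbar m j)"
      unfolding adj_index[OF S ij(2,1)] by (simp only: mult.commute)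
  next
    fix x y assume h: "\<forall>i<?d. \<forall>j<?d. cnj (S $$ (i, j)) = of_real (speta m i * speta m j) * S $$ (spbar m i, spbar m j)"
      and xy: "x < ?d" "y < ?d"
    show "(?J * transpose_mat S * (- ?J)) $$ (x, y) = adj S $$ (x, y)"
      unfolding idx[OF xy] adj_index[OF S xy] h[rule_format, OF xy(2,1)] by (simp only: mult.commute)
  qed
  finally show ?thesis using True by (simp add: symplectic_group_def)
qed (simp add: symplectic_group_def)

lemma symplectic_cnj:
  assumes "S \<in> symplectic_group (2 * m)" "i < 2 * m" "j < 2 * m"
  shows "cnj (S $$ (i, j)) = of_real (speta m i * speta m j) * S $$ (spbar m i, spbar m j)"
  using assms symplectic_iff by blast

lemma symplectic_group_subset: "symplectic_group d \<subseteq> unitary_group d"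
  by (auto simp: symplectic_group_def)

lemma symplectic_group_mult:
  assumes "U \<in> symplectic_group (2 * m)" "V \<in> symplectic_group (2 * m)"
  shows "U * V \<in> symplectic_group (2 * m)"
  unfolding symplectic_iff
proof (intro conjI allI impI)
  have u: "U \<in> unitary_group (2 * m)" "V \<in> unitary_group (2 * m)"
    using assms symplectic_group_subset by auto
  then show "U * V \<in> unitary_group (2 * m)" by (rule unitary_group_mult)
  have c: "U \<in> carrier_mat (2 * m) (2 * m)" "V \<in> carrier_mat (2 * m) (2 * m)"
    using u unitary_group_carrier by auto
  fix i j assume ij: "i < 2 * m" "j < 2 * m"
  have "cnj ((U * V) $$ (i, j)) = (\<Sum>l<2 * m. cnj (U $$ (i, l)) * cnj (V $$ (l, j)))"
    using mat_mult_index_sum[OF c ij] by simp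
  also have "\<dots> = (\<Sum>l<2 * m. of_real (speta m i * speta m j) * (U $$ (spbar m i, spbar m l) * V $$ (spbar m l, spbar m j)))"
  proof (intro sum.cong refl)
    fix l assume "l \<in> {..<2 * m}"
    then have l: "l < 2 * m" by simp
    have "complex_of_real (speta m i * speta m l) * of_real (speta m l * speta m j)
        = of_real (speta m i * speta m j * (speta m l * speta m l))"
      by (simp only: of_real_mult mult_ac)
    moreover have "(a * u) * (b * v) = (a * b) * (u * v)" for a b u v :: complex
      by (simp only: mult_ac)
    ultimately show "cnj (U $$ (i, l)) * cnj (V $$ (l, j))
      = of_real (speta m i * speta m j) * (U $$ (spbar m i, spbar m l) * V $$ (spbar m l, spbar m j))"
      unfolding symplectic_cnj[OF assms(1) ij(1) l] symplectic_cnj[OF assms(2) l ij(2)]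
      by (simp only: speta_square mult_1_right)
  qed
  also have "\<dots> = of_real (speta m i * speta m j) * (\<Sum>l<2 * m. U $$ (spbar m i, l) * V $$ (l, spbar m j))"
    unfolding sum_distrib_left
    by (rule sum.reindex_bij_witness[of _ "spbar m" "spbar m"]) (auto simp: spbar_spbar spbar_less)
  also have "(\<Sum>l<2 * m. U $$ (spbar m i, l) * V $$ (l, spbar m j)) = (U * V) $$ (spbar m i, spbar m j)"
    using mat_mult_index_sum[OF c spbar_less[OF ij(1)] spbar_less[OF ij(2)]] by simp
  finally show "cnj ((U * V) $$ (i, j)) = of_real (speta m i * speta m j) * (U * V) $$ (spbar m i, spbar m j)" .
qed

text \<open>In the plane of a row and its own partner a single rotation is symplectic, since real 2
  by 2 rotations commute with the 2 by 2 block of J.\<close>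

lemma symplectic_plane_rot:
  assumes "k < 2 * m" "c\<^sup>2 + s\<^sup>2 = 1"
  shows "plane_rot (2 * m) (spbar m k) k c s \<in> symplectic_group (2 * m)"
  unfolding symplectic_iff
proof (intro conjI allI impI)
  show "plane_rot (2 * m) (spbar m k) k c s \<in> unitary_group (2 * m)"
    using assms spbar_less spbar_neq by (intro plane_rot_unitary) auto
  fix i j assume ij: "i < 2 * m" "j < 2 * m"
  have eqs: "spbar m z = k \<longleftrightarrow> z = spbar m k" "spbar m z = spbar m w \<longleftrightarrow> z = w" if "z < 2 * m" "w < 2 * m" for z w
    using that spbar_spbar assms(1) by metis+
  have e: "plane_rot (2 * m) (spbar m k) k c s $$ (x, y) = (if x = y then (if x = spbar m k \<or> x = k then of_real c else 1)
     else if x = spbar m k \<and> y = k then of_real s else if x = k \<and> y = spbar m k then - of_real s else 0)"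
    if "x < 2 * m" "y < 2 * m" for x y
    using that by (simp add: plane_rot_def)
  have n: "spbar m k \<noteq> k" using assms(1) by (rule spbar_neq)
  have sq: "complex_of_real (speta m z) * of_real (speta m z) = 1" for z
    unfolding of_real_mult[symmetric] speta_square by simp
  show "cnj (plane_rot (2 * m) (spbar m k) k c s $$ (i, j)) = of_real (speta m i * speta m j) *
      plane_rot (2 * m) (spbar m k) k c s $$ (spbar m i, spbar m j)"
    unfolding e[OF ij] e[OF spbar_less[OF ij(1)] spbar_less[OF ij(2)]]
      eqs(2)[OF ij] eqs(2)[OF ij(1) assms(1)] eqs(2)[OF ij(2) assms(1)] eqs(1)[OF ij] eqs(1)[OF ij(2,1)]
    using n sq[of k] sq[of j] speta_spbar[OF assms(1)] by auto
qed

text \<open>Rotating two rows that are not partners preserves the symplectic relation only together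
  with a rotation of their partners, whose angle carries the sign
  \<open>speta m i * speta m k\<close>.\<close>

definition sp_rot :: "nat \<Rightarrow> nat \<Rightarrow> nat \<Rightarrow> real \<Rightarrow> real \<Rightarrow> complex mat" where
  "sp_rot m i k c s = plane_rot (2 * m) i k c s *
     plane_rot (2 * m) (spbar m i) (spbar m k) c (speta m i * speta m k * s)"

lemma sp_rot_mult:
  assumes i: "i < 2 * m" and k: "k < 2 * m" and ik: "i \<noteq> k" "i \<noteq> spbar m k"
    and U: "U \<in> carrier_mat (2 * m) l" and x: "x < 2 * m" and p: "p < l"
  shows "(sp_rot m i k c s * U) $$ (x, p) =
    (if x = i then of_real c * U $$ (i, p) + of_real s * U $$ (k, p)
     else if x = k then of_real c * U $$ (k, p) - of_real s * U $$ (i, p)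
     else if x = spbar m i then of_real c * U $$ (x, p) + of_real (speta m i * speta m k * s) * U $$ (spbar m k, p)
     else if x = spbar m k then of_real c * U $$ (x, p) - of_real (speta m i * speta m k * s) * U $$ (spbar m i, p)
     else U $$ (x, p))"
proof -
  let ?P = "plane_rot (2 * m) (spbar m i) (spbar m k) c (speta m i * speta m k * s)"
  have b: "spbar m i < 2 * m" "spbar m k < 2 * m" using i k spbar_less by auto
  have ne: "spbar m i \<noteq> spbar m k" "spbar m i \<noteq> i" "spbar m k \<noteq> k" "spbar m i \<noteq> k" "spbar m k \<noteq> i"
    using i k ik spbar_spbar spbar_neq by metis+
  have PU: "?P * U \<in> carrier_mat (2 * m) l" by (rule mult_carrier_mat[OF plane_rot_carrier U])
  have "sp_rot m i k c s * U = plane_rot (2 * m) i k c s * (?P * U)"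
    unfolding sp_rot_def by (rule assoc_mult_mat[OF plane_rot_carrier plane_rot_carrier U])
  then show ?thesis
    using plane_rot_mult[OF PU i k ik(1) x p, of c s] plane_rot_mult[OF U b ne(1) i p, of c "speta m i * speta m k * s"]
      plane_rot_mult[OF U b ne(1) k p, of c "speta m i * speta m k * s"] plane_rot_mult[OF U b ne(1) x p, of c "speta m i * speta m k * s"] ne
    by (auto simp del: index_mult_mat)
qed

lemma sp_rot_rows:
  assumes "i < 2 * m" "k < 2 * m" "i \<noteq> k" "i \<noteq> spbar m k" "U \<in> carrier_mat (2 * m) (2 * m)" "p < 2 * m"
  shows "(sp_rot m i k c s * U) $$ (i, p) = of_real c * U $$ (i, p) + of_real s * U $$ (k, p)"
    "(sp_rot m i k c s * U) $$ (k, p) = of_real c * U $$ (k, p) + of_real s * (- U $$ (i, p))"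
    "(sp_rot m i k c s * U) $$ (spbar m i, p) =
       of_real c * U $$ (spbar m i, p) + of_real s * (of_real (speta m i * speta m k) * U $$ (spbar m k, p))"
    "x < 2 * m \<Longrightarrow> x \<noteq> i \<Longrightarrow> x \<noteq> k \<Longrightarrow> x \<noteq> spbar m i \<Longrightarrow> x \<noteq> spbar m k \<Longrightarrow> (sp_rot m i k c s * U) $$ (x, p) = U $$ (x, p)"
proof -
  have ne: "spbar m i \<noteq> i" "spbar m i \<noteq> k" using assms spbar_spbar spbar_neq by metis+
  note M = sp_rot_mult[OF assms(1-5) _ assms(6), of _ c s]
  show "(sp_rot m i k c s * U) $$ (i, p) = of_real c * U $$ (i, p) + of_real s * U $$ (k, p)"
    unfolding M[OF assms(1)] by simp
  show "(sp_rot m i k c s * U) $$ (k, p) = of_real c * U $$ (k, p) + of_real s * (- U $$ (i, p))"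
    unfolding M[OF assms(2)] using assms(3) by simp
  show "(sp_rot m i k c s * U) $$ (spbar m i, p) =
       of_real c * U $$ (spbar m i, p) + of_real s * (of_real (speta m i * speta m k) * U $$ (spbar m k, p))"
    unfolding M[OF spbar_less[OF assms(1)]] using ne by (simp add: mult_ac)
  show "(sp_rot m i k c s * U) $$ (x, p) = U $$ (x, p)"
    if "x < 2 * m" "x \<noteq> i" "x \<noteq> k" "x \<noteq> spbar m i" "x \<noteq> spbar m k"
    unfolding M[OF that(1)] using that by simp
qed

lemma sp_rot_symplectic:
  assumes i: "i < 2 * m" and k: "k < 2 * m" and ik: "i \<noteq> k" "i \<noteq> spbar m k" and cs: "c\<^sup>2 + s\<^sup>2 = 1"
  shows "sp_rot m i k c s \<in> symplectic_group (2 * m)"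
  unfolding symplectic_iff
proof (intro conjI allI impI)
  have b: "spbar m i < 2 * m" "spbar m k < 2 * m" using i k spbar_less by auto
  have ne: "spbar m i \<noteq> spbar m k" "spbar m i \<noteq> i" "spbar m k \<noteq> k" "spbar m i \<noteq> k" "spbar m k \<noteq> i"
    using i k ik spbar_spbar spbar_neq by metis+
  have "(speta m i * speta m k * s)\<^sup>2 = s\<^sup>2" by (simp add: speta_def power_mult_distrib)
  then show "sp_rot m i k c s \<in> unitary_group (2 * m)"
    unfolding sp_rot_def using i k ik b ne cs by (intro unitary_group_mult plane_rot_unitary) auto
  have c: "sp_rot m i k c s \<in> carrier_mat (2 * m) (2 * m)"
    unfolding sp_rot_def by (rule mult_carrier_mat[OF plane_rot_carrier plane_rot_carrier])
  define \<sigma> where "\<sigma> = speta m i * speta m k"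
  have M: "sp_rot m i k c s $$ (x, y) = (sp_rot m i k c s * 1\<^sub>m (2 * m)) $$ (x, y)" for x y
    using c by simp
  have o: "1\<^sub>m (2 * m) $$ (a, y) = (if y = a then 1 else 0 :: complex)" if "a < 2 * m" "y < 2 * m" for a y
    using that by auto
  have r: "sp_rot m i k c s $$ (i, y) = (if y = i then of_real c else if y = k then of_real s else 0)"
    "sp_rot m i k c s $$ (k, y) = (if y = k then of_real c else if y = i then - of_real s else 0)"
    "sp_rot m i k c s $$ (spbar m i, y) = (if y = spbar m i then of_real c else if y = spbar m k then of_real (\<sigma> * s) else 0)"
    "sp_rot m i k c s $$ (spbar m k, y) = (if y = spbar m k then of_real c else if y = spbar m i then - of_real (\<sigma> * s) else 0)"
    if y: "y < 2 * m" for y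
    unfolding M sp_rot_mult[OF i k ik one_carrier_mat i y] sp_rot_mult[OF i k ik one_carrier_mat k y]
      sp_rot_mult[OF i k ik one_carrier_mat b(1) y] sp_rot_mult[OF i k ik one_carrier_mat b(2) y]
      o[OF i y] o[OF k y] o[OF b(1) y] o[OF b(2) y]
    using ne ik by (simp_all add: \<sigma>_def)
  have r5: "sp_rot m i k c s $$ (x, y) = (if x = y then 1 else 0)"
    if "x < 2 * m" "y < 2 * m" "x \<noteq> i" "x \<noteq> k" "x \<noteq> spbar m i" "x \<noteq> spbar m k" for x y
    unfolding M sp_rot_mult[OF i k ik one_carrier_mat that(1,2)] o[OF that(1,2)] using that by simp
  fix x y assume xy: "x < 2 * m" "y < 2 * m"
  have bxy: "spbar m x < 2 * m" "spbar m y < 2 * m" using xy spbar_less by auto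
  have inv: "spbar m z = w \<longleftrightarrow> z = spbar m w" if "z < 2 * m" "w < 2 * m" for z w
    using that spbar_spbar by metis
  have bij: "spbar m y = spbar m w \<longleftrightarrow> y = w" if "w < 2 * m" for w
    using that xy(2) spbar_spbar by metis
  note inv' = inv[OF xy(2) i] inv[OF xy(2) k]
  have et: "speta m (spbar m i) = - speta m i" "speta m (spbar m k) = - speta m k"
    using i k speta_spbar by auto
  consider "x = i" | "x = k" | "x = spbar m i" | "x = spbar m k"
    | "x \<noteq> i" "x \<noteq> k" "x \<noteq> spbar m i" "x \<noteq> spbar m k" by blast
  then show "cnj (sp_rot m i k c s $$ (x, y)) = of_real (speta m x * speta m y) * sp_rot m i k c s $$ (spbar m x, spbar m y)"
  proof cases
    case 1
    show ?thesis unfolding 1 r(1)[OF xy(2)] r(3)[OF bxy(2)] bij[OF i] bij[OF k] by (auto simp: \<sigma>_def speta_def)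
  next
    case 2
    show ?thesis unfolding 2 r(2)[OF xy(2)] r(4)[OF bxy(2)] bij[OF i] bij[OF k] by (auto simp: \<sigma>_def speta_def)
  next
    case 3
    show ?thesis unfolding 3 spbar_spbar[OF i] r(3)[OF xy(2)] r(1)[OF bxy(2)] inv' et \<sigma>_def
      by (auto simp: et) (auto simp: speta_def split: if_splits)
  next
    case 4
    show ?thesis unfolding 4 spbar_spbar[OF k] r(4)[OF xy(2)] r(2)[OF bxy(2)] inv' et \<sigma>_def
      by (auto simp: et) (auto simp: speta_def split: if_splits)
  next
    case 5
    then have "spbar m x \<noteq> i" "spbar m x \<noteq> k" "spbar m x \<noteq> spbar m i" "spbar m x \<noteq> spbar m k"
      using inv[OF xy(1)] i k b xy spbar_spbar by metis+
    moreover have "spbar m x = spbar m y \<longleftrightarrow> x = y" using xy spbar_spbar by metis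
    ultimately show ?thesis using r5[OF xy] r5[OF bxy] 5
      by (simp add: speta_square flip: of_real_mult)
  qed
qed

text \<open>The cost of moving the pair from row k to row i depends on where i and its partner lie.
  For i in A - {k} the column swap survives and the other extra term is killed by a phase. If the
  partner a of i lies in A - {k}, the rotation sends row a to the partner of k; one extra term is
  killed by a phase and the other becomes the crossed moment. In all other cases there is no cost.
  Each a in A - {k} thus contributes once as i = a and once through its partner.\<close>

lemma symplectic_haar_symmetric:
  assumes haar: "haar_prob (2 * m) (symplectic_group (2 * m)) \<mu>"
  shows "haar_symmetric (2 * m) (symplectic_group (2 * m)) \<mu> (spbar m)"
proof -
  let ?d = "2 * m" and ?G = "symplectic_group (2 * m)"
  interpret haar_measure ?d ?G \<mu> using haar symplectic_group_subset by unfold_locales auto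
  interpret involution ?d "spbar m" by (rule involution_spbar)
  have chi: "chi (spbar m) b i = (if i = b then \<i> else if i = spbar m b then - \<i> else 1)" if "b < ?d" for b i
    using spbar_neq[OF that] by (simp add: chi_def)
  have phase: "mat ?d ?d (\<lambda>(i, j). if i = j then chi (spbar m) b i else 0) \<in> ?G" if b: "b < ?d" for b
    unfolding symplectic_iff
  proof (intro conjI allI impI)
    show "mat ?d ?d (\<lambda>(i, j). if i = j then chi (spbar m) b i else 0) \<in> unitary_group ?d"
      by (rule diag_unitary) simp
    fix i j assume ij: "i < ?d" "j < ?d"
    have "spbar m i = spbar m j \<longleftrightarrow> i = j" using ij spbar_spbar by metis
    then show "cnj (mat ?d ?d (\<lambda>(i, j). if i = j then chi (spbar m) b i else 0) $$ (i, j)) =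
       of_real (speta m i * speta m j) * mat ?d ?d (\<lambda>(i, j). if i = j then chi (spbar m) b i else 0) $$ (spbar m i, spbar m j)"
      using ij spbar_less chi_bar[OF ij(1) b] by (auto simp: speta_square simp flip: of_real_mult)
  qed
  show ?thesis
  proof
    fix A k and c c' :: "nat \<Rightarrow> nat"
    assume A: "A \<subseteq> {..<?d}" "inj_on cls A" "k \<in> A" and c: "\<And>a. a \<in> A \<Longrightarrow> c a < ?d" "\<And>a. a \<in> A \<Longrightarrow> c' a < ?d"
    have fA: "finite A" using A finite_subset by blast
    have kd: "k < ?d" using A by auto
    have Ad: "a < ?d" if "a \<in> A" for a using A that by auto
    have nobar: "spbar m a \<notin> A" if "a \<in> A" for a
    proof
      assume "spbar m a \<in> A"
      moreover have "cls (spbar m a) = cls a" using Ad[OF that] spbar_less by (simp add: cls_eq_iff)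
      ultimately have "spbar m a = a" using inj_onD[OF A(2)] that by blast
      then show False using spbar_neq[OF Ad[OF that]] by simp
    qed
    let ?z1 = "\<lambda>a. cmod (moment A (c(a := c k, k := c a)) c')"
    let ?z2 = "\<lambda>a. cmod (moment A (c(k := spbar m (c' a))) (c'(a := spbar m (c k))))"
    let ?Z = "\<lambda>i. (if i \<in> A - {k} then ?z1 i else 0) + (if spbar m i \<in> A - {k} then ?z2 (spbar m i) else 0)"
    have "cmod (of_nat ?d * moment A c c' - (if c k = c' k then moment (A - {k}) c c' else 0)) \<le> (\<Sum>i<?d. ?Z i)"
    proof (rule moment_recursion_of_rows[OF fA A(1,3) c])
      fix i assume i: "i < ?d"
      let ?e = "\<integral>U. U $$ (i, c k) * cnj (U $$ (i, c' k)) * (\<Prod>a\<in>A - {k}. U $$ (a, c a) * cnj (U $$ (a, c' a))) \<partial>\<mu>"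
      have Znn: "0 \<le> ?Z i" by simp
      \<comment> \<open>The phase matrix at a multiplies row a by the imaginary unit and its partner
        by the conjugate. The partner is not in A, so the remaining rows of A keep phase 1, and
        \<open>ch\<close> says that the moved entries together acquire -1.\<close>
      have third_zero: "(\<integral>U. U $$ (j1, p1) * cnj (U $$ (k, p2)) * U $$ (j2, p3) * cnj (U $$ (j3, p4)) *
          (\<Prod>x\<in>A - {a, k}. U $$ (x, c x) * cnj (U $$ (x, c' x))) \<partial>\<mu>) = 0"
        if a: "a \<in> A" "a \<noteq> k" and j: "j1 < ?d" "j2 < ?d" "j3 < ?d" and p: "p1 < ?d" "p2 < ?d" "p3 < ?d" "p4 < ?d"
          and ch: "chi (spbar m) a j1 * chi (spbar m) a j2 * cnj (chi (spbar m) a j3) = - 1"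
        for a j1 j2 j3 p1 p2 p3 p4
      proof -
        let ?h = "\<lambda>U. \<Prod>x\<in>A - {a, k}. U $$ (x, c x) * cnj (U $$ (x, c' x))"
        let ?f = "\<lambda>U. U $$ (j1, p1) * cnj (U $$ (k, p2)) * U $$ (j2, p3) * cnj (U $$ (j3, p4)) * ?h U"
        let ?D = "mat ?d ?d (\<lambda>(i, j). if i = j then chi (spbar m) a i else 0)"
        have ad: "a < ?d" using Ad a by blast
        have one: "chi (spbar m) a x = 1" if "x \<in> A" "x \<noteq> a" for x
          using that a nobar[OF a(1)] by (auto simp: chi[OF ad])
        show ?thesis
        proof (rule integral_zero_by_phase[OF phase[OF ad], where \<zeta> = "- 1"])
          have bh: "bm ?h" using A c by (intro bm_intros) auto
          show "bm ?f" by (intro bm_mult bm_cnj bm_entry bh j p kd)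
          fix U :: "complex mat" assume U: "U \<in> carrier_mat ?d ?d"
          have h: "?h (?D * U) = ?h U"
          proof (intro prod.cong refl)
            fix x assume x: "x \<in> A - {a, k}"
            then have "x < ?d" "c x < ?d" "c' x < ?d" "chi (spbar m) a x = 1" using Ad c one by auto
            then show "(?D * U) $$ (x, c x) * cnj ((?D * U) $$ (x, c' x)) = U $$ (x, c x) * cnj (U $$ (x, c' x))"
              by (simp add: diag_mult_index[OF U])
          qed
          have r: "(?D * U) $$ (j1, p1) = chi (spbar m) a j1 * U $$ (j1, p1)" "(?D * U) $$ (j2, p3) = chi (spbar m) a j2 * U $$ (j2, p3)"
            "(?D * U) $$ (j3, p4) = chi (spbar m) a j3 * U $$ (j3, p4)" "(?D * U) $$ (k, p2) = U $$ (k, p2)"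
            using j p kd one[OF A(3)] a by (simp_all add: diag_mult_index[OF U])
          have "(x1 * u1) * u2 * (x2 * u3) * (cnj x3 * u4) * w = (x1 * x2 * cnj x3) * (u1 * u2 * u3 * u4 * w)"
            for x1 x2 x3 u1 u2 u3 u4 w :: complex by (simp only: mult_ac)
          then show "?f (?D * U) = - 1 * ?f U" unfolding h r complex_cnj_mult ch[symmetric] by (simp only:)
        qed simp
      qed
      have "i = spbar m k" if "spbar m i = k" using that spbar_spbar[OF i] by simp
      then consider "i = k" | "i \<in> A - {k}" | "i \<notin> A" "spbar m i \<in> A - {k}" | "i = spbar m k" | "i \<notin> A" "spbar m i \<notin> A"
        by blast
      then show "cmod (?e - moment A c c') \<le> ?Z i"
      proof cases
        case 1
        then have "?e = moment A c c'" using moment_remove[OF fA A(3), of c c'] by simp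
        then show ?thesis using Znn by simp
      next
        case 2
        then have a: "i \<in> A" "i \<noteq> k" by auto
        have ib: "i \<noteq> spbar m k" using nobar[OF A(3)] a by blast
        have e: "?e = moment A c c'
         + of_real 1 * (\<integral>U. U $$ (i, c k) * cnj (U $$ (k, c' k)) * U $$ (k, c i) * cnj (U $$ (i, c' i)) *
            (\<Prod>x\<in>A - {i, k}. U $$ (x, c x) * cnj (U $$ (x, c' x))) \<partial>\<mu>)
         + of_real 1 * (\<integral>U. U $$ (i, c k) * cnj (U $$ (k, c' k)) * U $$ (i, c i) * cnj (U $$ (k, c' i)) *
            (\<Prod>x\<in>A - {i, k}. U $$ (x, c x) * cnj (U $$ (x, c' x))) \<partial>\<mu>)"
        proof (rule row_replacement_occupied[OF fA A(1,3) a i kd c])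
          fix r s :: real assume rs: "r\<^sup>2 + s\<^sup>2 = 1"
          have xs: "x \<noteq> spbar m i" "x \<noteq> spbar m k" "x < ?d" if "x \<in> A" for x
            using that nobar[OF a(1)] nobar[OF A(3)] Ad by metis+
          show "\<exists>g\<in>?G. \<forall>U\<in>carrier_mat ?d ?d. \<forall>p<?d.
           (g * U) $$ (i, p) = of_real r * U $$ (i, p) + of_real s * U $$ (k, p) \<and>
           (g * U) $$ (k, p) = of_real r * U $$ (k, p) + of_real s * (- U $$ (i, p)) \<and>
           (g * U) $$ (i, p) = of_real r * U $$ (i, p) + of_real s * (of_real 1 * U $$ (k, p)) \<and>
           (\<forall>x\<in>A - {i, k}. (g * U) $$ (x, p) = U $$ (x, p))"
          proof (intro bexI[of _ "sp_rot m i k r s"] ballI allI impI)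
            fix U :: "complex mat" and p assume U: "U \<in> carrier_mat ?d ?d" "p < ?d"
            note R = sp_rot_rows[OF i kd a(2) ib U, where c = r and s = s]
            have "(sp_rot m i k r s * U) $$ (x, p) = U $$ (x, p)" if "x \<in> A - {i, k}" for x
              using that by (intro R(4) xs) auto
            moreover have "complex_of_real 1 * U $$ (k, p) = U $$ (k, p)" by simp
            ultimately show "(sp_rot m i k r s * U) $$ (i, p) = of_real r * U $$ (i, p) + of_real s * U $$ (k, p) \<and>
              (sp_rot m i k r s * U) $$ (k, p) = of_real r * U $$ (k, p) + of_real s * (- U $$ (i, p)) \<and>
              (sp_rot m i k r s * U) $$ (i, p) = of_real r * U $$ (i, p) + of_real s * (of_real 1 * U $$ (k, p)) \<and>
              (\<forall>x\<in>A - {i, k}. (sp_rot m i k r s * U) $$ (x, p) = U $$ (x, p))"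
              using R(1,2) by metis
          qed (rule sp_rot_symplectic[OF i kd a(2) ib rs])
        qed
        have "c k < ?d" "c' k < ?d" "c i < ?d" "c' i < ?d" using c a A(3) by auto
        then have z: "(\<integral>U. U $$ (i, c k) * cnj (U $$ (k, c' k)) * U $$ (i, c i) * cnj (U $$ (k, c' i)) *
            (\<Prod>x\<in>A - {i, k}. U $$ (x, c x) * cnj (U $$ (x, c' x))) \<partial>\<mu>) = 0"
          using i kd a nobar[OF a(1)] A(3) by (intro third_zero) (auto simp: chi[OF i])
        have "?e - moment A c c' = moment A (c(i := c k, k := c i)) c'"
          unfolding e z swap_columns_moment[OF fA A(3) a, of c c'] by simp
        then show ?thesis using 2 by simp
      next
        case 3
        let ?a = "spbar m i"
        have a: "?a \<in> A" "?a \<noteq> k" using 3 by auto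
        have ik: "i \<noteq> k" "i \<noteq> spbar m k" using 3 A(3) a kd spbar_spbar by auto
        have ai: "spbar m ?a = i" using i spbar_spbar by blast
        have bk: "spbar m k < ?d" using kd spbar_less by blast
        define \<sigma> where "\<sigma> = speta m i * speta m k"
        have e: "?e = moment A c c'
         + of_real \<sigma> * (\<integral>U. U $$ (i, c k) * cnj (U $$ (k, c' k)) * U $$ (spbar m k, c ?a) * cnj (U $$ (?a, c' ?a)) *
            (\<Prod>x\<in>A - {?a, k}. U $$ (x, c x) * cnj (U $$ (x, c' x))) \<partial>\<mu>)
         + of_real \<sigma> * (\<integral>U. U $$ (i, c k) * cnj (U $$ (k, c' k)) * U $$ (?a, c ?a) * cnj (U $$ (spbar m k, c' ?a)) *
            (\<Prod>x\<in>A - {?a, k}. U $$ (x, c x) * cnj (U $$ (x, c' x))) \<partial>\<mu>)"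
        proof (rule row_replacement_occupied[OF fA A(1,3) a i bk c])
          fix r s :: real assume rs: "r\<^sup>2 + s\<^sup>2 = 1"
          have "x \<noteq> i \<and> x \<noteq> spbar m k \<and> x < ?d" if "x \<in> A" for x
            using that 3(1) nobar[OF A(3)] Ad by metis
          moreover have "?a \<noteq> i" using spbar_neq[OF i] .
          ultimately show "\<exists>g\<in>?G. \<forall>U\<in>carrier_mat ?d ?d. \<forall>p<?d.
           (g * U) $$ (i, p) = of_real r * U $$ (i, p) + of_real s * U $$ (k, p) \<and>
           (g * U) $$ (k, p) = of_real r * U $$ (k, p) + of_real s * (- U $$ (i, p)) \<and>
           (g * U) $$ (?a, p) = of_real r * U $$ (?a, p) + of_real s * (of_real \<sigma> * U $$ (spbar m k, p)) \<and>
           (\<forall>x\<in>A - {?a, k}. (g * U) $$ (x, p) = U $$ (x, p))"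
            using sp_rot_symplectic[OF i kd ik rs] sp_rot_rows[OF i kd ik, where c = r and s = s]
            by (intro bexI[of _ "sp_rot m i k r s"] ballI allI impI conjI) (simp_all add: \<sigma>_def del: index_mult_mat)
        qed
        have lt: "c k < ?d" "c' k < ?d" "c ?a < ?d" "c' ?a < ?d" using c a A(3) by auto
        have ad: "?a < ?d" using Ad a by blast
        have bka: "spbar m k \<noteq> ?a" "spbar m k \<noteq> i" using ik nobar[OF A(3)] a by auto
        have z: "(\<integral>U. U $$ (i, c k) * cnj (U $$ (k, c' k)) * U $$ (spbar m k, c ?a) * cnj (U $$ (?a, c' ?a)) *
            (\<Prod>x\<in>A - {?a, k}. U $$ (x, c x) * cnj (U $$ (x, c' x))) \<partial>\<mu>) = 0"
          using lt i bk ad a bka spbar_neq[OF i] by (intro third_zero) (auto simp: chi[OF ad] ai)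
        let ?h = "\<lambda>U. \<Prod>x\<in>A - {?a, k}. U $$ (x, c x) * cnj (U $$ (x, c' x))"
        let ?q = "spbar m (c' ?a)" and ?p = "spbar m (c k)"
        have pq: "?q < ?d" "?p < ?d" using lt spbar_less by auto
        define \<tau> where "\<tau> = speta m i * speta m (c k) * (speta m (spbar m k) * speta m (c' ?a))"
        \<comment> \<open>The symplectic relation turns the entry in row i into a conjugated entry
          of its partner row a, and the conjugated entry in the partner of k into a plain entry of
          row k. The signs collect in \<tau>.\<close>
        have "(\<integral>U. U $$ (i, c k) * cnj (U $$ (k, c' k)) * U $$ (?a, c ?a) * cnj (U $$ (spbar m k, c' ?a)) * ?h U \<partial>\<mu>)
          = (\<integral>U. of_real \<tau> * ((U $$ (?a, c ?a) * cnj (U $$ (?a, ?p))) * (U $$ (k, ?q) * cnj (U $$ (k, c' k))) * ?h U) \<partial>\<mu>)"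
        proof (rule integral_cong_AE)
          have bh: "bm ?h" using A c by (intro bm_intros) auto
          show "(\<lambda>U. U $$ (i, c k) * cnj (U $$ (k, c' k)) * U $$ (?a, c ?a) * cnj (U $$ (spbar m k, c' ?a)) * ?h U) \<in> borel_measurable \<mu>"
            by (intro bm_measurable bm_mult bm_cnj bm_entry bh lt i ad bk kd)
          show "(\<lambda>U. of_real \<tau> * ((U $$ (?a, c ?a) * cnj (U $$ (?a, ?p))) * (U $$ (k, ?q) * cnj (U $$ (k, c' k))) * ?h U)) \<in> borel_measurable \<mu>"
            by (intro bm_measurable bm_mult bm_const bm_cnj bm_entry bh lt pq i ad bk kd)
          show "AE U in \<mu>. U $$ (i, c k) * cnj (U $$ (k, c' k)) * U $$ (?a, c ?a) * cnj (U $$ (spbar m k, c' ?a)) * ?h U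
            = of_real \<tau> * ((U $$ (?a, c ?a) * cnj (U $$ (?a, ?p))) * (U $$ (k, ?q) * cnj (U $$ (k, c' k))) * ?h U)"
            using AE_in_group
          proof eventually_elim
            case (elim U)
            have "cnj (cnj (U $$ (i, c k))) = cnj (of_real (speta m i * speta m (c k)) * U $$ (?a, ?p))"
              using symplectic_cnj[OF elim i lt(1)] by simp
            then have 1: "U $$ (i, c k) = of_real (speta m i * speta m (c k)) * cnj (U $$ (?a, ?p))" by simp
            have 2: "cnj (U $$ (spbar m k, c' ?a)) = of_real (speta m (spbar m k) * speta m (c' ?a)) * U $$ (k, ?q)"
              using symplectic_cnj[OF elim bk lt(4)] spbar_spbar[OF kd] by simp
            have "(x1 * u1) * u2 * u3 * (x2 * u4) * w = (x1 * x2) * ((u3 * u1) * (u4 * u2) * w)"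
              for x1 x2 u1 u2 u3 u4 w :: complex by (simp only: mult_ac)
            then show ?case unfolding 1 2 \<tau>_def of_real_mult[of "speta m i * speta m (c k)"] by (simp only:)
          qed
        qed
        also have "\<dots> = of_real \<tau> * moment A (c(k := ?q)) (c'(?a := ?p))"
        proof -
          have "(\<Prod>x\<in>A - {?a, k}. U $$ (x, (c(k := ?q)) x) * cnj (U $$ (x, (c'(?a := ?p)) x))) = ?h U" for U
            by (intro prod.cong) auto
          then have "moment A (c(k := ?q)) (c'(?a := ?p))
            = (\<integral>U. (U $$ (?a, c ?a) * cnj (U $$ (?a, ?p))) * (U $$ (k, ?q) * cnj (U $$ (k, c' k))) * ?h U \<partial>\<mu>)"
            unfolding moment_remove_two[OF fA a(1) A(3) a(2)] using a(2) by simp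
          then show ?thesis by simp
        qed
        finally have w: "(\<integral>U. U $$ (i, c k) * cnj (U $$ (k, c' k)) * U $$ (?a, c ?a) * cnj (U $$ (spbar m k, c' ?a)) * ?h U \<partial>\<mu>)
          = of_real \<tau> * moment A (c(k := ?q)) (c'(?a := ?p))" .
        have "?e - moment A c c' = of_real \<sigma> * (of_real \<tau> * moment A (c(k := ?q)) (c'(?a := ?p)))"
          unfolding e z w by simp
        moreover have "\<bar>\<sigma>\<bar> = 1" "\<bar>\<tau>\<bar> = 1" by (auto simp: \<sigma>_def \<tau>_def speta_def abs_mult)
        ultimately have "cmod (?e - moment A c c') = ?z2 ?a" by (simp add: norm_mult)
        then show ?thesis using 3 by simp
      next
        case 4
        have ik: "spbar m k \<noteq> k" using spbar_neq[OF kd] .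
        have "?e = moment A c c'"
        proof (rule row_replacement_free[OF fA A(1,3) i c])
          fix r s :: real assume rs: "r\<^sup>2 + s\<^sup>2 = 1"
          have "A - {k} \<subseteq> {..<?d}" "spbar m k \<notin> A - {k}" using A nobar[OF A(3)] by auto
          then show "\<exists>g\<in>?G. \<forall>U\<in>carrier_mat ?d ?d. \<forall>p<?d.
           (g * U) $$ (i, p) = of_real r * U $$ (i, p) + of_real s * U $$ (k, p) \<and>
           (g * U) $$ (k, p) = of_real r * U $$ (k, p) + of_real s * (- U $$ (i, p)) \<and>
           (\<forall>x\<in>A - {k}. (g * U) $$ (x, p) = U $$ (x, p))"
            using plane_rot_rows[OF spbar_less[OF kd] kd ik, of "A - {k}"] symplectic_plane_rot[OF kd rs] 4
            by (intro bexI[of _ "plane_rot ?d (spbar m k) k r s"] ballI allI impI) simp_all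
        qed
        then show ?thesis using Znn by simp
      next
        case 5
        then have ik: "i \<noteq> k" "i \<noteq> spbar m k" using A(3) kd spbar_spbar by auto
        have "?e = moment A c c'"
        proof (rule row_replacement_free[OF fA A(1,3) i c])
          fix r s :: real assume rs: "r\<^sup>2 + s\<^sup>2 = 1"
          have "x \<noteq> i \<and> x \<noteq> spbar m i \<and> x \<noteq> spbar m k \<and> x < ?d" if "x \<in> A" for x
            using that 5 nobar[OF A(3)] Ad by metis
          then show "\<exists>g\<in>?G. \<forall>U\<in>carrier_mat ?d ?d. \<forall>p<?d.
           (g * U) $$ (i, p) = of_real r * U $$ (i, p) + of_real s * U $$ (k, p) \<and>
           (g * U) $$ (k, p) = of_real r * U $$ (k, p) + of_real s * (- U $$ (i, p)) \<and>
           (\<forall>x\<in>A - {k}. (g * U) $$ (x, p) = U $$ (x, p))"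
            using sp_rot_symplectic[OF i kd ik rs] sp_rot_rows[OF i kd ik, where c = r and s = s]
            by (intro bexI[of _ "sp_rot m i k r s"] ballI allI impI conjI) (simp_all del: index_mult_mat)
        qed
        then show ?thesis using Znn by simp
      qed
    qed
    also have "\<dots> = (\<Sum>i<?d. if i \<in> A - {k} then ?z1 i else 0) + (\<Sum>i<?d. if spbar m i \<in> A - {k} then ?z2 (spbar m i) else 0)"
      by (rule sum.distrib)
    also have "(\<Sum>i<?d. if spbar m i \<in> A - {k} then ?z2 (spbar m i) else 0) = (\<Sum>i<?d. if i \<in> A - {k} then ?z2 i else 0)"
      by (rule sum.reindex_bij_witness[of _ "spbar m" "spbar m"]) (auto simp: spbar_spbar spbar_less)
    also have "(\<Sum>i<?d. if i \<in> A - {k} then ?z1 i else 0) = (\<Sum>a\<in>A - {k}. ?z1 a)"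
      using A by (intro sum.mono_neutral_cong_right) auto
    also have "(\<Sum>i<?d. if i \<in> A - {k} then ?z2 i else 0) = (\<Sum>a\<in>A - {k}. ?z2 a)"
      using A by (intro sum.mono_neutral_cong_right) auto
    finally show "cmod (of_nat ?d * moment A c c' - (if c k = c' k then moment (A - {k}) c c' else 0))
      \<le> (\<Sum>a\<in>A - {k}. ?z1 a + ?z2 a)" by (simp only: sum.distrib)
  qed (rule phase)
qed

section \<open>Products of linear forms\<close>

definition flat_mat :: "nat \<Rightarrow> (nat \<Rightarrow> real) \<Rightarrow> complex mat" where
  "flat_mat p \<epsilon> = mat (2 * 2 ^ p) (2 * 2 ^ p) (\<lambda>(i, b). of_real (flat_rot p \<epsilon> i b))"

lemma flat_mat_carrier: "flat_mat p \<epsilon> \<in> carrier_mat (2 * 2 ^ p) (2 * 2 ^ p)"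
  by (simp add: flat_mat_def)

lemma flat_mat_orthogonal:
  assumes e: "\<And>i. \<epsilon> i = 1 \<or> \<epsilon> i = -1"
  shows "flat_mat p \<epsilon> \<in> orthogonal_group (2 * 2 ^ p)"
proof -
  let ?d = "2 * 2 ^ p :: nat" and ?R = "flat_mat p \<epsilon>"
  have c: "?R \<in> carrier_mat ?d ?d" "adj ?R \<in> carrier_mat ?d ?d" using flat_mat_carrier by auto
  have "adj ?R * ?R = 1\<^sub>m ?d"
  proof (rule eq_matI)
    fix x y assume "x < dim_row (1\<^sub>m ?d :: complex mat)" "y < dim_col (1\<^sub>m ?d :: complex mat)"
    then have xy: "x < ?d" "y < ?d" by auto
    have "(adj ?R * ?R) $$ (x, y) = (\<Sum>l<?d. of_real (flat_rot p \<epsilon> l x * flat_rot p \<epsilon> l y))"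
      unfolding mat_mult_index_sum[OF c(2,1) xy] using xy
      by (intro sum.cong refl) (simp add: adj_index[OF c(1)], simp add: flat_mat_def)
    also have "\<dots> = of_real (if x = y then 1 else 0)"
      unfolding of_real_sum[symmetric] flat_rot_orthonormal_rows[OF e xy] by simp
    finally show "(adj ?R * ?R) $$ (x, y) = 1\<^sub>m ?d $$ (x, y)" using xy by simp
  qed (auto simp: adj_def flat_mat_def)
  moreover have "?R * adj ?R = 1\<^sub>m ?d"
  proof (rule eq_matI)
    fix x y assume "x < dim_row (1\<^sub>m ?d :: complex mat)" "y < dim_col (1\<^sub>m ?d :: complex mat)"
    then have xy: "x < ?d" "y < ?d" by auto
    have "(?R * adj ?R) $$ (x, y) = (\<Sum>l<?d. of_real (flat_rot p \<epsilon> x l * flat_rot p \<epsilon> y l))"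
      unfolding mat_mult_index_sum[OF c xy] using xy
      by (intro sum.cong refl) (simp add: adj_index[OF c(1)], simp add: flat_mat_def)
    also have "\<dots> = of_real (if x = y then 1 else 0)"
      unfolding of_real_sum[symmetric] flat_rot_orthonormal_cols[OF e xy] by simp
    finally show "(?R * adj ?R) $$ (x, y) = 1\<^sub>m ?d $$ (x, y)" using xy by simp
  qed (auto simp: adj_def flat_mat_def)
  moreover have "transpose_mat ?R = adj ?R"
    by (rule eq_matI) (auto simp: flat_mat_def adj_def)
  ultimately show ?thesis using c by (simp add: orthogonal_group_def unitary_group_def)
qed

text \<open>The matrix is real with two equal diagonal blocks. Its entries vanish unless both
  indices lie in the same half, and there the two signs \<open>speta\<close> agree. This is the
  reason for two blocks of half size in place of one Hadamard matrix of size d.\<close>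

lemma flat_mat_symplectic:
  assumes e: "\<And>i. \<epsilon> i = 1 \<or> \<epsilon> i = -1"
  shows "flat_mat p \<epsilon> \<in> symplectic_group (2 * 2 ^ p)"
  unfolding symplectic_iff
proof (intro conjI allI impI)
  show "flat_mat p \<epsilon> \<in> unitary_group (2 * 2 ^ p)"
    by (rule subsetD[OF orthogonal_group_subset flat_mat_orthogonal]) (rule e)
  let ?m = "2 ^ p :: nat"
  fix i j assume ij: "i < 2 * ?m" "j < 2 * ?m"
  have b: "spbar ?m x mod ?m = x mod ?m" "spbar ?m x div ?m = 1 - x div ?m" "x div ?m = (if x < ?m then 0 else 1)"
    if "x < 2 * ?m" for x
  proof -
    have m: "0 < ?m" by simp
    have "x div ?m = (if x < ?m then 0 else 1) \<and> spbar ?m x mod ?m = x mod ?m \<and> spbar ?m x div ?m = 1 - x div ?m"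
    proof (cases "x < ?m")
      case True
      then show ?thesis by (simp add: spbar_def)
    next
      case False
      then have "x - ?m < ?m" "?m \<le> x" using that by auto
      then show ?thesis using le_div_geq[OF m, of x] le_mod_geq[of ?m x] by (simp add: spbar_def)
    qed
    then show "x div ?m = (if x < ?m then 0 else 1)" "spbar ?m x mod ?m = x mod ?m" "spbar ?m x div ?m = 1 - x div ?m"
      by blast+
  qed
  have "flat_rot p \<epsilon> (spbar ?m i) (spbar ?m j) = flat_rot p \<epsilon> i j"
    unfolding flat_rot_def b(1,2)[OF ij(1)] b(1,2)[OF ij(2)] using b(3)[OF ij(1)] b(3)[OF ij(2)] by simp
  moreover have "speta ?m i * speta ?m j * flat_rot p \<epsilon> i j = flat_rot p \<epsilon> i j"
    unfolding flat_rot_def using b(3)[OF ij(1)] b(3)[OF ij(2)] by (simp add: speta_def)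
  ultimately show "cnj (flat_mat p \<epsilon> $$ (i, j)) = of_real (speta ?m i * speta ?m j) * flat_mat p \<epsilon> $$ (spbar ?m i, spbar ?m j)"
    using ij spbar_less by (simp add: flat_mat_def flip: of_real_mult)
qed

lemma orthogonal_group_mult:
  assumes "U \<in> orthogonal_group d" "V \<in> orthogonal_group d"
  shows "U * V \<in> orthogonal_group d"
proof -
  have u: "U \<in> unitary_group d" "V \<in> unitary_group d" using assms orthogonal_group_subset by auto
  have c: "U \<in> carrier_mat d d" "V \<in> carrier_mat d d" using u unitary_group_carrier by auto
  have "transpose_mat (U * V) = adj (U * V)"
  proof (rule eq_matI)
    fix i j assume "i < dim_row (adj (U * V))" "j < dim_col (adj (U * V))"
    then have ij: "i < d" "j < d" using c by (auto simp: adj_def)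
    have "cnj ((U * V) $$ (j, i)) = (U * V) $$ (j, i)"
      unfolding mat_mult_index_sum[OF c ij(2,1)] cnj_sum complex_cnj_mult using ij
      by (intro sum.cong refl) (simp add: orthogonal_real[OF assms(1)] orthogonal_real[OF assms(2)])
    then show "transpose_mat (U * V) $$ (i, j) = adj (U * V) $$ (i, j)"
      using c ij adj_index[of "U * V" d d i j] by (simp del: index_mult_mat(1))
  qed (use c in \<open>auto simp: adj_def\<close>)
  then show ?thesis using unitary_group_mult[OF u] by (simp add: orthogonal_group_def)
qed

lemma sum_swap_pairs:
  "(\<Sum>i\<in>A. \<Sum>j\<in>B. \<Sum>b\<in>C. \<Sum>q\<in>D. f i j b q) = (\<Sum>b\<in>C. \<Sum>q\<in>D. \<Sum>i\<in>A. \<Sum>j\<in>B. f i j b q)"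
proof -
  have "(\<Sum>i\<in>A. \<Sum>j\<in>B. \<Sum>b\<in>C. \<Sum>q\<in>D. f i j b q) = (\<Sum>x\<in>A \<times> B. \<Sum>y\<in>C \<times> D. f (fst x) (snd x) (fst y) (snd y))"
    by (simp add: sum.cartesian_product' )
  also have "\<dots> = (\<Sum>y\<in>C \<times> D. \<Sum>x\<in>A \<times> B. f (fst x) (snd x) (fst y) (snd y))"
    by (rule sum.swap)
  finally show ?thesis by (simp add: sum.cartesian_product')
qed

text \<open>The terms come from the diagonal Gram entries, from the off-diagonal ones, and from the
  discarded monomials with two entries in the same row or column class.\<close>

definition path_error :: "real \<Rightarrow> real \<Rightarrow> real" where
  "path_error T d = 2 * T\<^sup>2 / d + 4 * T * sqrt (2 * T / d)
     + 4 * T\<^sup>2 * (4 * (ln (4 * T * d\<^sup>2) + 1/2)\<^sup>2 / d)"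

text \<open>With flattening matrices L and R, substituting L U for U and setting W = U R replaces
  each form N by the flat form L^T N R in W. Left invariance absorbs L; R is absorbed by passing to
  the law \<nu> of W, to which the bound for flat forms is applied. For this purpose
  \<open>sym\<close> ranges over all Haar probabilities.\<close>

lemma product_lower_bound:
  fixes N :: "nat \<Rightarrow> nat \<Rightarrow> nat \<Rightarrow> complex" and p T :: nat
  defines "d \<equiv> 2 * 2 ^ p"
  assumes haar: "haar_prob d G \<mu>" and sub: "G \<subseteq> unitary_group d"
    and sym: "\<And>\<nu>. haar_prob d G \<nu> \<Longrightarrow> haar_symmetric d G \<nu> bar"
    and mult: "\<And>U V. U \<in> G \<Longrightarrow> V \<in> G \<Longrightarrow> U * V \<in> G"
    and flat: "\<And>\<epsilon>. (\<And>i. \<epsilon> i = 1 \<or> \<epsilon> i = (-1::real)) \<Longrightarrow> flat_mat p \<epsilon> \<in> G"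
    and T: "T > 0" "path_error T d \<le> 1 / 2"
  shows "(1 - path_error T d) * (\<Prod>t<T. (\<Sum>i<d. \<Sum>j<d. (cmod (N t i j))\<^sup>2) / d)
    \<le> (\<integral>U. (\<Prod>t<T. (cmod (\<Sum>i<d. \<Sum>j<d. N t i j * U $$ (i, j)))\<^sup>2) \<partial>\<mu>)"
proof -
  define u where "u = ln (4 * real T * (real d)\<^sup>2) + 1/2"
  define s where "s t = (\<Sum>i<d. \<Sum>j<d. (cmod (N t i j))\<^sup>2)" for t
  obtain \<epsilon> \<delta> where e: "\<And>i. \<epsilon> i = 1 \<or> \<epsilon> i = -1" and dl: "\<And>i. \<delta> i = 1 \<or> \<delta> i = -1" and
    fl: "\<forall>t<T. let N' = (\<lambda>b q. \<Sum>i<d. \<Sum>j<d. of_real (flat_rot p \<epsilon> i b) * N t i j * of_real (flat_rot p \<delta> j q));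
         s = (\<Sum>i<d. \<Sum>j<d. (cmod (N t i j))\<^sup>2) in
       (\<Sum>b<d. \<Sum>q<d. (cmod (N' b q))\<^sup>2) = s \<and>
       (\<forall>b<d. (\<Sum>q<d. (cmod (N' b q))\<^sup>2) \<le> u\<^sup>2 / 2 ^ p * s) \<and>
       (\<forall>q<d. (\<Sum>b<d. (cmod (N' b q))\<^sup>2) \<le> u\<^sup>2 / 2 ^ p * s)"
    using exists_flattening[OF T(1), of p N] unfolding d_def u_def by blast
  define N' where "N' t b q = (\<Sum>i<d. \<Sum>j<d. of_real (flat_rot p \<epsilon> i b) * N t i j * of_real (flat_rot p \<delta> j q))" for t b q
  have tot: "(\<Sum>b<d. \<Sum>q<d. (cmod (N' t b q))\<^sup>2) = s t"
    and row: "b < d \<Longrightarrow> (\<Sum>q<d. (cmod (N' t b q))\<^sup>2) \<le> u\<^sup>2 / 2 ^ p * s t"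
    and col: "b < d \<Longrightarrow> (\<Sum>q<d. (cmod (N' t q b))\<^sup>2) \<le> u\<^sup>2 / 2 ^ p * s t" if "t < T" for t b
    using fl that unfolding Let_def N'_def s_def by blast+
  let ?L = "flat_mat p \<epsilon>" and ?R = "flat_mat p \<delta>"
  have LG: "?L \<in> G" "?R \<in> G" using flat[OF e] flat[OF dl] by auto
  interpret haar_measure d G \<mu> using haar sub by unfold_locales
  define \<nu> where "\<nu> = distr \<mu> \<mu> (\<lambda>U. U * ?R)"
  have \<nu>: "haar_prob d G \<nu>" unfolding \<nu>_def by (rule haar_right_translate[OF LG(2)]) (rule mult[OF _ LG(2)])
  interpret \<nu>: haar_symmetric d G \<nu> bar using sym[OF \<nu>] .
  define F where "F U = (\<Prod>t<T. (cmod (\<Sum>i<d. \<Sum>j<d. N t i j * U $$ (i, j)))\<^sup>2)" for U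
  define F' where "F' W = (\<Prod>t<T. (cmod (\<Sum>e\<in>\<nu>.edges. N' t (fst e) (snd e) * W $$ e))\<^sup>2)" for W
  have bF: "bm F" unfolding F_def[abs_def] by (intro bm_prod bm_norm_square bm_sum bm_mult bm_const bm_entry) auto
  have bF': "F' \<in> borel_measurable \<mu>"
  proof -
    have "bm F'" unfolding F'_def[abs_def]
      by (intro bm_prod bm_norm_square bm_sum bm_mult bm_const) (auto simp: \<nu>.edges_def intro: bm_entry)
    then show ?thesis by (rule bm_measurable)
  qed
  have pt: "F (?L * U) = F' (U * ?R)" if U: "U \<in> carrier_mat d d" for U
  proof -
    have cL: "?L \<in> carrier_mat d d" "?R \<in> carrier_mat d d" using flat_mat_carrier by (auto simp: d_def)
    have Lidx: "(?L * U) $$ (i, j) = (\<Sum>b<d. of_real (flat_rot p \<epsilon> i b) * U $$ (b, j))" if "i < d" "j < d" for i j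
      unfolding mat_mult_index_sum[OF cL(1) U that] using that by (intro sum.cong refl) (simp add: flat_mat_def d_def)
    have Uidx: "U $$ (b, j) = (\<Sum>q<d. (U * ?R) $$ (b, q) * of_real (flat_rot p \<delta> j q))" if bj: "b < d" "j < d" for b j
    proof -
      have "(\<Sum>q<d. (U * ?R) $$ (b, q) * of_real (flat_rot p \<delta> j q))
        = (\<Sum>q<d. \<Sum>l<d. U $$ (b, l) * of_real (flat_rot p \<delta> l q * flat_rot p \<delta> j q))"
      proof (intro sum.cong refl)
        fix q assume "q \<in> {..<d}"
        then have q: "q < d" by simp
        show "(U * ?R) $$ (b, q) * of_real (flat_rot p \<delta> j q) = (\<Sum>l<d. U $$ (b, l) * of_real (flat_rot p \<delta> l q * flat_rot p \<delta> j q))"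
          unfolding mat_mult_index_sum[OF U cL(2) bj(1) q] sum_distrib_right
          using q by (intro sum.cong refl) (simp add: flat_mat_def d_def)
      qed
      also have "\<dots> = (\<Sum>l<d. U $$ (b, l) * of_real (\<Sum>q<d. flat_rot p \<delta> l q * flat_rot p \<delta> j q))"
        by (subst sum.swap) (simp only: of_real_sum sum_distrib_left)
      also have "\<dots> = (\<Sum>l<d. if l = j then U $$ (b, l) else 0)"
        using bj flat_rot_orthonormal_cols[OF dl] by (intro sum.cong refl) (simp add: d_def)
      finally show ?thesis using bj by simp
    qed
    have "(\<Sum>i<d. \<Sum>j<d. N t i j * (?L * U) $$ (i, j)) = (\<Sum>e\<in>\<nu>.edges. N' t (fst e) (snd e) * (U * ?R) $$ e)" for t
    proof -
      have "(\<Sum>i<d. \<Sum>j<d. N t i j * (?L * U) $$ (i, j))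
        = (\<Sum>i<d. \<Sum>j<d. \<Sum>b<d. \<Sum>q<d. (of_real (flat_rot p \<epsilon> i b) * N t i j * of_real (flat_rot p \<delta> j q)) * (U * ?R) $$ (b, q))"
      proof (intro sum.cong refl)
        fix i j assume "i \<in> {..<d}" "j \<in> {..<d}"
        then have ij: "i < d" "j < d" by auto
        have "N t i j * (?L * U) $$ (i, j) = (\<Sum>b<d. N t i j * (of_real (flat_rot p \<epsilon> i b) * U $$ (b, j)))"
          unfolding Lidx[OF ij] by (simp only: sum_distrib_left)
        also have "\<dots> = (\<Sum>b<d. \<Sum>q<d. (of_real (flat_rot p \<epsilon> i b) * N t i j * of_real (flat_rot p \<delta> j q)) * (U * ?R) $$ (b, q))"
        proof (intro sum.cong refl)
          fix b assume "b \<in> {..<d}"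
          then have bd: "b < d" by simp
          show "N t i j * (of_real (flat_rot p \<epsilon> i b) * U $$ (b, j))
            = (\<Sum>q<d. (of_real (flat_rot p \<epsilon> i b) * N t i j * of_real (flat_rot p \<delta> j q)) * (U * ?R) $$ (b, q))"
            unfolding Uidx[OF bd ij(2)] sum_distrib_left by (intro sum.cong refl) (simp only: mult_ac)
        qed
        finally show "N t i j * (?L * U) $$ (i, j) = (\<Sum>b<d. \<Sum>q<d. (of_real (flat_rot p \<epsilon> i b) * N t i j * of_real (flat_rot p \<delta> j q)) * (U * ?R) $$ (b, q))" .
      qed
      also have "\<dots> = (\<Sum>b<d. \<Sum>q<d. \<Sum>i<d. \<Sum>j<d. (of_real (flat_rot p \<epsilon> i b) * N t i j * of_real (flat_rot p \<delta> j q)) * (U * ?R) $$ (b, q))"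
        by (rule sum_swap_pairs)
      also have "\<dots> = (\<Sum>b<d. \<Sum>q<d. N' t b q * (U * ?R) $$ (b, q))"
        unfolding N'_def sum_distrib_right ..
      also have "\<dots> = (\<Sum>e\<in>\<nu>.edges. N' t (fst e) (snd e) * (U * ?R) $$ e)"
        unfolding \<nu>.edges_def sum.cartesian_product by (intro sum.cong) auto
      finally show ?thesis .
    qed
    then show ?thesis unfolding F_def F'_def by (simp only:)
  qed
  have "(\<integral>U. F U \<partial>\<mu>) = (\<integral>U. F (?L * U) \<partial>\<mu>)"
    using integral_left_mult[OF LG(1) bm_measurable[OF bF]] by simp
  also have "\<dots> = (\<integral>U. F' (U * ?R) \<partial>\<mu>)"
    by (intro Bochner_Integration.integral_cong refl pt) simp
  also have "\<dots> = (\<integral>W. F' W \<partial>\<nu>)"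
  proof -
    have "(\<lambda>U. U * ?R) \<in> measurable \<mu> \<mu>"
      using right_mult_measurable[OF group_carrier[OF LG(2)]] by (simp add: measurable_haar measurable_cong_sets[OF refl sets_haar])
    then show ?thesis unfolding \<nu>_def by (rule integral_distr[OF _ bF', symmetric])
  qed
  finally have eq: "(\<integral>U. F U \<partial>\<mu>) = (\<integral>W. F' W \<partial>\<nu>)" .
  \<comment> \<open>A class has at most two rows, each of relative mass at most u^2 / 2^p = 2 u^2 /
    d.\<close>
  define \<kappa> where "\<kappa> = 4 * u\<^sup>2 / d"
  have d0: "real d > 0" by (simp add: d_def)
  have edge_sum: "(\<Sum>e\<in>\<nu>.edges. g (fst e) (snd e)) = (\<Sum>b<d. \<Sum>q<d. g b q)" for g :: "nat \<Rightarrow> nat \<Rightarrow> real"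
    unfolding \<nu>.edges_def sum.cartesian_product by (intro sum.cong) auto
  have s0: "s t \<ge> 0" for t unfolding s_def by (intro sum_nonneg) auto
  have k2: "2 * (u\<^sup>2 / 2 ^ p * s t) = \<kappa> * s t" for t by (simp add: \<kappa>_def d_def field_simps)
  have class_le: "(\<Sum>x\<in>{x. x < d \<and> \<nu>.cls x = \<nu>.cls y}. g x) \<le> 2 * B"
    if "y < d" "\<And>x. x < d \<Longrightarrow> g x \<le> B" "\<And>x. 0 \<le> g x" for g :: "nat \<Rightarrow> real" and y B
  proof -
    have "{x. x < d \<and> \<nu>.cls x = \<nu>.cls y} \<subseteq> {y, bar y}" using that(1) \<nu>.cls_eq_iff by auto
    then have "(\<Sum>x\<in>{x. x < d \<and> \<nu>.cls x = \<nu>.cls y}. g x) \<le> (\<Sum>x\<in>{y, bar y}. g x)"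
      using that(3) by (intro sum_mono2) auto
    also have "\<dots> \<le> g y + g (bar y)" using that(3) by (cases "y = bar y") auto
    also have "\<dots> \<le> 2 * B" using that(1) that(2)[of y] that(2)[of "bar y"] by simp
    finally show ?thesis .
  qed
  have rowc: "(\<Sum>e'\<in>{e' \<in> \<nu>.edges. \<nu>.cls (fst e') = \<nu>.cls (fst e)}. (cmod (N' t (fst e') (snd e')))\<^sup>2)
      \<le> \<kappa> * (\<Sum>e\<in>\<nu>.edges. (cmod (N' t (fst e) (snd e)))\<^sup>2)" if "t < T" "e \<in> \<nu>.edges" for t e
  proof -
    have "{e' \<in> \<nu>.edges. \<nu>.cls (fst e') = \<nu>.cls (fst e)} = {x. x < d \<and> \<nu>.cls x = \<nu>.cls (fst e)} \<times> {..<d}"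
      by (auto simp: \<nu>.edges_def)
    then have "(\<Sum>e'\<in>{e' \<in> \<nu>.edges. \<nu>.cls (fst e') = \<nu>.cls (fst e)}. (cmod (N' t (fst e') (snd e')))\<^sup>2)
       = (\<Sum>x\<in>{x. x < d \<and> \<nu>.cls x = \<nu>.cls (fst e)}. \<Sum>q<d. (cmod (N' t x q))\<^sup>2)"
      by (simp add: sum.cartesian_product case_prod_unfold)
    also have "\<dots> \<le> 2 * (u\<^sup>2 / 2 ^ p * s t)"
      using that row[OF that(1)] by (intro class_le) (auto simp: \<nu>.edges_def sum_nonneg)
    finally show ?thesis unfolding k2 edge_sum[of "\<lambda>b q. (cmod (N' t b q))\<^sup>2"] tot[OF that(1)] .
  qed
  have colc: "(\<Sum>e'\<in>{e' \<in> \<nu>.edges. \<nu>.cls (snd e') = \<nu>.cls (snd e)}. (cmod (N' t (fst e') (snd e')))\<^sup>2)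
      \<le> \<kappa> * (\<Sum>e\<in>\<nu>.edges. (cmod (N' t (fst e) (snd e)))\<^sup>2)" if "t < T" "e \<in> \<nu>.edges" for t e
  proof -
    have "{e' \<in> \<nu>.edges. \<nu>.cls (snd e') = \<nu>.cls (snd e)} = {..<d} \<times> {x. x < d \<and> \<nu>.cls x = \<nu>.cls (snd e)}"
      by (auto simp: \<nu>.edges_def)
    then have "(\<Sum>e'\<in>{e' \<in> \<nu>.edges. \<nu>.cls (snd e') = \<nu>.cls (snd e)}. (cmod (N' t (fst e') (snd e')))\<^sup>2)
       = (\<Sum>q<d. \<Sum>x\<in>{x. x < d \<and> \<nu>.cls x = \<nu>.cls (snd e)}. (cmod (N' t q x))\<^sup>2)"
      by (simp add: sum.cartesian_product case_prod_unfold)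
    also have "\<dots> = (\<Sum>x\<in>{x. x < d \<and> \<nu>.cls x = \<nu>.cls (snd e)}. \<Sum>q<d. (cmod (N' t q x))\<^sup>2)"
      by (rule sum.swap)
    also have "\<dots> \<le> 2 * (u\<^sup>2 / 2 ^ p * s t)"
      using that col[OF that(1)] by (intro class_le) (auto simp: \<nu>.edges_def sum_nonneg)
    finally show ?thesis unfolding k2 edge_sum[of "\<lambda>b q. (cmod (N' t b q))\<^sup>2"] tot[OF that(1)] .
  qed
  have err: "path_error T d = 2 * real T ^ 2 / d + 4 * T * sqrt (2 * T / d) + 4 * real T ^ 2 * \<kappa>"
    by (simp add: path_error_def \<kappa>_def u_def)
  have \<kappa>0: "\<kappa> \<ge> 0" by (simp add: \<kappa>_def)
  \<comment> \<open>The three terms are nonnegative, so the bound 1/2 on their sum holds for each of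
    them.\<close>
  have p3: "2 * real T ^ 2 / d \<le> 1 / 2" "4 * T * sqrt (2 * T / d) \<le> 1 / 2" "4 * real T ^ 2 * \<kappa> \<le> 1 / 2"
  proof -
    have "0 \<le> 2 * real T ^ 2 / d" "0 \<le> 4 * T * sqrt (2 * T / d)" "0 \<le> 4 * real T ^ 2 * \<kappa>"
      using \<kappa>0 d0 by auto
    then show "2 * real T ^ 2 / d \<le> 1 / 2" "4 * T * sqrt (2 * T / d) \<le> 1 / 2" "4 * real T ^ 2 * \<kappa> \<le> 1 / 2"
      using T(2) unfolding err by linarith+
  qed
  have T1: "4 * real T * \<kappa> \<le> 1"
  proof -
    have "1 \<le> real T" using T(1) by simp
    then have "real T * 1 \<le> real T * real T" by (intro mult_left_mono) auto
    then have "4 * \<kappa> * (real T * 1) \<le> 4 * \<kappa> * (real T * real T)"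
      by (rule mult_left_mono) (use \<kappa>0 in simp)
    also have "\<dots> = 4 * real T ^ 2 * \<kappa>" by (simp add: power2_eq_square)
    finally have "4 * real T * \<kappa> \<le> 4 * real T ^ 2 * \<kappa>" by (simp add: mult_ac)
    then show ?thesis using p3(3) by linarith
  qed
  have "real (2 * T\<^sup>2) \<le> real d"
  proof -
    have "2 * real T ^ 2 \<le> 1 / 2 * d" using p3(1) d0 by (simp add: pos_divide_le_eq)
    then show ?thesis using d0 by simp
  qed
  then have T2: "2 * T\<^sup>2 \<le> d" using of_nat_le_iff by blast
  have T3: "real T * sqrt (2 * T / d) \<le> 1 / 8" using p3(2) by simp
  have "(1 - 2 * real T ^ 2 / d - 4 * T * sqrt (2 * T / d) - 4 * real T ^ 2 * \<kappa>)
      * (\<Prod>t<T. (\<Sum>e\<in>\<nu>.edges. (cmod (N' t (fst e) (snd e)))\<^sup>2) / d) \<le> (\<integral>W. F' W \<partial>\<nu>)"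
    unfolding F'_def
    using \<nu>.flat_product_lower_bound[where N = "\<lambda>t e. N' t (fst e) (snd e)", OF rowc colc \<kappa>0 T1 T(1) T2] T3 by simp
  moreover have "(\<Prod>t<T. (\<Sum>e\<in>\<nu>.edges. (cmod (N' t (fst e) (snd e)))\<^sup>2) / d) = (\<Prod>t<T. s t / d)"
    by (intro prod.cong refl) (simp add: edge_sum[of "\<lambda>b q. (cmod (N' _ b q))\<^sup>2"] tot)
  ultimately have "(1 - path_error T d) * (\<Prod>t<T. s t / d) \<le> (\<integral>U. F U \<partial>\<mu>)"
    unfolding eq err by (simp add: algebra_simps)
  then show ?thesis by (simp add: F_def s_def)
qed

section \<open>Learners without quantum memory\<close>

text \<open>The recursion of \<open>run\<close> with an arbitrary payoff in place of the indicator
  of one decision, so that sums and complements of decisions can be formed.\<close>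

primrec process :: "(nat list \<Rightarrow> nat \<Rightarrow> real) \<Rightarrow> (nat list \<Rightarrow> real) \<Rightarrow> nat \<Rightarrow> nat list \<Rightarrow> real" where
  "process P w 0 h = w h"
| "process P w (Suc k) h = (\<Sum>s. P h s * process P w k (h @ [s]))"

lemma run_eq_process:
  "run L A B c k h = process (out_prob L A B) (\<lambda>h. if guess L h = c then 1 else 0) k h"
  by (induction k arbitrary: h) auto

locale stochastic =
  fixes P :: "nat list \<Rightarrow> nat \<Rightarrow> real"
  assumes nonneg: "0 \<le> P h s" and total: "P h sums 1"
begin

lemma process_bounds:
  assumes w: "\<And>h. 0 \<le> w h" "\<And>h. w h \<le> 1"
  shows "0 \<le> process P w k h" "process P w k h \<le> 1" "summable (\<lambda>s. P h s * process P w k (h' @ [s]))"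
proof -
  have *: "0 \<le> process P w k h \<and> process P w k h \<le> 1" for k h
  proof (induction k arbitrary: h)
    case (Suc k)
    have le: "P h s * process P w k (h @ [s]) \<le> P h s" "0 \<le> P h s * process P w k (h @ [s])" for s
      using Suc nonneg[of h s] by (auto simp: mult_left_le)
    have sm: "summable (\<lambda>s. P h s * process P w k (h @ [s]))"
      by (rule summable_comparison_test[OF _ sums_summable[OF total[of h]]]) (use le in \<open>auto intro!: exI[of _ 0]\<close>)
    have "(\<Sum>s. P h s * process P w k (h @ [s])) \<le> (\<Sum>s. P h s)"
      using le sm sums_summable[OF total] by (intro suminf_le) auto
    then show ?case using sums_unique[OF total[of h]] suminf_nonneg[OF sm] le by simp
  qed (use w in auto)
  show "0 \<le> process P w k h" "process P w k h \<le> 1" using * by auto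
  show "summable (\<lambda>s. P h s * process P w k (h' @ [s]))"
    by (rule summable_comparison_test[OF _ sums_summable[OF total[of h]]])
       (use * nonneg in \<open>auto intro!: exI[of _ 0] simp: mult_left_le\<close>)
qed

lemma process_add:
  assumes w: "\<And>h. 0 \<le> w h" "\<And>h. 0 \<le> v h" "\<And>h. w h + v h \<le> 1"
  shows "process P (\<lambda>h. w h + v h) k h = process P w k h + process P v k h"
proof (induction k arbitrary: h)
  case (Suc k)
  have "w h \<le> 1" "v h \<le> 1" for h using w[of h] by linarith+
  then have "summable (\<lambda>s. P h s * process P w k (h @ [s]))" "summable (\<lambda>s. P h s * process P v k (h @ [s]))"
    using w by (auto intro!: process_bounds(3))
  then show ?case by (simp add: Suc distrib_left suminf_add)
qed simp

lemma process_one: "process P (\<lambda>_. 1) k h = 1"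
  by (induction k arbitrary: h) (auto simp: sums_unique[OF total, symmetric])

lemma process_complement:
  assumes "\<And>h. 0 \<le> w h" "\<And>h. w h \<le> 1"
  shows "process P w k h = 1 - process P (\<lambda>h. 1 - w h) k h"
  using process_add[of w "\<lambda>h. 1 - w h" k h] assms by (simp add: process_one)

end

context haar_measure begin

lemma process_measurable:
  assumes "\<And>h s. (\<lambda>U. P U h s) \<in> borel_measurable \<mu>"
  shows "(\<lambda>U. process (P U) w k h) \<in> borel_measurable \<mu>"
proof (induction k arbitrary: h)
  case (Suc k)
  then show ?case using assms by (auto intro!: borel_measurable_suminf)
qed simp

text \<open>A pointwise lower bound on the averaged probability of each path transfers to the averaged
  probability of each event; only finite partial sums are exchanged with the integral.\<close>

lemma process_average_ge:
  assumes meas: "\<And>h s. (\<lambda>U. P U h s) \<in> borel_measurable \<mu>"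
    and st: "\<And>U. U \<in> G \<Longrightarrow> stochastic (P U)" and ref: "stochastic R"
    and w: "\<And>h. 0 \<le> w h" "\<And>h. w h \<le> 1"
    and path: "\<And>xs. length xs = T \<Longrightarrow> c * (\<Prod>(h, s)\<leftarrow>xs. R h s) \<le> (\<integral>U. (\<Prod>(h, s)\<leftarrow>xs. P U h s) \<partial>\<mu>)"
  shows "c * process R w T h0 \<le> (\<integral>U. process (P U) w T h0 \<partial>\<mu>)"
proof -
  interpret R: stochastic R by (rule ref)
  define X where "X xs U = (\<Prod>(h, s)\<leftarrow>xs. P U h s)" for xs U
  have X0: "0 \<le> X xs U \<and> X xs U \<le> 1" if "U \<in> G" for xs U
  proof -
    interpret stochastic "P U" using st[OF that] .
    have le1: "P U h s \<le> 1" for h s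
    proof -
      have "sum (P U h) {s} \<le> (\<Sum>s. P U h s)"
        using sums_summable[OF total[of h]] nonneg by (intro sum_le_suminf) auto
      then show ?thesis using sums_unique[OF total[of h]] by simp
    qed
    show ?thesis unfolding X_def
      by (induction xs) (use nonneg le1 in \<open>auto simp: mult_le_one\<close>)
  qed
  have Xm: "X xs \<in> borel_measurable \<mu>" for xs
    unfolding X_def[abs_def] by (induction xs) (use meas in auto)
  have Pm: "(\<lambda>U. process (P U) w k h) \<in> borel_measurable \<mu>" for k h
    by (rule process_measurable[OF meas])
  have int: "integrable \<mu> (\<lambda>U. X xs U * process (P U) w k h)" for xs k h
  proof (rule integrable_const_bound[where B = 1])
    show "AE U in \<mu>. norm (X xs U * process (P U) w k h) \<le> 1"
      using AE_in_group
    proof eventually_elim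
      case (elim U)
      interpret stochastic "P U" using st[OF elim] .
      show ?case using X0[OF elim, of xs] process_bounds(1,2)[OF w] by (simp add: abs_mult mult_le_one)
    qed
  qed (intro borel_measurable_times Xm Pm)
  \<comment> \<open>\<open>xs\<close> holds the factors of the rounds already played, latest first,
    and h is the current history. The two vary independently, which is possible because
    \<open>path\<close> covers every list of T pairs.\<close>
  have "c * ((\<Prod>(h, s)\<leftarrow>xs. R h s) * process R w k h) \<le> (\<integral>U. X xs U * process (P U) w k h \<partial>\<mu>)"
    if "length xs + k = T" for xs k h
    using that
  proof (induction k arbitrary: xs h)
    case 0
    have "(c * (\<Prod>(h, s)\<leftarrow>xs. R h s)) * w h \<le> (\<integral>U. X xs U \<partial>\<mu>) * w h"
      using path[of xs] 0 w by (intro mult_right_mono) (auto simp: X_def)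
    then show ?case by (simp add: mult.assoc)
  next
    case (Suc k)
    let ?r = "\<Prod>(h, s)\<leftarrow>xs. R h s"
    have sm: "summable (\<lambda>s. R h s * process R w k (h @ [s]))" by (rule R.process_bounds(3)[OF w])
    have "(\<Sum>s. c * ?r * (R h s * process R w k (h @ [s]))) \<le> (\<integral>U. X xs U * process (P U) w (Suc k) h \<partial>\<mu>)"
    proof (rule suminf_le_const)
      show "summable (\<lambda>s. c * ?r * (R h s * process R w k (h @ [s])))" using sm by (rule summable_mult)
      fix n
      have "(\<Sum>s<n. c * ?r * (R h s * process R w k (h @ [s])))
        \<le> (\<Sum>s<n. \<integral>U. X ((h, s) # xs) U * process (P U) w k (h @ [s]) \<partial>\<mu>)"
      proof (rule sum_mono)
        fix s
        show "c * ?r * (R h s * process R w k (h @ [s])) \<le> (\<integral>U. X ((h, s) # xs) U * process (P U) w k (h @ [s]) \<partial>\<mu>)"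
          using Suc.IH[of "(h, s) # xs" "h @ [s]"] Suc.prems by (simp add: mult_ac)
      qed
      also have "\<dots> = (\<integral>U. (\<Sum>s<n. X ((h, s) # xs) U * process (P U) w k (h @ [s])) \<partial>\<mu>)"
        by (intro Bochner_Integration.integral_sum[symmetric] int)
      also have "\<dots> \<le> (\<integral>U. X xs U * process (P U) w (Suc k) h \<partial>\<mu>)"
      proof (rule integral_mono_AE)
        show "integrable \<mu> (\<lambda>U. \<Sum>s<n. X ((h, s) # xs) U * process (P U) w k (h @ [s]))"
          by (intro Bochner_Integration.integrable_sum int)
        show "integrable \<mu> (\<lambda>U. X xs U * process (P U) w (Suc k) h)" by (rule int)
        show "AE U in \<mu>. (\<Sum>s<n. X ((h, s) # xs) U * process (P U) w k (h @ [s])) \<le> X xs U * process (P U) w (Suc k) h"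
          using AE_in_group
        proof eventually_elim
          case (elim U)
          interpret stochastic "P U" using st[OF elim] .
          have "(\<Sum>s<n. X ((h, s) # xs) U * process (P U) w k (h @ [s])) = X xs U * (\<Sum>s<n. P U h s * process (P U) w k (h @ [s]))"
            by (simp add: X_def sum_distrib_left mult_ac)
          also have "\<dots> \<le> X xs U * (\<Sum>s. P U h s * process (P U) w k (h @ [s]))"
            using X0[OF elim] process_bounds[OF w] nonneg by (intro mult_left_mono sum_le_suminf) auto
          finally show ?case by simp
        qed
      qed
      finally show "(\<Sum>s<n. c * ?r * (R h s * process R w k (h @ [s]))) \<le> (\<integral>U. X xs U * process (P U) w (Suc k) h \<partial>\<mu>)" .
    qed
    then have "c * ?r * (\<Sum>s. R h s * process R w k (h @ [s])) \<le> (\<integral>U. X xs U * process (P U) w (Suc k) h \<partial>\<mu>)"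
      unfolding suminf_mult[OF sm, of "c * ?r"] .
    then show ?case by (simp only: process.simps mult.assoc)
  qed
  from this[of "[]" T h0] show ?thesis by (simp add: X_def)
qed

end

text \<open>The input state after the matrix unit at \<open>(i, j)\<close> has acted on the first register.\<close>

definition unit_applied :: "learner \<Rightarrow> nat list \<Rightarrow> nat \<Rightarrow> nat \<Rightarrow> nat \<Rightarrow> complex" where
  "unit_applied L h i j x = (if x div 2 ^ aux L = i then state L h $ (j * 2 ^ aux L + x mod 2 ^ aux L) else 0)"

text \<open>Outcome probabilities of the completely depolarizing channel.\<close>

definition ref_prob :: "nat \<Rightarrow> learner \<Rightarrow> nat list \<Rightarrow> nat \<Rightarrow> real" where
  "ref_prob n L h s = (\<Sum>i<2 ^ n. \<Sum>j<2 ^ n.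
     Re (qform (meas L h s) (vec (2 ^ (n + aux L)) (unit_applied L h i j)))) / 2 ^ n"

definition applied :: "nat \<Rightarrow> learner \<Rightarrow> complex mat \<Rightarrow> nat list \<Rightarrow> complex vec" where
  "applied n L U h = vec (2 ^ (n + aux L)) (\<lambda>x. \<Sum>i<2 ^ n. \<Sum>j<2 ^ n. U $$ (i, j) * unit_applied L h i j x)"

lemma sum_div_mod:
  fixes f :: "nat \<Rightarrow> nat \<Rightarrow> 'a::comm_monoid_add"
  assumes "a > 0"
  shows "(\<Sum>x<d * a. f (x div a) (x mod a)) = (\<Sum>i<d. \<Sum>b<a. f i b)"
proof -
  have "(\<Sum>i<d. \<Sum>b<a. f i b) = (\<Sum>(i, b)\<in>{..<d} \<times> {..<a}. f i b)"
    by (rule sum.cartesian_product)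
  also have "\<dots> = (\<Sum>x<d * a. f (x div a) (x mod a))"
  proof (rule sum.reindex_bij_witness[of _ "\<lambda>x. (x div a, x mod a)" "\<lambda>(i, b). i * a + b"])
    fix y assume "y \<in> {..<d} \<times> {..<a}"
    then obtain i b where y: "y = (i, b)" "i < d" "b < a" by auto
    have "i * a + b < Suc i * a" using y by simp
    also have "\<dots> \<le> d * a" using y by (intro mult_right_mono) auto
    finally show "(case y of (i, b) \<Rightarrow> i * a + b) \<in> {..<d * a}" using y by simp
    show "((case y of (i, b) \<Rightarrow> i * a + b) div a, (case y of (i, b) \<Rightarrow> i * a + b) mod a) = y" using y by simp
    show "f ((case y of (i, b) \<Rightarrow> i * a + b) div a) ((case y of (i, b) \<Rightarrow> i * a + b) mod a) = (case y of (i, b) \<Rightarrow> f i b)"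
      using y by simp
  qed (use assms in \<open>auto simp: less_mult_imp_div_less\<close>)
  finally show ?thesis ..
qed

lemma kron_apply_state:
  assumes U: "U \<in> carrier_mat (2 ^ n) (2 ^ n)" and x: "x < 2 ^ (n + aux L)"
  shows "(\<Sum>y<2 ^ (n + aux L). kron U (1\<^sub>m (2 ^ aux L)) $$ (x, y) * state L h $ y) = applied n L U h $ x"
proof -
  let ?d = "2 ^ n :: nat" and ?a = "2 ^ aux L :: nat"
  have D: "2 ^ (n + aux L) = ?d * ?a" by (simp add: power_add)
  have xd: "x div ?a < ?d" using x unfolding D by (rule less_mult_imp_div_less)
  have "(\<Sum>y<?d * ?a. kron U (1\<^sub>m ?a) $$ (x, y) * state L h $ y)
    = (\<Sum>y<?d * ?a. U $$ (x div ?a, y div ?a) * (if x mod ?a = y mod ?a then 1 else 0) * state L h $ (y div ?a * ?a + y mod ?a))"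
    using U x unfolding D div_mult_mod_eq by (intro sum.cong refl) (auto simp: kron_def)
  also have "\<dots> = (\<Sum>j<?d. \<Sum>b<?a. U $$ (x div ?a, j) * (if x mod ?a = b then 1 else 0) * state L h $ (j * ?a + b))"
    by (rule sum_div_mod[where f = "\<lambda>j b. U $$ (x div ?a, j) * (if x mod ?a = b then 1 else 0) * state L h $ (j * ?a + b)"]) simp
  also have "\<dots> = (\<Sum>j<?d. U $$ (x div ?a, j) * state L h $ (j * ?a + x mod ?a))"
  proof (intro sum.cong refl)
    fix j
    have "(\<Sum>b<?a. U $$ (x div ?a, j) * (if x mod ?a = b then 1 else 0) * state L h $ (j * ?a + b))
      = (\<Sum>b<?a. if b = x mod ?a then U $$ (x div ?a, j) * state L h $ (j * ?a + b) else 0)"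
      by (intro sum.cong) auto
    then show "(\<Sum>b<?a. U $$ (x div ?a, j) * (if x mod ?a = b then 1 else 0) * state L h $ (j * ?a + b))
      = U $$ (x div ?a, j) * state L h $ (j * ?a + x mod ?a)" by simp
  qed
  also have "\<dots> = (\<Sum>i<?d. if i = x div ?a then (\<Sum>j<?d. U $$ (i, j) * state L h $ (j * ?a + x mod ?a)) else 0)"
    using xd by simp
  also have "\<dots> = (\<Sum>i<?d. \<Sum>j<?d. U $$ (i, j) * unit_applied L h i j x)"
    by (intro sum.cong refl) (auto simp: unit_applied_def)
  finally show ?thesis using x by (simp add: applied_def D)
qed

text \<open>The input stays pure: the measured state is the projection onto v = (U \<otimes> 1)
  \<phi>, and its trace against the effect is the quadratic form at v.\<close>

lemma out_prob_qform:
  assumes L: "valid_learner n L" and U: "U \<in> carrier_mat (2 ^ n) (2 ^ n)"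
  shows "out_prob L U (adj U) h s = Re (qform (meas L h s) (applied n L U h))"
proof -
  let ?d = "2 ^ n :: nat" and ?a = "2 ^ aux L :: nat" and ?D = "2 ^ (n + aux L) :: nat"
  let ?K = "kron U (1\<^sub>m ?a)" and ?K' = "kron (adj U) (1\<^sub>m ?a)" and ?v = "applied n L U h" and ?\<phi> = "state L h"
  have D: "?D = ?d * ?a" by (simp add: power_add)
  have \<phi>: "?\<phi> \<in> carrier_vec ?D" using L by (auto simp: valid_learner_def)
  have F: "meas L h s \<in> carrier_mat ?D ?D"
    using L by (auto simp: valid_learner_def is_povm_def psd_def)
  have aU: "adj U \<in> carrier_mat ?d ?d" using U by simp
  note dims = carrier_matD[OF U] carrier_matD[OF aU]
  have K: "?K \<in> carrier_mat ?D ?D" "?K' \<in> carrier_mat ?D ?D"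
    unfolding carrier_mat_def by (auto simp: kron_def D dims)
  have O: "outer ?\<phi> \<in> carrier_mat ?D ?D" using \<phi> by (auto simp: outer_def)
  have KO: "?K * outer ?\<phi> \<in> carrier_mat ?D ?D" using mult_carrier_mat[OF K(1) O] .
  have KOK: "?K * outer ?\<phi> * ?K' \<in> carrier_mat ?D ?D" using mult_carrier_mat[OF KO K(2)] .
  have K'idx: "?K' $$ (y, z) = cnj (?K $$ (z, y))" if "y < ?D" "z < ?D" for y z
  proof -
    have "y div ?a < ?d" "z div ?a < ?d" using that unfolding D by (auto intro: less_mult_imp_div_less)
    then show ?thesis using that adj_index[OF U] by (auto simp: kron_def D dims)
  qed
  have KOidx: "(?K * outer ?\<phi>) $$ (x, y) = ?v $ x * cnj (?\<phi> $ y)" if "x < ?D" "y < ?D" for x y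
  proof -
    have "(?K * outer ?\<phi>) $$ (x, y) = (\<Sum>z<?D. ?K $$ (x, z) * ?\<phi> $ z) * cnj (?\<phi> $ y)"
      unfolding mat_mult_index_sum[OF K(1) O that] sum_distrib_right
      using that \<phi> by (intro sum.cong refl) (auto simp: outer_def)
    then show ?thesis unfolding kron_apply_state[OF U that(1)] .
  qed
  have idx: "(?K * outer ?\<phi> * ?K') $$ (x, z) = ?v $ x * cnj (?v $ z)" if "x < ?D" "z < ?D" for x z
  proof -
    have "(?K * outer ?\<phi> * ?K') $$ (x, z) = (\<Sum>y<?D. ?v $ x * cnj (?K $$ (z, y) * ?\<phi> $ y))"
      unfolding mat_mult_index_sum[OF KO K(2) that]
      using that by (intro sum.cong refl) (simp add: KOidx K'idx del: index_mult_mat)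
    also have "\<dots> = ?v $ x * cnj (\<Sum>y<?D. ?K $$ (z, y) * ?\<phi> $ y)"
      by (simp only: cnj_sum sum_distrib_left)
    finally show ?thesis unfolding kron_apply_state[OF U that(2)] .
  qed
  have dv: "dim_vec ?v = ?D" by (simp add: applied_def)
  have "mtrace (meas L h s * (?K * outer ?\<phi> * ?K')) = (\<Sum>x<?D. \<Sum>y<?D. meas L h s $$ (x, y) * (?v $ y * cnj (?v $ x)))"
  proof -
    have "dim_row (meas L h s * (?K * outer ?\<phi> * ?K')) = ?D" using F by simp
    then have "mtrace (meas L h s * (?K * outer ?\<phi> * ?K')) = (\<Sum>x<?D. (meas L h s * (?K * outer ?\<phi> * ?K')) $$ (x, x))"
      by (simp only: mtrace_def)
    also have "\<dots> = (\<Sum>x<?D. \<Sum>y<?D. meas L h s $$ (x, y) * (?v $ y * cnj (?v $ x)))"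
    proof (intro sum.cong refl)
      fix x assume "x \<in> {..<?D}"
      then have x: "x < ?D" by simp
      show "(meas L h s * (?K * outer ?\<phi> * ?K')) $$ (x, x) = (\<Sum>y<?D. meas L h s $$ (x, y) * (?v $ y * cnj (?v $ x)))"
        unfolding mat_mult_index_sum[OF F KOK x x] by (intro sum.cong refl) (simp only: idx x lessThan_iff)
    qed
    finally show ?thesis .
  qed
  also have "\<dots> = qform (meas L h s) ?v" unfolding qform_def dv by (simp add: mult_ac)
  finally show ?thesis by (simp add: out_prob_def)
qed

lemma unitary_preserves_norm:
  assumes U: "U \<in> unitary_group d"
  shows "(\<Sum>i<d. (cmod (\<Sum>j<d. U $$ (i, j) * v j))\<^sup>2) = (\<Sum>j<d. (cmod (v j))\<^sup>2)"
proof -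
  have "complex_of_real (\<Sum>i<d. (cmod (\<Sum>j<d. U $$ (i, j) * v j))\<^sup>2)
     = (\<Sum>i<d. \<Sum>j<d. \<Sum>k<d. (U $$ (i, j) * cnj (U $$ (i, k))) * (v j * cnj (v k)))"
    unfolding of_real_sum
    by (intro sum.cong refl) (simp only: complex_norm_square cnj_sum sum_product, simp add: mult_ac)
  also have "\<dots> = (\<Sum>j<d. \<Sum>k<d. \<Sum>i<d. (U $$ (i, j) * cnj (U $$ (i, k))) * (v j * cnj (v k)))"
    by (subst sum.swap) (intro sum.cong refl sum.swap)
  also have "\<dots> = (\<Sum>j<d. \<Sum>k<d. (\<Sum>i<d. U $$ (i, j) * cnj (U $$ (i, k))) * (v j * cnj (v k)))"
    by (simp only: sum_distrib_right)
  also have "\<dots> = (\<Sum>j<d. \<Sum>k<d. if j = k then v j * cnj (v j) else 0)"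
    by (intro sum.cong refl) (simp add: unitary_cols[OF U])
  also have "\<dots> = (\<Sum>j<d. v j * cnj (v j))" by simp
  also have "\<dots> = of_real (\<Sum>j<d. (cmod (v j))\<^sup>2)"
    by (simp only: of_real_sum complex_norm_square)
  finally show ?thesis by (simp only: of_real_eq_iff)
qed

lemma sqnorm_state:
  assumes L: "valid_learner n L"
  shows "(\<Sum>j<2 ^ n. \<Sum>b<2 ^ aux L. (cmod (state L h $ (j * 2 ^ aux L + b)))\<^sup>2) = 1"
proof -
  have "dim_vec (state L h) = 2 ^ (n + aux L)" "sqnorm (state L h) = 1"
    using L by (auto simp: valid_learner_def dest: carrier_vecD)
  then have "(\<Sum>x<2 ^ n * 2 ^ aux L. (cmod (state L h $ (x div 2 ^ aux L * 2 ^ aux L + x mod 2 ^ aux L)))\<^sup>2) = 1"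
    unfolding sqnorm_def power_add div_mult_mod_eq by simp
  then show ?thesis
    using sum_div_mod[of "2 ^ aux L" "\<lambda>j b. (cmod (state L h $ (j * 2 ^ aux L + b)))\<^sup>2" "2 ^ n"] by simp
qed

lemma sqnorm_applied:
  assumes L: "valid_learner n L" and U: "U \<in> unitary_group (2 ^ n)"
  shows "sqnorm (applied n L U h) = 1"
proof -
  let ?d = "2 ^ n :: nat" and ?a = "2 ^ aux L :: nat"
  have D: "2 ^ (n + aux L) = ?d * ?a" by (simp add: power_add)
  have v: "applied n L U h $ x = (\<Sum>j<?d. U $$ (x div ?a, j) * state L h $ (j * ?a + x mod ?a))" if "x < ?d * ?a" for x
  proof -
    have "x div ?a < ?d" using that by (rule less_mult_imp_div_less)
    then have "(\<Sum>j<?d. U $$ (x div ?a, j) * state L h $ (j * ?a + x mod ?a))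
      = (\<Sum>i<?d. if i = x div ?a then (\<Sum>j<?d. U $$ (i, j) * state L h $ (j * ?a + x mod ?a)) else 0)" by simp
    also have "\<dots> = (\<Sum>i<?d. \<Sum>j<?d. U $$ (i, j) * unit_applied L h i j x)"
      by (intro sum.cong refl) (auto simp: unit_applied_def)
    finally show ?thesis using that by (simp add: applied_def D)
  qed
  have "sqnorm (applied n L U h) = (\<Sum>x<?d * ?a. (cmod (\<Sum>j<?d. U $$ (x div ?a, j) * state L h $ (j * ?a + x mod ?a)))\<^sup>2)"
  proof -
    have "dim_vec (applied n L U h) = ?d * ?a" by (simp add: applied_def D)
    then show ?thesis unfolding sqnorm_def by (intro sum.cong) (auto simp: v)
  qed
  also have "\<dots> = (\<Sum>i<?d. \<Sum>b<?a. (cmod (\<Sum>j<?d. U $$ (i, j) * state L h $ (j * ?a + b)))\<^sup>2)"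
    by (rule sum_div_mod[where f = "\<lambda>i b. (cmod (\<Sum>j<?d. U $$ (i, j) * state L h $ (j * ?a + b)))\<^sup>2"]) simp
  also have "\<dots> = (\<Sum>b<?a. \<Sum>i<?d. (cmod (\<Sum>j<?d. U $$ (i, j) * state L h $ (j * ?a + b)))\<^sup>2)"
    by (rule sum.swap)
  also have "\<dots> = (\<Sum>b<?a. \<Sum>j<?d. (cmod (state L h $ (j * ?a + b)))\<^sup>2)"
    by (intro sum.cong refl unitary_preserves_norm[OF U])
  also have "\<dots> = (\<Sum>j<?d. \<Sum>b<?a. (cmod (state L h $ (j * ?a + b)))\<^sup>2)"
    by (rule sum.swap)
  finally show ?thesis using sqnorm_state[OF L] by simp
qed

lemma out_prob_stochastic:
  assumes L: "valid_learner n L" and U: "U \<in> unitary_group (2 ^ n)"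
  shows "stochastic (out_prob L U (adj U))"
proof
  fix h s
  have c: "U \<in> carrier_mat (2 ^ n) (2 ^ n)" using U by (rule unitary_group_carrier)
  have v: "applied n L U h \<in> carrier_vec (2 ^ (n + aux L))" by (simp add: applied_def)
  have P: "is_povm (2 ^ (n + aux L)) (meas L h)" using L by (simp add: valid_learner_def)
  show "0 \<le> out_prob L U (adj U) h s"
    unfolding out_prob_qform[OF L c] using P v by (auto simp: is_povm_def psd_def)
  have "(\<lambda>s. Re (qform (meas L h s) (applied n L U h))) sums sqnorm (applied n L U h)"
    using P v by (auto simp: is_povm_def)
  then show "out_prob L U (adj U) h sums 1"
    unfolding sqnorm_applied[OF L U] out_prob_qform[OF L c, of h, symmetric] by simp
qed

text \<open>The matrix units divided by sqrt d are Kraus operators of the depolarizing channel. For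
  fixed i the vectors over all j have total squared norm 1, and the sum over the d values of i
  cancels the division by d.\<close>

lemma ref_prob_stochastic:
  assumes L: "valid_learner n L"
  shows "stochastic (ref_prob n L)"
proof
  fix h s
  let ?d = "2 ^ n :: nat" and ?a = "2 ^ aux L :: nat" and ?D = "2 ^ (n + aux L) :: nat"
  have D: "?D = ?d * ?a" by (simp add: power_add)
  have P: "is_povm ?D (meas L h)" using L by (simp add: valid_learner_def)
  let ?w = "\<lambda>i j. vec ?D (unit_applied L h i j)"
  have w: "?w i j \<in> carrier_vec ?D" for i j by simp
  show "0 \<le> ref_prob n L h s"
    unfolding ref_prob_def using P w by (intro divide_nonneg_nonneg sum_nonneg) (auto simp: is_povm_def psd_def)
  have sq: "sqnorm (?w i j) = (\<Sum>b<?a. (cmod (state L h $ (j * ?a + b)))\<^sup>2)" if "i < ?d" for i j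
  proof -
    have "sqnorm (?w i j) = (\<Sum>x<?d * ?a. if x div ?a = i then (cmod (state L h $ (j * ?a + x mod ?a)))\<^sup>2 else 0)"
      unfolding sqnorm_def D by (intro sum.cong) (auto simp: unit_applied_def)
    also have "\<dots> = (\<Sum>k<?d. \<Sum>b<?a. if k = i then (cmod (state L h $ (j * ?a + b)))\<^sup>2 else 0)"
      by (rule sum_div_mod[where f = "\<lambda>k b. if k = i then (cmod (state L h $ (j * ?a + b)))\<^sup>2 else 0"]) simp
    also have "\<dots> = (\<Sum>k<?d. if k = i then (\<Sum>b<?a. (cmod (state L h $ (j * ?a + b)))\<^sup>2) else 0)"
      by (intro sum.cong) auto
    finally show ?thesis using that by simp
  qed
  have "(\<lambda>s. \<Sum>i<?d. \<Sum>j<?d. Re (qform (meas L h s) (?w i j))) sums (\<Sum>i<?d. \<Sum>j<?d. sqnorm (?w i j))"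
    using P w by (intro sums_sum) (auto simp: is_povm_def)
  also have "(\<Sum>i<?d. \<Sum>j<?d. sqnorm (?w i j)) = (\<Sum>i<?d. 1)"
    using sqnorm_state[OF L, of h] by (intro sum.cong refl) (simp add: sq)
  finally have "(\<lambda>s. (\<Sum>i<?d. \<Sum>j<?d. Re (qform (meas L h s) (?w i j))) / 2 ^ n) sums (2 ^ n / 2 ^ n)"
    by (intro sums_divide) simp
  then show "ref_prob n L h sums 1" by (simp add: ref_prob_def[abs_def])
qed

text \<open>Writing the effect as a sum of squares with vectors w_r makes every summand a squared
  linear form in U, whose coefficient at (i, j) is the inner product of w_r with the input state
  after the matrix unit at (i, j). The depolarizing probability is the sum of the squared
  coefficients over d, so both laws split along the same r.\<close>

lemma outcome_rank_one_decomposition: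
  assumes L: "valid_learner n L"
  shows "\<exists>N. (\<forall>U\<in>carrier_mat (2 ^ n) (2 ^ n). out_prob L U (adj U) h s
        = (\<Sum>r<(2::nat) ^ (n + aux L). (cmod (\<Sum>i<2 ^ n. \<Sum>j<2 ^ n. N r i j * U $$ (i, j)))\<^sup>2)) \<and>
      ref_prob n L h s = (\<Sum>r<(2::nat) ^ (n + aux L). (\<Sum>i<2 ^ n. \<Sum>j<2 ^ n. (cmod (N r i j))\<^sup>2) / 2 ^ n)"
proof -
  let ?d = "2 ^ n :: nat" and ?D = "2 ^ (n + aux L) :: nat"
  let ?F = "meas L h s"
  have psd: "psd ?D ?F" using L by (simp add: valid_learner_def is_povm_def)
  then have F: "?F \<in> carrier_mat ?D ?D" "adj ?F = ?F" by (auto simp: psd_def)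
  have q: "qform ?F (vec ?D v) = (\<Sum>x<?D. \<Sum>y<?D. cnj (v x) * ?F $$ (x, y) * v y)" for v
    unfolding qform_def by (intro sum.cong refl) auto
  have "\<exists>w. \<forall>v. (\<Sum>x<?D. \<Sum>y<?D. cnj (v x) * ?F $$ (x, y) * v y)
     = of_real (\<Sum>r<?D. (cmod (\<Sum>x<?D. cnj (w r x) * v x))\<^sup>2)"
  proof (rule psd_form_sum_squares)
    show "?F $$ (j, i) = cnj (?F $$ (i, j))" if "i \<in> {..<?D}" "j \<in> {..<?D}" for i j
      using adj_index[OF F(1), of j i] that F(2) by simp
    show "0 \<le> Re (\<Sum>x<?D. \<Sum>y<?D. cnj (v x) * ?F $$ (x, y) * v y)" for v
      using psd vec_carrier[of ?D v] unfolding q[symmetric] psd_def by blast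
  qed simp
  then obtain w where w: "\<And>v. (\<Sum>x<?D. \<Sum>y<?D. cnj (v x) * ?F $$ (x, y) * v y)
     = of_real (\<Sum>r<?D. (cmod (\<Sum>x<?D. cnj (w r x) * v x))\<^sup>2)" by blast
  have q': "Re (qform ?F (vec ?D v)) = (\<Sum>r<?D. (cmod (\<Sum>x<?D. cnj (w r x) * v x))\<^sup>2)" for v
    unfolding q w by (rule Re_complex_of_real)
  define N where "N r i j = (\<Sum>x<?D. cnj (w r x) * unit_applied L h i j x)" for r i j
  have out: "out_prob L U (adj U) h s = (\<Sum>r<?D. (cmod (\<Sum>i<?d. \<Sum>j<?d. N r i j * U $$ (i, j)))\<^sup>2)"
    if U: "U \<in> carrier_mat ?d ?d" for U
  proof -
    have "(\<Sum>x<?D. cnj (w r x) * (\<Sum>i<?d. \<Sum>j<?d. U $$ (i, j) * unit_applied L h i j x))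
      = (\<Sum>i<?d. \<Sum>j<?d. N r i j * U $$ (i, j))" for r
    proof -
      have "(\<Sum>x<?D. cnj (w r x) * (\<Sum>i<?d. \<Sum>j<?d. U $$ (i, j) * unit_applied L h i j x))
        = (\<Sum>x<?D. \<Sum>i<?d. \<Sum>j<?d. cnj (w r x) * unit_applied L h i j x * U $$ (i, j))"
        unfolding sum_distrib_left by (intro sum.cong refl) (metis mult.commute mult.assoc)
      also have "\<dots> = (\<Sum>i<?d. \<Sum>j<?d. \<Sum>x<?D. cnj (w r x) * unit_applied L h i j x * U $$ (i, j))"
        by (subst sum.swap) (intro sum.cong refl sum.swap)
      finally show ?thesis by (simp only: N_def sum_distrib_right)
    qed
    then show ?thesis unfolding out_prob_qform[OF L U] applied_def q' by simp
  qed
  have ref: "ref_prob n L h s = (\<Sum>r<?D. (\<Sum>i<?d. \<Sum>j<?d. (cmod (N r i j))\<^sup>2) / 2 ^ n)"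
  proof -
    have "ref_prob n L h s = (\<Sum>i<?d. \<Sum>j<?d. \<Sum>r<?D. (cmod (N r i j))\<^sup>2) / 2 ^ n"
      unfolding ref_prob_def q' N_def ..
    also have "(\<Sum>i<?d. \<Sum>j<?d. \<Sum>r<?D. (cmod (N r i j))\<^sup>2) = (\<Sum>i<?d. \<Sum>r<?D. \<Sum>j<?d. (cmod (N r i j))\<^sup>2)"
      by (intro sum.cong refl sum.swap)
    also have "\<dots> = (\<Sum>r<?D. \<Sum>i<?d. \<Sum>j<?d. (cmod (N r i j))\<^sup>2)"
      by (rule sum.swap)
    finally show ?thesis by (simp only: sum_divide_distrib)
  qed
  show ?thesis by (intro exI[of _ N] conjI ballI out ref)
qed

text \<open>The dimension is written as 2 * 2^p to match the two blocks of the flattening matrices.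
  \<open>symmetric\<close> ranges over all Haar probabilities because it is applied to a right
  translate of \<mu>.\<close>

locale channel_class = haar_measure "2 * 2 ^ p" G \<mu> for p G \<mu> +
  fixes bar :: "nat \<Rightarrow> nat"
  assumes symmetric: "\<And>\<nu>. haar_prob (2 * 2 ^ p) G \<nu> \<Longrightarrow> haar_symmetric (2 * 2 ^ p) G \<nu> bar"
    and mult_closed: "\<And>U V. U \<in> G \<Longrightarrow> V \<in> G \<Longrightarrow> U * V \<in> G"
    and flat_closed: "\<And>\<epsilon>. (\<And>i. \<epsilon> i = 1 \<or> \<epsilon> i = (-1::real)) \<Longrightarrow> flat_mat p \<epsilon> \<in> G"
begin

lemma out_prob_measurable:
  assumes L: "valid_learner (Suc p) L"
  shows "(\<lambda>U. out_prob L U (adj U) h s) \<in> borel_measurable \<mu>"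
proof -
  obtain N where N: "\<And>U. U \<in> carrier_mat (2 * 2 ^ p) (2 * 2 ^ p) \<Longrightarrow> out_prob L U (adj U) h s
        = (\<Sum>r<(2::nat) ^ (Suc p + aux L). (cmod (\<Sum>i<2 * 2 ^ p. \<Sum>j<2 * 2 ^ p. N r i j * U $$ (i, j)))\<^sup>2)"
    using outcome_rank_one_decomposition[OF L, of h s] unfolding power_Suc[of 2 p] by blast
  have "(\<lambda>U. \<Sum>r<(2::nat) ^ (Suc p + aux L). (cmod (\<Sum>i<2 * 2 ^ p. \<Sum>j<2 * 2 ^ p. N r i j * U $$ (i, j)))\<^sup>2) \<in> borel_measurable \<mu>"
    by (intro bm_measurable bm_sum bm_norm_square bm_mult bm_const bm_entry) auto
  then show ?thesis using measurable_cong[of \<mu>, OF N] by simp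
qed

lemma out_prob_stochastic_group:
  assumes "valid_learner (Suc p) L" "U \<in> G"
  shows "stochastic (out_prob L U (adj U))"
  using out_prob_stochastic[OF assms(1)] assms(2) unitary unfolding power_Suc[of 2 p] by blast

text \<open>The product over rounds of sums of rank-one pieces expands into a sum over choices g of
  one piece per round, and the bound for products of linear forms applies to each g
  separately.\<close>

lemma path_average_ge:
  assumes L: "valid_learner (Suc p) L" and err: "path_error (length xs) (2 * 2 ^ p) \<le> 1 / 2"
  shows "(1 - path_error (length xs) (2 * 2 ^ p)) * (\<Prod>(h, s)\<leftarrow>xs. ref_prob (Suc p) L h s)
    \<le> (\<integral>U. (\<Prod>(h, s)\<leftarrow>xs. out_prob L U (adj U) h s) \<partial>\<mu>)"
proof (cases "xs = []")
  \<comment> \<open>The product bound assumes a positive number of factors; for the empty path the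
    error is 0 and both sides are 1.\<close>
  case True
  then show ?thesis using prob_space by (simp add: path_error_def del: space_haar)
next
  case False
  define T where "T = length xs"
  let ?d = "2 * 2 ^ p :: nat" and ?R = "{..<(2::nat) ^ (Suc p + aux L)}"
  have T: "0 < T" using False by (simp add: T_def)
  have "\<forall>t. \<exists>N. (\<forall>U\<in>carrier_mat ?d ?d. out_prob L U (adj U) (fst (xs ! t)) (snd (xs ! t))
        = (\<Sum>r\<in>?R. (cmod (\<Sum>i<?d. \<Sum>j<?d. N r i j * U $$ (i, j)))\<^sup>2)) \<and>
      ref_prob (Suc p) L (fst (xs ! t)) (snd (xs ! t)) = (\<Sum>r\<in>?R. (\<Sum>i<?d. \<Sum>j<?d. (cmod (N r i j))\<^sup>2) / real ?d)"
    using outcome_rank_one_decomposition[OF L] by simp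
  from choice[OF this] obtain N where out: "\<And>t U. U \<in> carrier_mat ?d ?d \<Longrightarrow> out_prob L U (adj U) (fst (xs ! t)) (snd (xs ! t))
        = (\<Sum>r\<in>?R. (cmod (\<Sum>i<?d. \<Sum>j<?d. N t r i j * U $$ (i, j)))\<^sup>2)"
    and ref: "\<And>t. ref_prob (Suc p) L (fst (xs ! t)) (snd (xs ! t)) = (\<Sum>r\<in>?R. (\<Sum>i<?d. \<Sum>j<?d. (cmod (N t r i j))\<^sup>2) / real ?d)"
    by blast
  define F where "F g U = (\<Prod>t<T. (cmod (\<Sum>i<?d. \<Sum>j<?d. N t (g t) i j * U $$ (i, j)))\<^sup>2)" for g and U :: "complex mat"
  have path: "(\<Prod>(h, s)\<leftarrow>xs. f h s) = (\<Prod>t<T. f (fst (xs ! t)) (snd (xs ! t)))" for f :: "nat list \<Rightarrow> nat \<Rightarrow> real"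
    unfolding prod.list_conv_set_nth T_def by (auto simp: case_prod_unfold atLeast0LessThan intro!: prod.cong)
  have intF: "integrable \<mu> (F g)" for g
    unfolding F_def[abs_def] by (intro bm_integrable bm_prod bm_norm_square bm_sum bm_mult bm_const bm_entry) auto
  have "(1 - path_error T ?d) * (\<Prod>(h, s)\<leftarrow>xs. ref_prob (Suc p) L h s)
    = (\<Sum>g\<in>PiE {..<T} (\<lambda>_. ?R). (1 - path_error T ?d) * (\<Prod>t<T. (\<Sum>i<?d. \<Sum>j<?d. (cmod (N t (g t) i j))\<^sup>2) / real ?d))"
    unfolding path ref sum_distrib_left[symmetric] by (subst prod_sum_PiE) auto
  also have "\<dots> \<le> (\<Sum>g\<in>PiE {..<T} (\<lambda>_. ?R). \<integral>U. F g U \<partial>\<mu>)"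
    unfolding F_def
  proof (rule sum_mono)
    fix g
    show "(1 - path_error T ?d) * (\<Prod>t<T. (\<Sum>i<?d. \<Sum>j<?d. (cmod (N t (g t) i j))\<^sup>2) / real ?d)
      \<le> (\<integral>U. (\<Prod>t<T. (cmod (\<Sum>i<?d. \<Sum>j<?d. N t (g t) i j * U $$ (i, j)))\<^sup>2) \<partial>\<mu>)"
      using product_lower_bound[OF haar unitary symmetric mult_closed flat_closed T, of "\<lambda>t. N t (g t)"] err
      by (simp add: T_def)
  qed
  also have "\<dots> = (\<integral>U. (\<Sum>g\<in>PiE {..<T} (\<lambda>_. ?R). F g U) \<partial>\<mu>)"
    by (intro Bochner_Integration.integral_sum[symmetric] intF)
  also have "\<dots> = (\<integral>U. (\<Prod>(h, s)\<leftarrow>xs. out_prob L U (adj U) h s) \<partial>\<mu>)"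
  proof (rule Bochner_Integration.integral_cong[OF refl])
    fix U assume "U \<in> space \<mu>"
    then have U: "U \<in> carrier_mat ?d ?d" by simp
    show "(\<Sum>g\<in>PiE {..<T} (\<lambda>_. ?R). F g U) = (\<Prod>(h, s)\<leftarrow>xs. out_prob L U (adj U) h s)"
      unfolding path out[OF U] F_def by (subst prod_sum_PiE) auto
  qed
  finally show ?thesis by (simp add: T_def)
qed

text \<open>The path bound is applied to the complementary payoff, and complementing once more gives
  an upper bound. The relative error becomes an additive one because depolarizing values are at most
  1.\<close>

lemma average_run_le:
  assumes L: "valid_learner (Suc p) L" and err: "path_error (real T) (2 * 2 ^ p) \<le> 1 / 2"
  shows "integrable \<mu> (\<lambda>U. run L U (adj U) c T [])"
    and "(\<integral>U. run L U (adj U) c T [] \<partial>\<mu>)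
      \<le> process (ref_prob (Suc p) L) (\<lambda>h. if guess L h = c then 1 else 0) T [] + path_error (real T) (2 * 2 ^ p)"
proof -
  let ?\<delta> = "path_error (real T) (2 * 2 ^ p)" and ?w = "\<lambda>h. if guess L h = c then 1 else 0 :: real"
  let ?P = "\<lambda>U. out_prob L U (adj U)" and ?R = "ref_prob (Suc p) L"
  interpret R: stochastic ?R by (rule ref_prob_stochastic[OF L])
  have int: "integrable \<mu> (\<lambda>U. process (?P U) w T [])" if w: "\<And>h. 0 \<le> w h" "\<And>h. w h \<le> 1" for w
  proof (rule integrable_const_bound[where B = 1])
    show "AE U in \<mu>. norm (process (?P U) w T []) \<le> 1"
      using AE_in_group
    proof eventually_elim
      case (elim U)
      interpret stochastic "?P U" using out_prob_stochastic_group[OF L elim] .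
      show ?case using process_bounds(1,2)[OF w] by simp
    qed
  qed (intro process_measurable out_prob_measurable L)
  have w: "0 \<le> ?w h" "?w h \<le> 1" "0 \<le> 1 - ?w h" "1 - ?w h \<le> 1" for h by auto
  show "integrable \<mu> (\<lambda>U. run L U (adj U) c T [])"
    unfolding run_eq_process by (rule int[OF w(1,2)])
  have "(1 - ?\<delta>) * process ?R (\<lambda>h. 1 - ?w h) T [] \<le> (\<integral>U. process (?P U) (\<lambda>h. 1 - ?w h) T [] \<partial>\<mu>)"
  proof (rule process_average_ge[OF out_prob_measurable[OF L] out_prob_stochastic_group[OF L] R.stochastic_axioms w(3,4)])
    fix xs :: "(nat list \<times> nat) list" assume "length xs = T"
    then show "(1 - ?\<delta>) * (\<Prod>(h, s)\<leftarrow>xs. ?R h s) \<le> (\<integral>U. (\<Prod>(h, s)\<leftarrow>xs. ?P U h s) \<partial>\<mu>)"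
      using path_average_ge[OF L, of xs] err by simp
  qed
  also have "(\<integral>U. process (?P U) (\<lambda>h. 1 - ?w h) T [] \<partial>\<mu>) = (\<integral>U. 1 - process (?P U) ?w T [] \<partial>\<mu>)"
  proof (rule integral_cong_AE)
    show "AE U in \<mu>. process (?P U) (\<lambda>h. 1 - ?w h) T [] = 1 - process (?P U) ?w T []"
      using AE_in_group
    proof eventually_elim
      case (elim U)
      interpret stochastic "?P U" using out_prob_stochastic_group[OF L elim] .
      show ?case using process_complement[of ?w T "[]"] w(1,2) by simp
    qed
  qed (intro borel_measurable_diff borel_measurable_const process_measurable out_prob_measurable L)+
  also have "\<dots> = 1 - (\<integral>U. process (?P U) ?w T [] \<partial>\<mu>)"
    using int[OF w(1,2)] prob_space by (simp del: space_haar)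
  finally have *: "(1 - ?\<delta>) * process ?R (\<lambda>h. 1 - ?w h) T [] \<le> 1 - (\<integral>U. process (?P U) ?w T [] \<partial>\<mu>)" .
  have "0 \<le> ?\<delta>" by (auto simp: path_error_def intro!: add_nonneg_nonneg)
  then have "?\<delta> * process ?R (\<lambda>h. 1 - ?w h) T [] \<le> ?\<delta>"
    using R.process_bounds(2)[OF w(3,4)] by (simp add: mult_left_le)
  then show "(\<integral>U. run L U (adj U) c T [] \<partial>\<mu>) \<le> process ?R ?w T [] + ?\<delta>"
    using * R.process_complement[of ?w T "[]", OF w(1,2)] unfolding run_eq_process
    by (simp add: left_diff_distrib)
qed

end

lemma sum_guess_prob_le_1:
  assumes "stochastic P"
  shows "process P (\<lambda>h. if g h = (0::nat) then 1 else 0) k h + process P (\<lambda>h. if g h = 1 then 1 else 0) k h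
    + process P (\<lambda>h. if g h = 2 then 1 else 0) k h \<le> 1"
proof -
  interpret stochastic P by fact
  have "process P (\<lambda>h. if g h = (0::nat) then 1 else 0) k h + process P (\<lambda>h. if g h = 1 then 1 else 0) k h
      = process P (\<lambda>h. (if g h = 0 then 1 else 0) + (if g h = 1 then 1 else 0)) k h"
    by (rule process_add[symmetric]) auto
  also have "\<dots> + process P (\<lambda>h. if g h = 2 then 1 else 0) k h
      = process P (\<lambda>h. ((if g h = 0 then 1 else 0) + (if g h = 1 then 1 else 0)) + (if g h = 2 then 1 else 0)) k h"
    by (rule process_add[symmetric]) auto
  also have "\<dots> \<le> 1" by (rule process_bounds(2)) auto
  finally show ?thesis .
qed

lemma success_prob_le:
  assumes n: "n = Suc p" and U: "haar_prob (2 ^ n) (unitary_group (2 ^ n)) \<mu>U"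
    and Q: "haar_prob (2 ^ n) (orthogonal_group (2 ^ n)) \<mu>O"
    and S: "haar_prob (2 ^ n) (symplectic_group (2 ^ n)) \<mu>S"
    and L: "valid_learner n L" and err: "path_error (real T) (2 ^ n) \<le> 1 / 2"
  shows "success_prob L T \<mu>U \<mu>O \<mu>S \<le> 1 / 3 + path_error (real T) (2 ^ n)"
proof -
  let ?\<delta> = "path_error (real T) (2 ^ n)" and ?r = "\<lambda>c. process (ref_prob n L) (\<lambda>h. if guess L h = c then 1 else 0) T []"
  have d: "2 ^ n = 2 * 2 ^ p" "(2::real) ^ n = 2 * 2 ^ p" by (simp_all add: n)
  have L': "valid_learner (Suc p) L" and err': "path_error (real T) (2 * 2 ^ p) \<le> 1 / 2"
    using L err by (simp_all add: n)
  interpret U: channel_class p "unitary_group (2 * 2 ^ p)" \<mu>U "\<lambda>i. i"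
    using U unfolding d
    by (intro channel_class.intro haar_measure.intro channel_class_axioms.intro
        unitary_haar_symmetric unitary_group_mult subsetD[OF orthogonal_group_subset flat_mat_orthogonal] subset_refl) simp_all
  interpret O: channel_class p "orthogonal_group (2 * 2 ^ p)" \<mu>O "\<lambda>i. i"
    using Q unfolding d
    by (intro channel_class.intro haar_measure.intro channel_class_axioms.intro
        orthogonal_haar_symmetric orthogonal_group_mult flat_mat_orthogonal orthogonal_group_subset) simp_all
  interpret S: channel_class p "symplectic_group (2 * 2 ^ p)" \<mu>S "spbar (2 ^ p)"
    using S unfolding d
    by (intro channel_class.intro haar_measure.intro channel_class_axioms.intro
        symplectic_haar_symmetric symplectic_group_mult flat_mat_symplectic symplectic_group_subset) simp_all
  have u: "(\<integral>U. run L U (adj U) 0 T [] \<partial>\<mu>U) \<le> ?r 0 + ?\<delta>"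
    using U.average_run_le(2)[OF L' err', of 0] by (simp add: n)
  have s: "(\<integral>U. run L U (adj U) 2 T [] \<partial>\<mu>S) \<le> ?r 2 + ?\<delta>"
    using S.average_run_le(2)[OF L' err', of 2] by (simp add: n)
  \<comment> \<open>Transpose and adjoint agree on the group but not for all matrices in the space,
    so integrability of the run with the transpose is split off as a case. A function that is not
    integrable has integral 0 by convention, which satisfies the bound.\<close>
  have o: "(\<integral>Q. run L Q (transpose_mat Q) 1 T [] \<partial>\<mu>O) \<le> ?r 1 + ?\<delta>"
  proof (cases "integrable \<mu>O (\<lambda>Q. run L Q (transpose_mat Q) 1 T [])")
    case True
    have "(\<integral>Q. run L Q (transpose_mat Q) 1 T [] \<partial>\<mu>O) = (\<integral>Q. run L Q (adj Q) 1 T [] \<partial>\<mu>O)"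
    proof (rule integral_cong_AE)
      show "AE Q in \<mu>O. run L Q (transpose_mat Q) 1 T [] = run L Q (adj Q) 1 T []"
        using O.AE_in_group by eventually_elim (simp add: orthogonal_group_def)
    qed (intro borel_measurable_integrable True O.average_run_le(1)[OF L' err'])+
    then show ?thesis using O.average_run_le(2)[OF L' err', of 1] by (simp add: n)
  next
    case False
    interpret stochastic "ref_prob n L" by (rule ref_prob_stochastic[OF L])
    have "0 \<le> ?r 1" by (rule process_bounds(1)) auto
    moreover have "0 \<le> ?\<delta>" by (auto simp: path_error_def intro!: add_nonneg_nonneg)
    ultimately show ?thesis using False by (simp add: not_integrable_integral_eq)
  qed
  show ?thesis
    using u o s sum_guess_prob_le_1[OF ref_prob_stochastic[OF L], of "guess L" T "[]"]
    by (simp add: success_prob_def)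
qed

text \<open>Squaring preserves the order once the logarithm is nonnegative, which the lower bounds 1
  on T and d provide.\<close>

lemma path_error_mono:
  assumes "1 \<le> T" "T \<le> X" "1 \<le> d"
  shows "path_error T d \<le> path_error X d"
proof -
  have d2: "1 \<le> d\<^sup>2" using assms(3) by simp
  have "1 * 1 \<le> 4 * T * d\<^sup>2" using assms d2 by (intro mult_mono) auto
  then have "0 \<le> ln (4 * T * d\<^sup>2)" by simp
  moreover have "ln (4 * T * d\<^sup>2) \<le> ln (4 * X * d\<^sup>2)"
    using assms d2 \<open>1 * 1 \<le> 4 * T * d\<^sup>2\<close> by (intro ln_mono mult_right_mono) auto
  ultimately have "(ln (4 * T * d\<^sup>2) + 1 / 2)\<^sup>2 \<le> (ln (4 * X * d\<^sup>2) + 1 / 2)\<^sup>2"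
    by (intro power_mono) auto
  moreover have "T\<^sup>2 \<le> X\<^sup>2" using assms by (intro power_mono) auto
  ultimately show ?thesis
    unfolding path_error_def using assms
    by (intro add_mono mult_mono divide_right_mono real_sqrt_le_mono) auto
qed

text \<open>The dominant term T sqrt (2 T / d) is of order x^(3/7 - 1/2) = x^(-1/14).\<close>

lemma path_error_vanishes: "((\<lambda>x::real. path_error (x powr (2 / 7)) x) \<longlongrightarrow> 0) at_top"
  unfolding path_error_def by real_asymp

theorem mainTheorem18:
  shows "\<exists>c > 0. \<exists>N. \<forall>n \<ge> N. \<forall>\<mu>U \<mu>O \<mu>S.
     haar_prob (2 ^ n) (unitary_group (2 ^ n)) \<mu>U \<and>
     haar_prob (2 ^ n) (orthogonal_group (2 ^ n)) \<mu>O \<and>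
     haar_prob (2 ^ n) (symplectic_group (2 ^ n)) \<mu>S \<longrightarrow>
     (\<forall>(L :: learner) (T :: nat). valid_learner n L \<and> success_prob L T \<mu>U \<mu>O \<mu>S \<ge> 2/3 \<longrightarrow>
        real T \<ge> c * 2 powr (2 * real n / 7))"
proof -
  \<comment> \<open>The value 1/4 is below the gap 1/3 between the demanded success 2/3 and blind
    guessing, and below the 1/2 under which \<open>success_prob_le\<close> applies.\<close>
  have "eventually (\<lambda>x::real. path_error (x powr (2 / 7)) x < 1 / 4) at_top"
    using path_error_vanishes by (rule order_tendstoD) simp
  then obtain x0 where x0: "\<And>x. x0 \<le> x \<Longrightarrow> path_error (x powr (2 / 7)) x < 1 / 4"
    unfolding eventually_at_top_linorder by blast
  \<comment> \<open>The lower bound 1 on n makes the dimension 2 * 2^(n - 1), as the pairing of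
    indices and the flattening matrices require.\<close>
  have lower: "2 powr (2 * real n / 7) \<le> real T"
    if n: "n \<ge> max 1 (nat \<lceil>x0\<rceil>)" and haar: "haar_prob (2 ^ n) (unitary_group (2 ^ n)) \<mu>U"
      "haar_prob (2 ^ n) (orthogonal_group (2 ^ n)) \<mu>O" "haar_prob (2 ^ n) (symplectic_group (2 ^ n)) \<mu>S"
      and L: "valid_learner n L" and success: "2 / 3 \<le> success_prob L T \<mu>U \<mu>O \<mu>S"
    for n \<mu>U \<mu>O \<mu>S L T
  proof (rule ccontr)
    assume "\<not> 2 powr (2 * real n / 7) \<le> real T"
    then have T: "real T \<le> 2 powr (2 * real n / 7)" by simp
    have X: "2 powr (2 * real n / 7) = (2 ^ n) powr (2 / 7)"
      by (simp add: powr_realpow[symmetric] powr_powr mult.commute)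
    have "x0 \<le> real n" using n by linarith
    also have "\<dots> \<le> 2 ^ n" using of_nat_less_two_power[of n, where 'a = real] by simp
    finally have "x0 \<le> 2 ^ n" .
    then have X4: "path_error ((2 ^ n) powr (2 / 7)) (2 ^ n) < 1 / 4" by (rule x0)
    have "path_error (real T) (2 ^ n) < 1 / 4"
    proof (cases "T = 0")
      \<comment> \<open>Monotonicity of the error starts at T = 1; at T = 0 all three terms
        vanish.\<close>
      case True
      then show ?thesis by (simp add: path_error_def)
    next
      case False
      then have "path_error (real T) (2 ^ n) \<le> path_error ((2 ^ n) powr (2 / 7)) (2 ^ n)"
        using T unfolding X by (intro path_error_mono) auto
      then show ?thesis using X4 by simp
    qed
    moreover have "n = Suc (n - 1)" using n by simp
    ultimately show False
      using success_prob_le[of n "n - 1" \<mu>U \<mu>O \<mu>S L T] haar L success by simp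
  qed
  show ?thesis
    by (intro exI[of _ "1::real"] conjI exI[of _ "max 1 (nat \<lceil>x0\<rceil>)"] allI impI) (use lower in auto)
qed

end
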